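(* Let $X$ be a subshift, let $R$ be a field, and let $I$ be a left ideal of the unital subshift algebra $\widetilde{\mathcal A}_R(X)$. Then $I$ is minimal if and only if $I$ is isomorphic, as a left $\widetilde{\mathcal A}_R(X)$-module, to $\widetilde{\mathcal A}_R(X)\,p_A$ for some $A\in\mathcal Q_X$.
   Context: Notation: $\mathbb N=\{0,1,2,\dots\}$. Let $\mathfrak A$ be a nonempty set (the alphabet) and let $\mathfrak A^*$ be the set of finite words over $\mathfrak A$, including the empty word $\omega$. For a nonempty word $\beta$, $\beta^\infty=\beta\beta\beta\cdots\in\mathfrak A^{\mathbb N}$. A subshift over $\mathfrak A$ is a set $X\subseteq\mathfrak A^{\mathbb N}$ of the form $X=X_F$ for some $F\subseteq\mathfrak A^*$, where $X_F$ is the set of all sequences in which no word of $F$ occurs as a block. The language $\mathcal L_X$ is the set of all finite words (including $\omega$) occurring in some element of $X$. For $\alpha,\beta\in\mathcal L_X$ put $C(\alpha,\beta)=\{\beta x\in X:\alpha x\in X\}$. Let $\mathcal U$ be the Boolean algebra of subsets of $X$ generated by all $C(\alpha,\beta)$, $\alpha,\beta\in\mathcal L_X$ (closed under finite unions, finite intersections and complements in $X$). The unital subshift algebra $\widetilde{\mathcal A}_R(X)$ is the universal unital (associative) $R$-algebra with generators $\{p_A:A\in\mathcal U\}$ and $\{s_a,s_a^*:a\in\mathfrak A\}$ subject to: (i) $p_X=1$, $p_{A\cap B}=p_Ap_B$, $p_{A\cup B}=p_A+p_B-p_{A\cap B}$, $p_\emptyset=0$ for all $A,B\in\mathcal U$;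 (ii) $s_as_a^*s_a=s_a$ and $s_a^*s_as_a^*=s_a^*$ for all $a\in\mathfrak A$; (iii) $s_\beta s_\alpha^*s_\alpha s_\beta^*=p_{C(\alpha,\beta)}$ for all $\alpha,\beta\in\mathcal L_X$, where $s_\omega=s_\omega^*=1$, $s_\alpha=s_{\alpha_1}\cdots s_{\alpha_n}$ and $s_\alpha^*=s_{\alpha_n}^*\cdots s_{\alpha_1}^*$ for $\alpha=\alpha_1\cdots\alpha_n$. $\mathcal Q_X$ denotes the set of all one-point sets $\{p\}\in\mathcal U$ such that $p\neq\alpha\beta^\infty$ for all $\alpha,\beta\in\mathcal L_X$ with $\beta\ne\omega$; its elements are called irrational paths. A minimal left ideal is a nonzero left ideal containing no left ideals other than $0$ and itself.
   Formalization: It is additionally assumed that, when X is nonempty, every letter of the alphabet occurs in X; with an unused letter u, s_u is nearly unconstrained and the claim fails, e.g. for X={n(n+1)(n+2)...} over N with an extra letter u. *)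

theory Defs
  imports
    "HOL-Algebra.QuotRing"
    "HOL-Library.Omega_Words_Fun"
    "HOL-Library.Poly_Mapping"
begin

section \<open>One-sided subshifts\<close>

text \<open>
  The alphabet is a set \<open>\<AA>\<close> of letters. Sequences are the \<open>\<omega>\<close>-words
  of \<^theory>\<open>HOL-Library.Omega_Words_Fun\<close>, so \<open>\<beta> \<frown> x\<close> is the concatenation \<open>\<beta>x\<close>
  and \<open>\<beta>\<^sup>\<omega>\<close> is the periodic sequence \<open>\<beta>\<beta>\<beta>\<dots>\<close> for \<open>\<beta> \<noteq> []\<close>.
\<close>

definition occurs_in :: "'a list \<Rightarrow> 'a word \<Rightarrow> bool" where
  "occurs_in w x \<longleftrightarrow> (\<exists>i j. w = x [i \<rightarrow> j])"

definition avoiding :: "'a set \<Rightarrow> 'a list set \<Rightarrow> 'a word set" where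
  "avoiding \<AA> F = {x. range x \<subseteq> \<AA> \<and> (\<forall>w\<in>F. \<not> occurs_in w x)}"

definition subshift :: "'a set \<Rightarrow> 'a word set \<Rightarrow> bool" where
  "subshift \<AA> X \<longleftrightarrow> (\<exists>F\<subseteq>lists \<AA>. X = avoiding \<AA> F)"

definition language :: "'a word set \<Rightarrow> 'a list set" where
  "language X = insert [] {w. \<exists>x\<in>X. occurs_in w x}"

definition follower_cylinder :: "'a word set \<Rightarrow> 'a list \<Rightarrow> 'a list \<Rightarrow> 'a word set" where
  "follower_cylinder X \<alpha> \<beta> = {\<beta> \<frown> x | x. \<beta> \<frown> x \<in> X \<and> \<alpha> \<frown> x \<in> X}"

inductive_set shift_sets :: "'a word set \<Rightarrow> 'a word set set" for X where
  base: "\<alpha> \<in> language X \<Longrightarrow> \<beta> \<in> language X \<Longrightarrow> follower_cylinder X \<alpha> \<beta> \<in> shift_sets X"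
| space: "X \<in> shift_sets X"
| union: "A \<in> shift_sets X \<Longrightarrow> B \<in> shift_sets X \<Longrightarrow> A \<union> B \<in> shift_sets X"
| inter: "A \<in> shift_sets X \<Longrightarrow> B \<in> shift_sets X \<Longrightarrow> A \<inter> B \<in> shift_sets X"
| compl: "A \<in> shift_sets X \<Longrightarrow> X - A \<in> shift_sets X"

definition irrational_paths :: "'a word set \<Rightarrow> 'a word set set" where
  "irrational_paths X =
     {{p} | p. {p} \<in> shift_sets X \<and>
        (\<forall>\<alpha>\<in>language X. \<forall>\<beta>\<in>language X. \<beta> \<noteq> [] \<longrightarrow> p \<noteq> \<alpha> \<frown> \<beta>\<^sup>\<omega>)}"


section \<open>Free associative unital algebras\<close>

text \<open>
  Lists form the free monoid under concatenation, written additively because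
  \<^theory>\<open>HOL-Library.Poly_Mapping\<close> builds monoid rings over additive monoids. Hence the type
  \<open>'g list \<Rightarrow>\<^sub>0 'r\<close>, with the multiplication of \<^theory>\<open>HOL-Library.Poly_Mapping\<close>, is the ring
  of noncommutative polynomials in variables \<open>'g\<close> with coefficients in \<open>'r\<close>.
\<close>

instantiation list :: (type) monoid_add
begin

definition zero_list :: "'a list" where "zero_list = []"

definition plus_list :: "'a list \<Rightarrow> 'a list \<Rightarrow> 'a list" where "plus_list xs ys = xs @ ys"

instance
  by intro_classes (simp_all add: zero_list_def plus_list_def)

end

text \<open>
  The free unital \<open>'r\<close>-algebra on the set \<open>G\<close>: only words over \<open>G\<close> may have a nonzero
  coefficient. Scalars sit inside as the multiples of the empty word, which are central as
  \<open>'r\<close> is commutative; so ideals and left ideals of this ring, or of a quotient of it, are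
  automatically \<open>'r\<close>-submodules, and it suffices to record the ring structure.
\<close>

definition free_algebra :: "'g set \<Rightarrow> ('g list \<Rightarrow>\<^sub>0 'r::comm_ring_1) ring" where
  "free_algebra G =
     \<lparr>carrier = {f. Poly_Mapping.keys f \<subseteq> lists G}, mult = (*), one = 1, zero = 0, add = (+)\<rparr>"

definition var :: "'g \<Rightarrow> ('g list \<Rightarrow>\<^sub>0 'r::comm_ring_1)" where
  "var g = Poly_Mapping.single [g] 1"

lemma ring_free_algebra: "ring (free_algebra G :: ('g list \<Rightarrow>\<^sub>0 'r::comm_ring_1) ring)"
proof -
  have mult: "Poly_Mapping.keys (f * g) \<subseteq> lists G"
    if "Poly_Mapping.keys f \<subseteq> lists G" "Poly_Mapping.keys g \<subseteq> lists G"
    for f g :: "'g list \<Rightarrow>\<^sub>0 'r"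
    using keys_mult[of f g] that by (fastforce simp: plus_list_def)
  have add: "Poly_Mapping.keys (f + g) \<subseteq> lists G"
    if "Poly_Mapping.keys f \<subseteq> lists G" "Poly_Mapping.keys g \<subseteq> lists G"
    for f g :: "'g list \<Rightarrow>\<^sub>0 'r"
    using Poly_Mapping.keys_add[of f g] that by blast
  have one: "Poly_Mapping.keys (1 :: 'g list \<Rightarrow>\<^sub>0 'r) \<subseteq> lists G"
    by (simp add: zero_list_def)
  show ?thesis
  proof (rule ringI)
    show "abelian_group (free_algebra G :: ('g list \<Rightarrow>\<^sub>0 'r) ring)"
    proof (rule abelian_groupI)
      fix x :: "'g list \<Rightarrow>\<^sub>0 'r" assume "x \<in> carrier (free_algebra G)"
      then show "\<exists>y\<in>carrier (free_algebra G). y \<oplus>\<^bsub>free_algebra G\<^esub> x = \<zero>\<^bsub>free_algebra G\<^esub>"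
        by (intro bexI[of _ "- x"]) (auto simp: free_algebra_def)
    qed (auto simp: free_algebra_def add.assoc add.commute dest: subsetD[OF add])
    show "monoid (free_algebra G :: ('g list \<Rightarrow>\<^sub>0 'r) ring)"
      by (rule monoidI)
        (use one in \<open>auto simp: free_algebra_def mult.assoc dest: subsetD[OF mult]\<close>)
  qed (auto simp: free_algebra_def distrib_left distrib_right)
qed

lemma var_closed: "g \<in> G \<Longrightarrow> var g \<in> carrier (free_algebra G)"
  by (simp add: free_algebra_def var_def)


section \<open>The unital subshift algebra\<close>

datatype 'a generator = P "'a word set" | S 'a | S_star 'a

definition generators :: "'a set \<Rightarrow> 'a word set \<Rightarrow> 'a generator set" where
  "generators \<AA> X = P ` shift_sets X \<union> S ` \<AA> \<union> S_star ` \<AA>"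

definition s_word :: "'a list \<Rightarrow> ('a generator list \<Rightarrow>\<^sub>0 'r::comm_ring_1)" where
  "s_word \<alpha> = prod_list (map (\<lambda>a. var (S a)) \<alpha>)"

definition s_star_word :: "'a list \<Rightarrow> ('a generator list \<Rightarrow>\<^sub>0 'r::comm_ring_1)" where
  "s_star_word \<alpha> = prod_list (map (\<lambda>a. var (S_star a)) (rev \<alpha>))"

text \<open>Each relation \<open>l = r\<close> is encoded by the element \<open>l - r\<close>.\<close>

definition relators :: "'a set \<Rightarrow> 'a word set \<Rightarrow> ('a generator list \<Rightarrow>\<^sub>0 'r::comm_ring_1) set" where
  "relators \<AA> X =
     {var (P X) - 1, var (P {})}
     \<union> {var (P (A \<inter> B)) - var (P A) * var (P B) | A B.
          A \<in> shift_sets X \<and> B \<in> shift_sets X}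
     \<union> {var (P (A \<union> B)) - (var (P A) + var (P B) - var (P (A \<inter> B))) | A B.
          A \<in> shift_sets X \<and> B \<in> shift_sets X}
     \<union> {var (S a) * var (S_star a) * var (S a) - var (S a) | a. a \<in> \<AA>}
     \<union> {var (S_star a) * var (S a) * var (S_star a) - var (S_star a) | a. a \<in> \<AA>}
     \<union> {s_word \<beta> * s_star_word \<alpha> * s_word \<alpha> * s_star_word \<beta>
           - var (P (follower_cylinder X \<alpha> \<beta>)) | \<alpha> \<beta>.
          \<alpha> \<in> language X \<and> \<beta> \<in> language X}"

definition relation_ideal :: "'a set \<Rightarrow> 'a word set \<Rightarrow> ('a generator list \<Rightarrow>\<^sub>0 'r::comm_ring_1) set" where
  "relation_ideal \<AA> X = Idl\<^bsub>free_algebra (generators \<AA> X)\<^esub> (relators \<AA> X)"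

definition subshift_algebra ::
  "'a set \<Rightarrow> 'a word set \<Rightarrow> ('a generator list \<Rightarrow>\<^sub>0 'r::comm_ring_1) set ring" where
  "subshift_algebra \<AA> X = free_algebra (generators \<AA> X) Quot relation_ideal \<AA> X"

lemma language_subset_lists:
  assumes "subshift \<AA> X"
  shows "language X \<subseteq> lists \<AA>"
  using assms by (auto simp: subshift_def avoiding_def language_def occurs_in_def subsequence_def
      image_subset_iff)

lemma relators_closed:
  assumes "subshift \<AA> X"
  shows "(relators \<AA> X :: ('a generator list \<Rightarrow>\<^sub>0 'r::comm_ring_1) set)
     \<subseteq> carrier (free_algebra (generators \<AA> X))"
proof -
  define C where "C = carrier (free_algebra (generators \<AA> X) :: ('a generator list \<Rightarrow>\<^sub>0 'r) ring)"
  interpret F: ring "free_algebra (generators \<AA> X) :: ('a generator list \<Rightarrow>\<^sub>0 'r) ring"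
    by (rule ring_free_algebra)
  have mult: "f * g \<in> C" if "f \<in> C" "g \<in> C" for f g
    using F.m_closed[of f g] that by (simp add: C_def free_algebra_def)
  have add: "f + g \<in> C" if "f \<in> C" "g \<in> C" for f g
    using F.a_closed[of f g] that by (simp add: C_def free_algebra_def)
  have neg: "- f \<in> C" if "f \<in> C" for f
    using that by (simp add: C_def free_algebra_def)
  have diff: "f - g \<in> C" if "f \<in> C" "g \<in> C" for f g
    using add[OF that(1) neg[OF that(2)]] by simp
  have one: "1 \<in> C"
    using F.one_closed by (simp add: C_def free_algebra_def)
  have vP: "var (P A) \<in> C" if "A \<in> shift_sets X" for A
    unfolding C_def using that by (intro var_closed) (auto simp: generators_def)
  have vS: "var (S a) \<in> C" and vT: "var (S_star a) \<in> C" if "a \<in> \<AA>" for a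
    unfolding C_def using that by (intro var_closed; auto simp: generators_def)+
  have prod: "prod_list fs \<in> C" if "\<And>f. f \<in> set fs \<Longrightarrow> f \<in> C" for fs
    using that by (induction fs) (auto intro: one mult)
  have sw: "s_word \<alpha> \<in> C" and sw': "s_star_word \<alpha> \<in> C" if "\<alpha> \<in> language X" for \<alpha>
    using language_subset_lists[OF assms] that
    by (auto simp: s_word_def s_star_word_def dest!: subsetD intro!: prod vS vT)
  have "{} \<in> shift_sets X"
    using shift_sets.compl[OF shift_sets.space, of X] by simp
  then have "relators \<AA> X \<subseteq> C"
    unfolding relators_def
    by (auto intro!: diff add mult one vP vS vT sw sw' shift_sets.intros)
  then show ?thesis
    by (simp add: C_def)
qed

lemma ring_subshift_algebra:
  assumes "subshift \<AA> X"
  shows "ring (subshift_algebra \<AA> X :: ('a generator list \<Rightarrow>\<^sub>0 'r::comm_ring_1) set ring)"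
  unfolding subshift_algebra_def relation_ideal_def
  by (intro ideal.quotient_is_ring ring.genideal_ideal ring_free_algebra relators_closed assms)

definition p_elem ::
  "'a set \<Rightarrow> 'a word set \<Rightarrow> 'a word set \<Rightarrow> ('a generator list \<Rightarrow>\<^sub>0 'r::comm_ring_1) set" where
  "p_elem \<AA> X A = relation_ideal \<AA> X +>\<^bsub>free_algebra (generators \<AA> X)\<^esub> var (P A)"


section \<open>Left ideals of noncommutative rings\<close>

definition left_ideal :: "'c set \<Rightarrow> ('c, 'm) ring_scheme \<Rightarrow> bool" where
  "left_ideal I A \<longleftrightarrow>
     additive_subgroup I A \<and> (\<forall>a\<in>carrier A. \<forall>x\<in>I. a \<otimes>\<^bsub>A\<^esub> x \<in> I)"

definition minimal_left_ideal :: "'c set \<Rightarrow> ('c, 'm) ring_scheme \<Rightarrow> bool" where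
  "minimal_left_ideal I A \<longleftrightarrow>
     left_ideal I A \<and> I \<noteq> {\<zero>\<^bsub>A\<^esub>} \<and>
     (\<forall>J. left_ideal J A \<and> J \<subseteq> I \<longrightarrow> J = {\<zero>\<^bsub>A\<^esub>} \<or> J = I)"

definition principal_left_ideal :: "('c, 'm) ring_scheme \<Rightarrow> 'c \<Rightarrow> 'c set" where
  "principal_left_ideal A e = {a \<otimes>\<^bsub>A\<^esub> e | a. a \<in> carrier A}"

definition left_module_isomorphic :: "('c, 'm) ring_scheme \<Rightarrow> 'c set \<Rightarrow> 'c set \<Rightarrow> bool" where
  "left_module_isomorphic A I J \<longleftrightarrow>
     (\<exists>f. bij_betw f I J \<and>
        (\<forall>x\<in>I. \<forall>y\<in>I. f (x \<oplus>\<^bsub>A\<^esub> y) = f x \<oplus>\<^bsub>A\<^esub> f y) \<and>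
        (\<forall>a\<in>carrier A. \<forall>x\<in>I. f (a \<otimes>\<^bsub>A\<^esub> x) = a \<otimes>\<^bsub>A\<^esub> f x))"

end

theory Submission
  imports Defs
begin

text \<open>
  Every element of the algebra is a combination of monomials \<open>s\<^sub>\<alpha> p\<^sub>A s\<^sub>\<beta>\<^sup>*\<close>. Multiplying a nonzero
  element \<open>x\<close> on the right by a suitable \<open>s\<^sub>\<nu> p\<^sub>B\<close>, then on the left by the adjoint of a shortest
  word that occurs, gives \<open>p\<^sub>B + \<Sum>\<^sub>\<gamma> c\<^sub>\<gamma> s\<^sub>\<gamma> p\<^sub>B\<close> with all \<open>\<gamma>\<close> nonempty. If some \<open>b \<in> B\<close> satisfies \<open>\<gamma>b \<noteq> b\<close>
  for all these \<open>\<gamma>\<close>, cutting down to a small cylinder around \<open>b\<close> leaves an idempotent \<open>p\<^sub>D\<close>; otherwise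
  \<open>B\<close> is finite and one can cut down to a single periodic point \<open>b\<close>.

  Right multiplication carries a minimal left ideal isomorphically onto any nonzero image, so a
  minimal left ideal is isomorphic to one containing an element of one of these two kinds. The
  periodic kind is impossible because multiplication by \<open>p\<^sub>b - s\<^sub>\<beta> p\<^sub>b\<close>, with \<open>\<beta>b = b\<close>, is injective
  but not surjective, as in Laurent polynomials. In the idempotent kind, minimality forces \<open>D\<close> to be
  a single point, and this point not to be eventually periodic. Conversely, for an irrational path
  \<open>w\<close> the reduction of any nonzero \<open>x\<close> with \<open>x p\<^sub>w = x\<close> recovers \<open>p\<^sub>w\<close>.
\<close>

section \<open>Shift spaces\<close>

text \<open>Nothing in a presentation shows that an element is nonzero, yet the argument needs
  \<open>p\<^sub>B \<noteq> 0\<close> and \<open>p\<^sub>b + r \<noteq> 0\<close> for combinations r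
  of terms with nonempty words. Both facts are read off from an action on functions. The whole
  argument is therefore carried out for a ring about which only the defining relations, generation
  and such an action are known; the concrete quotient enters at the end. The obstacle in the
  periodic kind is that J is only a left ideal, so right multiplication by
  \<open>D = p\<^sub>b - s\<^sub>\<beta> p\<^sub>b\<close> need not map J into itself. However, all
  words that fix b commute with each other. For the given element q of J this yields
  \<open>q D = q - s\<^sub>\<beta> q\<close>, a nonzero element of both J and \<open>J D\<close>.
  Two minimal left ideals with a common nonzero element coincide, so \<open>J = J D\<close>, and
  division by D can be repeated inside J.\<close>

definition pull :: "'a list \<Rightarrow> 'a word set \<Rightarrow> 'a word set" where
  "pull \<alpha> A = {x. \<alpha> \<frown> x \<in> A}"

text \<open>\<open>pull\<close> and \<open>push\<close> are what the partial shift maps do to sets: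
  \<open>p A\<close> passes the word \<open>sw \<alpha>\<close> by becoming
  \<open>p (pull \<alpha> A)\<close>, and
  \<open>sw \<alpha> \<otimes> p A \<otimes> tw \<alpha>\<close> is
  \<open>p (push X \<alpha> A)\<close>. Only \<open>push\<close> has to intersect with
  \<open>X\<close>, since a prolonged point may leave the space.\<close>

definition push :: "'a word set \<Rightarrow> 'a list \<Rightarrow> 'a word set \<Rightarrow> 'a word set" where
  "push X \<alpha> A = {\<alpha> \<frown> x | x. x \<in> A \<and> \<alpha> \<frown> x \<in> X}"

lemma pull_Nil [simp]: "pull [] A = A"
  by (simp add: pull_def)

lemma pull_append: "pull (\<alpha> @ \<beta>) A = pull \<beta> (pull \<alpha> A)"
  by (simp add: pull_def)

lemma pull_Cons: "pull (a # \<alpha>) A = pull \<alpha> (pull [a] A)"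
  using pull_append[of "[a]" \<alpha> A] by simp

lemma conc_eq_conc_cases:
  assumes "\<alpha> \<frown> x = \<beta> \<frown> y" "length \<alpha> \<le> length \<beta>"
  obtains \<gamma> where "\<beta> = \<alpha> @ \<gamma>" "x = \<gamma> \<frown> y"
proof
  define n where "n = length \<alpha>"
  have "\<alpha> \<frown> x = take n \<beta> \<frown> (drop n \<beta> \<frown> y)"
    using assms(1) by simp
  moreover have "length \<alpha> = length (take n \<beta>)"
    using assms(2) by (simp add: n_def)
  ultimately have *: "\<alpha> = take n \<beta>" "x = drop n \<beta> \<frown> y"
    by (metis concat_eq)+
  show "\<beta> = \<alpha> @ drop n \<beta>" by (subst *(1)) simp
  show "x = drop n \<beta> \<frown> y" by fact
qed

text \<open>From position |\<alpha>| on the letters of b repeat those |\<alpha>| places earlier, so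
  strong induction determines all of them. Hence a nonempty word fixes at most one sequence, which
  later bounds a set of fixed points by a finite set of words.\<close>

lemma fixed_by_conc_imp_iter:
  assumes "\<alpha> \<frown> b = b" "\<alpha> \<noteq> []"
  shows "b = \<alpha>\<^sup>\<omega>"
proof
  fix n
  show "b n = \<alpha>\<^sup>\<omega> n"
  proof (induction n rule: less_induct)
    case (less n)
    show ?case
    proof (cases "n < length \<alpha>")
      case True
      then show ?thesis using assms conc_fst[OF True, of b] by simp
    next
      case False
      then have "b n = b (n - length \<alpha>)"
        using assms(1) conc_snd[OF False, of b] by simp
      also have "\<dots> = \<alpha>\<^sup>\<omega> (n - length \<alpha>)"
        using False assms(2) by (intro less.IH) (cases \<alpha>, auto)
      also have "\<dots> = \<alpha>\<^sup>\<omega> n"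
        using False assms(2) le_mod_geq[of "length \<alpha>" n] by simp
      finally show ?thesis .
    qed
  qed
qed

lemma suffix_build [simp]: "suffix (Suc 0) (a ## z) = z"
  by (simp add: fun_eq_iff)

lemma starts_with_Cons:
  "(\<exists>w. z = (a # \<alpha>) \<frown> w) \<longleftrightarrow> z 0 = a \<and> (\<exists>w. suffix 1 z = \<alpha> \<frown> w)"
proof
  assume "\<exists>w. z = (a # \<alpha>) \<frown> w"
  then obtain w where w: "z = a ## \<alpha> \<frown> w" by auto
  then have "suffix 1 z = \<alpha> \<frown> w" by (auto simp: fun_eq_iff)
  with w show "z 0 = a \<and> (\<exists>w. suffix 1 z = \<alpha> \<frown> w)" by auto
next
  assume "z 0 = a \<and> (\<exists>w. suffix 1 z = \<alpha> \<frown> w)"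
  then obtain w where "z 0 = a" "suffix 1 z = \<alpha> \<frown> w" by blast
  then have "z = (a # \<alpha>) \<frown> w" using build_first[of z] by simp
  then show "\<exists>w. z = (a # \<alpha>) \<frown> w" by blast
qed

text \<open>One differing position per element of \<open>Y\<close> is enough, and finitely many
  positions have a bound. This supplies the length of a cylinder around b that avoids
  \<open>Y\<close>.\<close>

lemma separating_length:
  assumes "finite Y" "b \<notin> Y"
  obtains n :: nat where "\<And>y. y \<in> Y \<Longrightarrow> \<exists>m<n. y m \<noteq> b m"
proof -
  have "\<exists>n. \<forall>y\<in>Y. \<exists>m<n. y m \<noteq> b m"
    using assms
  proof (induction Y)
    case (insert y Y)
    then obtain n where n: "\<forall>y\<in>Y. \<exists>m<n. y m \<noteq> b m" by auto
    from insert.prems have "y \<noteq> b" by auto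
    then obtain m where m: "y m \<noteq> b m" by (auto simp: fun_eq_iff)
    have "\<exists>k<max n (Suc m). z k \<noteq> b k" if "z \<in> insert y Y" for z
      using n m that by (cases "z = y") (auto simp: less_max_iff_disj)
    then show ?case by blast
  qed simp
  with that show ?thesis by blast
qed

lemma shift_sets_subset: "A \<in> shift_sets X \<Longrightarrow> A \<subseteq> X"
  by (induction rule: shift_sets.induct) (auto simp: follower_cylinder_def)

lemma empty_shift_set [simp]: "{} \<in> shift_sets X"
  using shift_sets.compl[OF shift_sets.space, of X] by simp

text \<open>The alphabet consists of letters that occur. A letter outside the language would appear
  in no instance of relation (iii), and nothing would tie its two generators to the
  projections.\<close>

locale full_subshift =
  fixes \<AA> :: "'a set" and X :: "'a word set"
  assumes subshift: "subshift \<AA> X"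
    and letters: "\<And>a. a \<in> \<AA> \<Longrightarrow> [a] \<in> language X"
begin

lemma suffix_closed:
  assumes "x \<in> X" shows "suffix n x \<in> X"
proof -
  from subshift obtain F where F: "X = avoiding \<AA> F" by (auto simp: subshift_def)
  have "occurs_in w x" if "occurs_in w (suffix n x)" for w
    using that by (auto simp: occurs_in_def)
  with assms show ?thesis unfolding F avoiding_def by (auto simp: image_subset_iff)
qed

lemma conc_tail: "\<alpha> \<frown> x \<in> X \<Longrightarrow> x \<in> X"
  using suffix_closed[of "\<alpha> \<frown> x" "length \<alpha>"] by simp

lemma build_tail: "a ## x \<in> X \<Longrightarrow> x \<in> X"
  using conc_tail[of "[a]" x] by simp

lemma X_letters: "x \<in> X \<Longrightarrow> x n \<in> \<AA>"
  using subshift by (auto simp: subshift_def avoiding_def)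

lemma conc_letters: "\<alpha> \<frown> x \<in> X \<Longrightarrow> \<alpha> \<in> lists \<AA>"
  using X_letters[of "\<alpha> \<frown> x"] by (metis conc_fst in_lists_conv_set in_set_conv_nth)

lemma conc_language:
  assumes "\<alpha> \<frown> x \<in> X" shows "\<alpha> \<in> language X"
proof -
  have "occurs_in \<alpha> (\<alpha> \<frown> x)"
    unfolding occurs_in_def by (metis prefix_conc_length)
  with assms show ?thesis by (auto simp: language_def)
qed

lemma mid_language: "\<alpha> \<frown> \<beta> \<frown> x \<in> X \<Longrightarrow> \<beta> \<in> language X"
  using conc_language conc_tail by metis

lemma conc_in_language: "\<alpha> @ \<beta> \<in> language X \<Longrightarrow> \<alpha> \<in> language X \<and> \<beta> \<in> language X"
proof -
  assume a: "\<alpha> @ \<beta> \<in> language X"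
  show ?thesis
  proof (cases "\<alpha> @ \<beta> = []")
    case True
    then show ?thesis using a by simp
  next
    case False
    then obtain x i j where x: "x \<in> X" "\<alpha> @ \<beta> = subsequence x i j"
      using a by (auto simp: language_def occurs_in_def)
    then have "i \<le> j" using False by (metis linear subseq_to_smaller)
    then have "\<alpha> \<frown> \<beta> \<frown> suffix j x \<in> X"
      using x suffix_closed[OF x(1), of i] by simp
    then show ?thesis using conc_language mid_language by blast
  qed
qed

lemma language_lists: "\<alpha> \<in> language X \<Longrightarrow> \<alpha> \<in> lists \<AA>"
  using language_subset_lists[OF subshift] by blast

lemma Nil_language [simp]: "[] \<in> language X"
  by (simp add: language_def)

abbreviation U where "U \<equiv> shift_sets X"
abbreviation C where "C \<equiv> follower_cylinder X"

section \<open>Stability of the Boolean algebra under removing and adding prefixes\<close>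

text \<open>For empty \<nu> the condition is \<mu>ax \<in> X, which belongs to the longer word
  \<mu>a; the case that \<mu>a is not in the language is separated because only words of the
  language index generators of \<open>U\<close>. For \<nu> = a\<nu>' the requirement a\<nu>'x \<in>
  X does not follow from membership in \<open>C \<mu> \<nu>'\<close> and becomes the factor
  \<open>C [a] []\<close>.\<close>

lemma pull_letter_follower_cylinder:
  assumes "\<mu> \<in> language X" "\<nu> \<in> language X" "a \<in> \<AA>"
  shows "pull [a] (C \<mu> \<nu>) =
    (case \<nu> of [] \<Rightarrow> if \<mu> @ [a] \<in> language X then C (\<mu> @ [a]) [] else {}
     | b # \<nu>' \<Rightarrow> if b = a then C [a] [] \<inter> C \<mu> \<nu>' else {})"
proof (cases \<nu>)
  case Nil
  have "\<mu> @ [a] \<in> language X" if "\<mu> \<frown> a ## x \<in> X" for x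
    using conc_language[of "\<mu> @ [a]" x] that by simp
  then show ?thesis using Nil
    by (auto simp: pull_def follower_cylinder_def dest: conc_tail build_tail)
next
  case (Cons b \<nu>')
  then show ?thesis
    by (auto simp: pull_def follower_cylinder_def dest: conc_tail build_tail)
qed

lemma pull_letter_sets:
  assumes "A \<in> U" "a \<in> \<AA>" shows "pull [a] A \<in> U"
  using assms(1)
proof (induction rule: shift_sets.induct)
  case (base \<alpha> \<beta>)
  then show ?case
    using pull_letter_follower_cylinder[OF base assms(2)] letters[OF assms(2)] conc_in_language[of "[_]" _]
    by (auto split: list.splits intro!: shift_sets.intros)
next
  case space
  have "pull [a] X = C [a] []"
    by (auto simp: pull_def follower_cylinder_def dest: conc_tail build_tail)
  then show ?case by (simp add: letters assms(2) shift_sets.base)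
next
  case (union A B)
  have "pull [a] (A \<union> B) = pull [a] A \<union> pull [a] B" by (auto simp: pull_def)
  with union show ?case by (auto intro!: shift_sets.intros)
next
  case (inter A B)
  have "pull [a] (A \<inter> B) = pull [a] A \<inter> pull [a] B" by (auto simp: pull_def)
  with inter show ?case by (auto intro!: shift_sets.intros)
next
  case (compl A)
  \<comment> \<open>Complements are taken in \<open>X\<close>, so a point x with ax outside
    \<open>X\<close> lies in neither preimage; the domain \<open>C [a] []\<close> has to be
    intersected in.\<close>
  have "pull [a] (X - A) = C [a] [] \<inter> (X - pull [a] A)"
    by (auto simp: pull_def follower_cylinder_def dest: conc_tail build_tail)
  with compl show ?case by (auto intro!: shift_sets.intros letters assms(2))
qed

lemma pull_sets: "A \<in> U \<Longrightarrow> \<alpha> \<in> lists \<AA> \<Longrightarrow> pull \<alpha> A \<in> U"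
proof (induction \<alpha> arbitrary: A)
  case (Cons a \<alpha>)
  then show ?case unfolding pull_Cons[of a \<alpha>] using pull_letter_sets[of A a] by simp
qed simp

lemma push_letter_follower_cylinder:
  assumes "\<mu> \<in> language X" "\<nu> \<in> language X" "a \<in> \<AA>"
  shows "push X [a] (C \<mu> \<nu>) = (if a # \<nu> \<in> language X then C \<mu> (a # \<nu>) else {})"
proof -
  have "a # \<nu> \<in> language X" if "a ## \<nu> \<frown> x \<in> X" for x
    using conc_language[of "a # \<nu>" x] that by simp
  moreover have "push X [a] (C \<mu> \<nu>) = {a ## \<nu> \<frown> x | x. a ## \<nu> \<frown> x \<in> X \<and> \<mu> \<frown> x \<in> X}"
    unfolding push_def follower_cylinder_def using build_tail by fastforce
  ultimately show ?thesis
    unfolding follower_cylinder_def build_cons by (simp only: split: if_split) blast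
qed

lemma push_letter_sets:
  assumes "A \<in> U" "a \<in> \<AA>" shows "push X [a] A \<in> U"
  using assms(1)
proof (induction rule: shift_sets.induct)
  case (base \<alpha> \<beta>)
  then show ?case
    using push_letter_follower_cylinder[OF base assms(2)] by (auto intro!: shift_sets.intros)
next
  case space
  have "push X [a] X = C [] [a]"
    by (auto simp: push_def follower_cylinder_def dest: conc_tail build_tail)
  then show ?case by (simp add: letters assms(2) shift_sets.base)
next
  case (union A B)
  have "push X [a] (A \<union> B) = push X [a] A \<union> push X [a] B" by (auto simp: push_def)
  with union show ?case by (auto intro!: shift_sets.intros)
next
  case (inter A B)
  have "push X [a] (A \<inter> B) = push X [a] A \<inter> push X [a] B" by (auto simp: push_def)
  with inter show ?case by (auto intro!: shift_sets.intros)
next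
  case (compl A)
  have "push X [a] (X - A) = C [] [a] \<inter> (X - push X [a] A)"
    by (auto simp: push_def follower_cylinder_def dest: conc_tail build_tail)
  with compl show ?case by (auto intro!: shift_sets.intros letters assms(2))
qed

lemma push_Cons: "push X (a # \<alpha>) A = push X [a] (push X \<alpha> A)"
proof (rule equalityI; rule subsetI)
  fix y assume "y \<in> push X (a # \<alpha>) A"
  then obtain x where x: "x \<in> A" "a ## \<alpha> \<frown> x \<in> X" "y = a ## \<alpha> \<frown> x"
    by (auto simp: push_def)
  with build_tail[OF x(2)] show "y \<in> push X [a] (push X \<alpha> A)"
    unfolding push_def by auto
qed (auto simp: push_def)

lemma push_Nil: "A \<subseteq> X \<Longrightarrow> push X [] A = A"
  by (auto simp: push_def)

lemma push_sets: "A \<in> U \<Longrightarrow> \<alpha> \<in> lists \<AA> \<Longrightarrow> push X \<alpha> A \<in> U"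
proof (induction \<alpha>)
  case (Cons a \<alpha>)
  then show ?case unfolding push_Cons[of a \<alpha>] using push_letter_sets[of "push X \<alpha> A" a] by simp
qed (simp add: push_Nil shift_sets_subset)

text \<open>An ordinary cylinder is C(\<omega>, \<beta>) with \<beta> a prefix of b, so the sets of
  \<open>U\<close> separate the points of \<open>X\<close>.\<close>

lemma cylinder_sets: "b \<in> X \<Longrightarrow> {y \<in> X. \<forall>m<n. y m = b m} \<in> U"
proof -
  assume b: "b \<in> X"
  have "prefix n b \<in> language X"
    using b conc_language[of "prefix n b" "suffix n b"] by simp
  moreover have "{y \<in> X. \<forall>m<n. y m = b m} = C [] (prefix n b)"
  proof -
    have "y = prefix n b \<frown> suffix n y" if "\<forall>m<n. y m = b m" for y
      using that by (auto simp: conc_def fun_eq_iff)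
    moreover have "(prefix n b \<frown> x) m = b m" if "m < n" for x m
      using that by simp
    ultimately have "y \<in> {y \<in> X. \<forall>m<n. y m = b m} \<longleftrightarrow> y \<in> C [] (prefix n b)" for y
      unfolding follower_cylinder_def mem_Collect_eq by (metis conc_empty conc_tail)
    then show ?thesis by blast
  qed
  ultimately show ?thesis by (simp add: shift_sets.base)
qed

end

section \<open>Left ideals\<close>

definition right_translate :: "('c, 'm) ring_scheme \<Rightarrow> 'c set \<Rightarrow> 'c \<Rightarrow> 'c set" where
  "right_translate A I z = {x \<otimes>\<^bsub>A\<^esub> z | x. x \<in> I}"

primrec lprod :: "('c, 'm) ring_scheme \<Rightarrow> ('b \<Rightarrow> 'c) \<Rightarrow> 'b list \<Rightarrow> 'c" where
  "lprod A f [] = \<one>\<^bsub>A\<^esub>"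
| "lprod A f (x # xs) = f x \<otimes>\<^bsub>A\<^esub> lprod A f xs"

text \<open>The factors are multiplied in reverse order, which makes
  \<open>rprod R t \<alpha>\<close> the adjoint of \<open>lprod R s \<alpha>\<close> without
  reversing the list.\<close>

primrec rprod :: "('c, 'm) ring_scheme \<Rightarrow> ('b \<Rightarrow> 'c) \<Rightarrow> 'b list \<Rightarrow> 'c" where
  "rprod A f [] = \<one>\<^bsub>A\<^esub>"
| "rprod A f (x # xs) = rprod A f xs \<otimes>\<^bsub>A\<^esub> f x"

context ring
begin

lemma left_idealD:
  assumes "left_ideal I R"
  shows "I \<subseteq> carrier R" "\<zero> \<in> I" "\<And>x y. x \<in> I \<Longrightarrow> y \<in> I \<Longrightarrow> x \<oplus> y \<in> I"
    "\<And>x y. x \<in> I \<Longrightarrow> y \<in> I \<Longrightarrow> x \<ominus> y \<in> I"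
    "\<And>a x. a \<in> carrier R \<Longrightarrow> x \<in> I \<Longrightarrow> a \<otimes> x \<in> I"
proof -
  interpret additive_subgroup I R using assms by (simp add: left_ideal_def)
  show "I \<subseteq> carrier R" by (rule a_subset)
  show "\<zero> \<in> I" by simp
  show "x \<oplus> y \<in> I" if "x \<in> I" "y \<in> I" for x y using that by simp
  show "x \<ominus> y \<in> I" if "x \<in> I" "y \<in> I" for x y using that by (simp add: minus_eq)
  show "a \<otimes> x \<in> I" if "a \<in> carrier R" "x \<in> I" for a x
    using assms that by (simp add: left_ideal_def)
qed

text \<open>Closure under negation is supplied by multiplication with the negative of
  \<one>.\<close>

lemma left_idealI:
  assumes "I \<subseteq> carrier R" "\<zero> \<in> I" "\<And>x y. x \<in> I \<Longrightarrow> y \<in> I \<Longrightarrow> x \<oplus> y \<in> I"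
    and mult: "\<And>a x. a \<in> carrier R \<Longrightarrow> x \<in> I \<Longrightarrow> a \<otimes> x \<in> I"
  shows "left_ideal I R"
proof -
  have "\<ominus> x \<in> I" if "x \<in> I" for x
    using mult[of "\<ominus> \<one>" x] that assms(1) by (auto simp: l_minus)
  then have "additive_subgroup I R"
    using assms
    by (intro additive_subgroup.intro group.subgroupI add.group_axioms) (auto simp: a_inv_def)
  with mult show ?thesis by (simp add: left_ideal_def)
qed

lemma left_ideal_Int: "left_ideal I R \<Longrightarrow> left_ideal J R \<Longrightarrow> left_ideal (I \<inter> J) R"
  by (rule left_idealI) (auto dest: left_idealD)

lemma left_ideal_principal: "e \<in> carrier R \<Longrightarrow> left_ideal (principal_left_ideal R e) R"
proof (rule left_idealI)
  assume e: "e \<in> carrier R"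
  show "principal_left_ideal R e \<subseteq> carrier R" using e by (auto simp: principal_left_ideal_def)
  show "\<zero> \<in> principal_left_ideal R e"
    unfolding principal_left_ideal_def using e by (auto intro!: exI[of _ \<zero>])
  fix x y assume "x \<in> principal_left_ideal R e" "y \<in> principal_left_ideal R e"
  then show "x \<oplus> y \<in> principal_left_ideal R e"
    unfolding principal_left_ideal_def using e by (auto simp: l_distr[symmetric])
next
  fix a x assume "e \<in> carrier R" "a \<in> carrier R" "x \<in> principal_left_ideal R e"
  then show "a \<otimes> x \<in> principal_left_ideal R e"
    unfolding principal_left_ideal_def by (auto simp: m_assoc[symmetric])
qed

lemma left_ideal_right_translate:
  assumes "left_ideal I R" "z \<in> carrier R" shows "left_ideal (right_translate R I z) R"
proof -
  note I = left_idealD[OF assms(1)]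
  show ?thesis
  proof (rule left_idealI)
    show "right_translate R I z \<subseteq> carrier R" using I(1) assms(2) by (auto simp: right_translate_def)
    show "\<zero> \<in> right_translate R I z"
      unfolding right_translate_def using I(2) assms(2) by (auto intro!: exI[of _ \<zero>])
    fix x y assume "x \<in> right_translate R I z" "y \<in> right_translate R I z"
    then obtain u v where "u \<in> I" "v \<in> I" "x = u \<otimes> z" "y = v \<otimes> z"
      by (auto simp: right_translate_def)
    moreover from this have "u \<in> carrier R" "v \<in> carrier R" using I(1) by auto
    ultimately show "x \<oplus> y \<in> right_translate R I z"
      unfolding right_translate_def using I(3)[of u v] assms(2)
      by (intro CollectI exI[of _ "u \<oplus> v"]) (auto simp: l_distr)
  next
    fix a x assume "a \<in> carrier R" "x \<in> right_translate R I z"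
    then obtain u where "u \<in> I" "x = u \<otimes> z" by (auto simp: right_translate_def)
    moreover from this have "u \<in> carrier R" using I(1) by auto
    ultimately show "a \<otimes> x \<in> right_translate R I z"
      unfolding right_translate_def using I(5) assms(2) \<open>a \<in> carrier R\<close>
      by (intro CollectI exI[of _ "a \<otimes> u"]) (auto simp: m_assoc)
  qed
qed

lemma left_module_isomorphic_sym:
  assumes "left_module_isomorphic R I J" "left_ideal I R"
  shows "left_module_isomorphic R J I"
proof -
  from assms(1) obtain f where f: "bij_betw f I J"
      "\<And>x y. x \<in> I \<Longrightarrow> y \<in> I \<Longrightarrow> f (x \<oplus> y) = f x \<oplus> f y"
      "\<And>a x. a \<in> carrier R \<Longrightarrow> x \<in> I \<Longrightarrow> f (a \<otimes> x) = a \<otimes> f x"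
    by (auto simp: left_module_isomorphic_def)
  define g where "g = inv_into I f"
  have fg: "f (g y) = y" "g y \<in> I" if "y \<in> J" for y
    using f(1) that by (auto simp: g_def bij_betw_def f_inv_into_f inv_into_into)
  have gf: "g (f x) = x" if "x \<in> I" for x
    using f(1) that by (auto simp: g_def bij_betw_def)
  have "bij_betw g J I" using f(1) by (simp add: g_def bij_betw_inv_into)
  moreover have "g (x \<oplus> y) = g x \<oplus> g y" if "x \<in> J" "y \<in> J" for x y
    using gf[of "g x \<oplus> g y"] f(2)[of "g x" "g y"] fg that left_idealD(3)[OF assms(2)] by simp
  moreover have "g (a \<otimes> x) = a \<otimes> g x" if "a \<in> carrier R" "x \<in> J" for a x
    using gf[of "a \<otimes> g x"] f(3)[of a "g x"] fg that left_idealD(5)[OF assms(2)] by simp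
  ultimately show ?thesis unfolding left_module_isomorphic_def by blast
qed

text \<open>Minimality depends on the module structure alone: a left ideal inside J pulls back along
  the isomorphism to a left ideal inside I, which is zero or all of I.\<close>

lemma minimal_left_ideal_transfer:
  assumes "left_module_isomorphic R I J" "minimal_left_ideal I R" "left_ideal J R"
  shows "minimal_left_ideal J R"
proof -
  from assms(1) obtain f where f: "bij_betw f I J"
      "\<And>x y. x \<in> I \<Longrightarrow> y \<in> I \<Longrightarrow> f (x \<oplus> y) = f x \<oplus> f y"
      "\<And>a x. a \<in> carrier R \<Longrightarrow> x \<in> I \<Longrightarrow> f (a \<otimes> x) = a \<otimes> f x"
    by (auto simp: left_module_isomorphic_def)
  from assms(2) have I: "left_ideal I R" "I \<noteq> {\<zero>}" by (simp_all add: minimal_left_ideal_def)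
  note I' = left_idealD[OF I(1)] and J' = left_idealD[OF assms(3)]
  have fJ: "f ` I = J" "inj_on f I" using f(1) by (auto simp: bij_betw_def)
  \<comment> \<open>An isomorphism is only required to be additive and linear; f \<zero> = \<zero>
    comes from \<zero> = \<zero> \<otimes> \<zero> by linearity.\<close>
  have f0: "f \<zero> = \<zero>"
    using f(3)[of \<zero> \<zero>] I' J'(1) fJ by (metis imageI l_null subsetD zero_closed)
  have "J \<noteq> {\<zero>}"
  proof
    assume "J = {\<zero>}"
    then have "x = \<zero>" if "x \<in> I" for x
      using that fJ f0 I'(2) by (metis imageI inj_onD singletonD)
    with I(2) I'(2) show False by blast
  qed
  moreover have "L = {\<zero>} \<or> L = J" if L: "left_ideal L R" "L \<subseteq> J" for L
  proof -
    note L' = left_idealD[OF L(1)]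
    have "left_ideal {x \<in> I. f x \<in> L} R"
      using I' L' f f0 by (intro left_idealI) auto
    then have "{x \<in> I. f x \<in> L} = {\<zero>} \<or> {x \<in> I. f x \<in> L} = I"
      using assms(2) unfolding minimal_left_ideal_def by blast
    moreover have "L = f ` {x \<in> I. f x \<in> L}" using L(2) fJ(1) by auto
    ultimately show ?thesis using fJ(1) f0 by auto
  qed
  ultimately show ?thesis using assms(3) by (simp add: minimal_left_ideal_def)
qed

text \<open>Schur's argument: the elements of I annihilated by z form a left ideal inside I, and it
  is not all of I because of x, so it is zero and right multiplication by z is injective.\<close>

lemma minimal_right_translate:
  assumes min: "minimal_left_ideal I R" and z: "z \<in> carrier R" and x: "x \<in> I" "x \<otimes> z \<noteq> \<zero>"
  shows "left_module_isomorphic R I (right_translate R I z)"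
    and "minimal_left_ideal (right_translate R I z) R"
proof -
  have I: "left_ideal I R" using min by (simp add: minimal_left_ideal_def)
  note I' = left_idealD[OF I]
  have "left_ideal {x \<in> I. x \<otimes> z = \<zero>} R"
    using I' z by (intro left_idealI) (auto simp: l_distr m_assoc subset_eq)
  then have ker: "{x \<in> I. x \<otimes> z = \<zero>} = {\<zero>}"
    using min x unfolding minimal_left_ideal_def by blast
  have "inj_on (\<lambda>x. x \<otimes> z) I"
  proof (rule inj_onI)
    fix u v assume uv: "u \<in> I" "v \<in> I" "u \<otimes> z = v \<otimes> z"
    then have c: "u \<in> carrier R" "v \<in> carrier R" using I'(1) by auto
    have "(u \<ominus> v) \<otimes> z = u \<otimes> z \<ominus> v \<otimes> z"
      using c z by (simp add: minus_eq l_distr l_minus)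
    also have "\<dots> = \<zero>" using uv c z by (simp add: minus_eq r_neg)
    finally have "u \<ominus> v = \<zero>" using ker I'(4)[OF uv(1,2)] by blast
    then have "u \<ominus> v \<oplus> v = v" using c by simp
    then show "u = v" using c by (simp add: minus_eq a_assoc l_neg)
  qed
  then have "bij_betw (\<lambda>x. x \<otimes> z) I (right_translate R I z)"
    by (auto simp: bij_betw_def right_translate_def)
  then show iso: "left_module_isomorphic R I (right_translate R I z)"
    unfolding left_module_isomorphic_def using I'(1) z
    by (intro exI[of _ "\<lambda>x. x \<otimes> z"]) (auto simp: l_distr m_assoc subset_eq)
  show "minimal_left_ideal (right_translate R I z) R"
    by (rule minimal_left_ideal_transfer[OF iso min left_ideal_right_translate[OF I z]])
qed

lemma minimal_left_ideal_eqI: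
  assumes "minimal_left_ideal I R" "left_ideal J R" "J \<subseteq> I" "w \<in> J" "w \<noteq> \<zero>"
  shows "J = I"
  using assms unfolding minimal_left_ideal_def by blast

lemma minimal_left_ideal_principal:
  assumes "minimal_left_ideal I R" "e \<in> I" "e \<noteq> \<zero>"
  shows "I = principal_left_ideal R e"
proof -
  have I: "left_ideal I R" using assms by (simp add: minimal_left_ideal_def)
  note I' = left_idealD[OF I]
  have e: "e \<in> carrier R" using I'(1) assms(2) by blast
  then have "e \<in> principal_left_ideal R e"
    unfolding principal_left_ideal_def by (auto intro!: exI[of _ \<one>])
  then show ?thesis
    using minimal_left_ideal_eqI[OF assms(1) left_ideal_principal[OF e]] assms(2,3) I'(5)
    by (fastforce simp: principal_left_ideal_def)
qed

end

section \<open>Rings satisfying the relations of the subshift algebra\<close>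

text \<open>The action is by weighted pullback along the partial shift maps. Its integer coordinate
  records degree: on functions on \<open>X\<close> alone, \<open>s\<^sub>\<beta>\<close> could not be told from \<open>1\<close> at the
  fixed point \<open>\<beta>\<^sup>\<omega>\<close>.\<close>

locale subshift_ring = ring R + full_subshift \<AA> X
  for R :: "('c, 'e) ring_scheme" (structure) and \<AA> :: "'a set" and X :: "'a word set" +
  fixes p :: "'a word set \<Rightarrow> 'c" and s t :: "'a \<Rightarrow> 'c" and k :: "'r::field \<Rightarrow> 'c"
    and act :: "'c \<Rightarrow> ('a word \<Rightarrow> int \<Rightarrow> 'r) \<Rightarrow> 'a word \<Rightarrow> int \<Rightarrow> 'r"
  assumes p_closed [simp]: "A \<in> shift_sets X \<Longrightarrow> p A \<in> carrier R"
    and s_closed [simp]: "a \<in> \<AA> \<Longrightarrow> s a \<in> carrier R"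
    and t_closed [simp]: "a \<in> \<AA> \<Longrightarrow> t a \<in> carrier R"
    and k_closed [simp]: "k c \<in> carrier R"
    and p_space: "p X = \<one>" and p_empty [simp]: "p {} = \<zero>"
    and p_mult: "A \<in> shift_sets X \<Longrightarrow> B \<in> shift_sets X \<Longrightarrow> p A \<otimes> p B = p (A \<inter> B)"
    and p_Un: "A \<in> shift_sets X \<Longrightarrow> B \<in> shift_sets X \<Longrightarrow>
      p (A \<union> B) = p A \<oplus> p B \<ominus> p (A \<inter> B)"
    and s_t_s: "a \<in> \<AA> \<Longrightarrow> s a \<otimes> t a \<otimes> s a = s a"
    and t_s_t: "a \<in> \<AA> \<Longrightarrow> t a \<otimes> s a \<otimes> t a = t a"
    and follower: "\<alpha> \<in> language X \<Longrightarrow> \<beta> \<in> language X \<Longrightarrow>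
      lprod R s \<beta> \<otimes> rprod R t \<alpha> \<otimes> lprod R s \<alpha> \<otimes> rprod R t \<beta> = p (follower_cylinder X \<alpha> \<beta>)"
    and k_zero [simp]: "k 0 = \<zero>" and k_one [simp]: "k 1 = \<one>" and k_mult: "k (c * d) = k c \<otimes> k d"
    and k_add: "k (c + d) = k c \<oplus> k d"
    and k_central: "x \<in> carrier R \<Longrightarrow> k c \<otimes> x = x \<otimes> k c"
    and generated: "\<And>Q x. x \<in> carrier R \<Longrightarrow> Q \<one> \<Longrightarrow>
      (\<And>x y. x \<in> carrier R \<Longrightarrow> y \<in> carrier R \<Longrightarrow> Q x \<Longrightarrow> Q y \<Longrightarrow> Q (x \<oplus> y)) \<Longrightarrow>
      (\<And>c x. x \<in> carrier R \<Longrightarrow> Q x \<Longrightarrow> Q (k c \<otimes> x)) \<Longrightarrow>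
      (\<And>A x. A \<in> shift_sets X \<Longrightarrow> x \<in> carrier R \<Longrightarrow> Q x \<Longrightarrow> Q (p A \<otimes> x)) \<Longrightarrow>
      (\<And>a x. a \<in> \<AA> \<Longrightarrow> x \<in> carrier R \<Longrightarrow> Q x \<Longrightarrow> Q (s a \<otimes> x)) \<Longrightarrow>
      (\<And>a x. a \<in> \<AA> \<Longrightarrow> x \<in> carrier R \<Longrightarrow> Q x \<Longrightarrow> Q (t a \<otimes> x)) \<Longrightarrow> Q x"
    and act_add: "x \<in> carrier R \<Longrightarrow> y \<in> carrier R \<Longrightarrow> act (x \<oplus> y) m z n = act x m z n + act y m z n"
    and act_mult: "x \<in> carrier R \<Longrightarrow> y \<in> carrier R \<Longrightarrow> act (x \<otimes> y) m = act x (act y m)"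
    and act_k: "act (k c) m z n = (if z \<in> X then c * m z n else 0)"
    and act_p: "A \<in> shift_sets X \<Longrightarrow> act (p A) m z n = (if z \<in> A then m z n else 0)"
    and act_s: "a \<in> \<AA> \<Longrightarrow>
      act (s a) m z n = (if z \<in> X \<and> z 0 = a then m (suffix 1 z) (n - 1) else 0)"
    and act_t: "a \<in> \<AA> \<Longrightarrow> act (t a) m z n = (if a ## z \<in> X then m (a ## z) (n + 1) else 0)"
begin

section \<open>Multiplication rules for projections and letters\<close>

abbreviation sw where "sw \<equiv> lprod R s"
abbreviation tw where "tw \<equiv> rprod R t"

lemma sw_closed [simp]: "\<alpha> \<in> lists \<AA> \<Longrightarrow> sw \<alpha> \<in> carrier R"
  by (induction \<alpha>) auto

lemma tw_closed [simp]: "\<alpha> \<in> lists \<AA> \<Longrightarrow> tw \<alpha> \<in> carrier R"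
  by (induction \<alpha>) auto

lemma sw_append: "\<alpha> \<in> lists \<AA> \<Longrightarrow> \<beta> \<in> lists \<AA> \<Longrightarrow> sw (\<alpha> @ \<beta>) = sw \<alpha> \<otimes> sw \<beta>"
  by (induction \<alpha>) (auto simp: m_assoc)

lemma tw_append: "\<alpha> \<in> lists \<AA> \<Longrightarrow> \<beta> \<in> lists \<AA> \<Longrightarrow> tw (\<alpha> @ \<beta>) = tw \<beta> \<otimes> tw \<alpha>"
  by (induction \<alpha>) (auto simp: m_assoc)

lemma space_sets [simp]: "X \<in> U"
  by (rule shift_sets.space)

lemma Int_sets [simp]: "A \<in> U \<Longrightarrow> B \<in> U \<Longrightarrow> A \<inter> B \<in> U"
  by (rule shift_sets.inter)

lemma compl_sets [simp]: "A \<in> U \<Longrightarrow> X - A \<in> U"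
  by (rule shift_sets.compl)

lemma p_comm: "A \<in> U \<Longrightarrow> B \<in> U \<Longrightarrow> p A \<otimes> p B = p B \<otimes> p A"
  by (simp add: p_mult Int_commute)

lemma p_mult_left:
  "A \<in> U \<Longrightarrow> B \<in> U \<Longrightarrow> x \<in> carrier R \<Longrightarrow> p A \<otimes> (p B \<otimes> x) = p (A \<inter> B) \<otimes> x"
  by (simp add: p_mult m_assoc[symmetric])

lemma p_compl:
  assumes "A \<in> U" shows "p A \<oplus> p (X - A) = \<one>"
proof -
  have "A \<union> (X - A) = X" "A \<inter> (X - A) = {}" using shift_sets_subset[OF assms] by auto
  with p_Un[OF assms compl_sets[OF assms]] assms show ?thesis
    by (simp add: p_space minus_eq)
qed

abbreviation cyl where "cyl a \<equiv> push X [a] X"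
abbreviation dom where "dom a \<equiv> pull [a] X"

lemma cyl_sets [simp]: "a \<in> \<AA> \<Longrightarrow> cyl a \<in> U"
  by (rule push_letter_sets[OF shift_sets.space])

lemma dom_sets [simp]: "a \<in> \<AA> \<Longrightarrow> dom a \<in> U"
  by (rule pull_letter_sets[OF shift_sets.space])

text \<open>\<open>s_t\<close> and \<open>t_s\<close> are relation (iii) for the pairs (\<omega>, a)
  and (a, \<omega>), which is available because every letter lies in the language.\<close>

lemma s_t: "a \<in> \<AA> \<Longrightarrow> s a \<otimes> t a = p (cyl a)"
proof -
  assume a: "a \<in> \<AA>"
  have "cyl a = C [] [a]"
    by (auto simp: push_def follower_cylinder_def dest: build_tail)
  with follower[of "[]" "[a]"] a letters[OF a] show ?thesis by simp
qed

lemma t_s: "a \<in> \<AA> \<Longrightarrow> t a \<otimes> s a = p (dom a)"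
proof -
  assume a: "a \<in> \<AA>"
  have "dom a = C [a] []"
    by (auto simp: pull_def follower_cylinder_def dest: build_tail)
  with follower[of "[a]" "[]"] a letters[OF a] show ?thesis by simp
qed

lemma p_cyl_s: "a \<in> \<AA> \<Longrightarrow> p (cyl a) \<otimes> s a = s a"
  using s_t_s[of a] by (simp add: s_t)

lemma t_p_cyl: "a \<in> \<AA> \<Longrightarrow> t a \<otimes> p (cyl a) = t a"
  using t_s_t[of a] by (simp add: s_t[symmetric] m_assoc)

lemma s_p_dom: "a \<in> \<AA> \<Longrightarrow> s a \<otimes> p (dom a) = s a"
  using s_t_s[of a] by (simp add: t_s[symmetric] m_assoc)

lemma p_dom_t: "a \<in> \<AA> \<Longrightarrow> p (dom a) \<otimes> t a = t a"
  using t_s_t[of a] by (simp add: t_s)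

lemma p_s_disjoint:
  assumes "A \<in> U" "a \<in> \<AA>" "A \<inter> cyl a = {}" shows "p A \<otimes> s a = \<zero>"
proof -
  have "p A \<otimes> s a = p A \<otimes> (p (cyl a) \<otimes> s a)" using assms by (simp add: p_cyl_s)
  also have "\<dots> = \<zero>" using assms by (subst p_mult_left) auto
  finally show ?thesis .
qed

text \<open>Separated from \<open>p_s\<close> because two cases of its induction use it: the
  intersection, and the union through inclusion-exclusion.\<close>

lemma p_s_Int:
  assumes "A \<in> U" "B \<in> U" "a \<in> \<AA>"
    and "p A \<otimes> s a = s a \<otimes> p (pull [a] A)" "p B \<otimes> s a = s a \<otimes> p (pull [a] B)"
  shows "p (A \<inter> B) \<otimes> s a = s a \<otimes> p (pull [a] (A \<inter> B))"
proof -
  have pA: "pull [a] A \<in> U" "pull [a] B \<in> U" using assms by (simp_all add: pull_letter_sets)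
  have "p (A \<inter> B) \<otimes> s a = p A \<otimes> (p B \<otimes> s a)"
    using p_mult_left[of A B "s a"] assms(1-3) by simp
  also have "\<dots> = s a \<otimes> p (pull [a] A) \<otimes> p (pull [a] B)"
    using assms pA by (simp add: m_assoc[symmetric])
  also have "\<dots> = s a \<otimes> p (pull [a] A \<inter> pull [a] B)"
    using assms pA by (simp add: m_assoc p_mult)
  also have "pull [a] A \<inter> pull [a] B = pull [a] (A \<inter> B)" by (auto simp: pull_def)
  finally show ?thesis .
qed

text \<open>This commutation rule is not among the relations. On a generator it follows from
  relation (iii) by writing \<open>p (C \<mu> \<nu>)\<close> as a product of words: for empty \<nu>
  the letter a is appended to \<mu>, and for \<nu> = a\<nu>' it is split off from \<nu>. If
  \<open>C \<mu> \<nu>\<close> misses the cylinder of a, both sides vanish. Induction then carries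
  the rule through the Boolean operations.\<close>

lemma p_s:
  assumes "A \<in> U" "a \<in> \<AA>" shows "p A \<otimes> s a = s a \<otimes> p (pull [a] A)"
  using assms(1)
proof (induction rule: shift_sets.induct)
  case (base \<mu> \<nu>)
  note a = assms(2)
  have l: "\<mu> \<in> lists \<AA>" "\<nu> \<in> lists \<AA>" using base by (simp_all add: language_lists)
  have CU: "C \<mu> \<nu> \<in> U" using base by (rule shift_sets.base)
  note pull = pull_letter_follower_cylinder[OF base a]
  consider (disjoint) "pull [a] (C \<mu> \<nu>) = {}" "C \<mu> \<nu> \<inter> cyl a = {}"
    | (Nil) "\<nu> = []" "\<mu> @ [a] \<in> language X"
    | (Cons) \<nu>' where "\<nu> = a # \<nu>'"
  proof (cases \<nu>)
    case Nil
    show ?thesis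
    proof (cases "\<mu> @ [a] \<in> language X")
      case False
      then have e: "pull [a] (C \<mu> \<nu>) = {}" using pull Nil by simp
      then have "C \<mu> \<nu> \<inter> cyl a = {}" by (auto simp: pull_def push_def)
      with e that show ?thesis by blast
    qed (use that Nil in blast)
  next
    case (Cons b \<nu>')
    show ?thesis
    proof (cases "b = a")
      case False
      then have e: "pull [a] (C \<mu> \<nu>) = {}" using pull Cons by simp
      then have "C \<mu> \<nu> \<inter> cyl a = {}" by (auto simp: pull_def push_def)
      with e that show ?thesis by blast
    qed (use that Cons in blast)
  qed
  then show ?case
  proof cases
    case disjoint
    then show ?thesis using p_s_disjoint[OF CU a] a by simp
  next
    case Nil
    have pe: "pull [a] (C \<mu> \<nu>) = C (\<mu> @ [a]) []" using pull Nil by simp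
    have "s a \<otimes> p (C (\<mu> @ [a]) []) = s a \<otimes> (tw (\<mu> @ [a]) \<otimes> sw (\<mu> @ [a]))"
      using follower[of "\<mu> @ [a]" "[]"] Nil l a by simp
    also have "\<dots> = (s a \<otimes> t a) \<otimes> ((tw \<mu> \<otimes> sw \<mu>) \<otimes> s a)"
      using l a by (simp add: sw_append tw_append m_assoc)
    also have "tw \<mu> \<otimes> sw \<mu> = p (C \<mu> \<nu>)"
      using follower[of \<mu> "[]"] Nil l base by simp
    also have "s a \<otimes> t a \<otimes> (p (C \<mu> \<nu>) \<otimes> s a) = p (C \<mu> \<nu>) \<otimes> (p (cyl a) \<otimes> s a)"
      using a CU by (simp add: s_t p_mult_left Int_commute)
    finally show ?thesis using a pe by (simp add: p_cyl_s)
  next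
    case Cons
    have \<nu>': "\<nu>' \<in> language X" "[a] \<in> language X" "\<nu>' \<in> lists \<AA>"
      using base(2) Cons conc_in_language[of "[a]" \<nu>'] l(2) by auto
    have CU': "C \<mu> \<nu>' \<in> U" "C [a] [] \<in> U" using base \<nu>' by (auto intro: shift_sets.base)
    have dom: "dom a = C [a] []"
      by (auto simp: pull_def follower_cylinder_def dest: build_tail)
    have "p (C \<mu> \<nu>) \<otimes> s a = sw \<nu> \<otimes> tw \<mu> \<otimes> sw \<mu> \<otimes> tw \<nu> \<otimes> s a"
      using follower[OF base] by simp
    also have "\<dots> = s a \<otimes> ((sw \<nu>' \<otimes> tw \<mu> \<otimes> sw \<mu> \<otimes> tw \<nu>') \<otimes> (t a \<otimes> s a))"
      using Cons l \<nu>' a by (simp add: m_assoc)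
    also have "\<dots> = s a \<otimes> p (C \<mu> \<nu>' \<inter> dom a)"
      using follower[OF base(1) \<nu>'(1)] a CU' by (simp add: t_s p_mult)
    finally show ?thesis using pull Cons dom by (simp add: Int_commute)
  qed
next
  case space
  then show ?case using assms(2) by (simp add: p_space s_p_dom)
next
  case (union A B)
  note a = assms(2)
  have pU: "pull [a] A \<in> U" "pull [a] B \<in> U" using union a by (simp_all add: pull_letter_sets)
  have e: "pull [a] (A \<union> B) = pull [a] A \<union> pull [a] B"
    "pull [a] (A \<inter> B) = pull [a] A \<inter> pull [a] B" by (auto simp: pull_def)
  have "p (A \<union> B) \<otimes> s a = p A \<otimes> s a \<oplus> p B \<otimes> s a \<ominus> p (A \<inter> B) \<otimes> s a"
    using union(1,2) a by (simp add: p_Un minus_eq l_distr l_minus)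
  also have "\<dots> = s a \<otimes> p (pull [a] A \<union> pull [a] B)"
    using union pU a p_s_Int[OF union(1,2) a union.IH] e(2)
    by (simp add: p_Un minus_eq r_distr r_minus)
  finally show ?case using e by simp
next
  case (inter A B)
  then show ?case using p_s_Int[OF inter(1,2) assms(2)] by blast
next
  case (compl A)
  note a = assms(2)
  have pU: "pull [a] A \<in> U" using compl a by (simp add: pull_letter_sets)
  have pU': "pull [a] (X - A) \<in> U" using compl a by (simp add: pull_letter_sets)
  have "dom a = pull [a] A \<union> pull [a] (X - A)" "pull [a] A \<inter> pull [a] (X - A) = {}"
    using shift_sets_subset[OF compl(1)] by (auto simp: pull_def)
  then have "s a \<otimes> p (pull [a] A) \<oplus> s a \<otimes> p (pull [a] (X - A)) = s a"
    using p_Un[OF pU pU'] s_p_dom[OF a] a pU pU' by (simp add: minus_eq r_distr)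
  \<comment> \<open>Both sides of the rule for the complement are what is missing from
    \<open>s a \<otimes> p (pull [a] A)\<close> to make up \<open>s a\<close>, so cancellation
    identifies them.\<close>
  moreover have "s a \<otimes> p (pull [a] A) \<oplus> p (X - A) \<otimes> s a = s a"
    using compl a by (simp add: compl.IH[symmetric] l_distr[symmetric] p_compl)
  ultimately show ?case
    using a pU pU' compl(1) by (metis r_neg1 compl_sets m_closed p_closed s_closed)
qed

text \<open>The adjoint of \<open>p_s\<close>, derived without an involution: inserting
  \<open>p (cyl a) = s a \<otimes> t a\<close> places an \<open>s a\<close> to the right of
  \<open>p A\<close>, where \<open>p_s\<close> applies.\<close>

lemma t_p:
  assumes "A \<in> U" "a \<in> \<AA>" shows "t a \<otimes> p A = p (pull [a] A) \<otimes> t a"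
proof -
  have U: "pull [a] A \<in> U" using assms by (simp add: pull_letter_sets)
  have "t a \<otimes> p A = t a \<otimes> (p (cyl a) \<otimes> p A)"
    using assms t_p_cyl[of a] by (simp add: m_assoc[symmetric])
  also have "\<dots> = t a \<otimes> (p A \<otimes> s a \<otimes> t a)"
    using assms p_comm[of A "cyl a"] by (simp add: m_assoc s_t)
  also have "\<dots> = (t a \<otimes> s a) \<otimes> p (pull [a] A) \<otimes> t a"
    using assms U by (simp add: m_assoc p_s)
  also have "\<dots> = p (pull [a] A) \<otimes> (p (dom a) \<otimes> t a)"
    using assms U by (simp add: t_s p_mult m_assoc p_mult_left Int_commute)
  finally show ?thesis using assms by (simp add: p_dom_t)
qed

text \<open>The pushed set lies in the cylinder of a, so its projection absorbs
  \<open>s a \<otimes> t a\<close> and then moves past \<open>s a\<close>; the surplus factor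
  \<open>p (dom a)\<close> is absorbed by \<open>t a\<close>.\<close>

lemma s_p_t:
  assumes "A \<in> U" "a \<in> \<AA>" shows "s a \<otimes> p A \<otimes> t a = p (push X [a] A)"
proof -
  have U: "push X [a] A \<in> U" using assms by (simp add: push_letter_sets)
  have e: "pull [a] (push X [a] A) = A \<inter> dom a" "push X [a] A \<inter> cyl a = push X [a] A"
    using shift_sets_subset[OF assms(1)] by (auto simp: pull_def push_def)
  have "p (push X [a] A) = p (push X [a] A) \<otimes> (s a \<otimes> t a)"
    using assms U e by (simp add: s_t p_mult)
  also have "\<dots> = s a \<otimes> p (A \<inter> dom a) \<otimes> t a"
    using assms U e p_s[OF U assms(2)] by (simp add: m_assoc[symmetric])
  also have "\<dots> = s a \<otimes> (p A \<otimes> (p (dom a) \<otimes> t a))"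
    using assms by (simp add: m_assoc p_mult_left)
  finally show ?thesis using assms by (simp add: p_dom_t m_assoc)
qed

lemma t_s_distinct:
  assumes "a \<in> \<AA>" "b \<in> \<AA>" "a \<noteq> b" shows "t a \<otimes> s b = \<zero>"
proof -
  have "t a \<otimes> s b = t a \<otimes> (p (cyl a) \<otimes> s b)"
    using assms t_p_cyl[of a] by (simp add: m_assoc[symmetric])
  also have "p (cyl a) \<otimes> s b = \<zero>"
    using assms by (intro p_s_disjoint cyl_sets) (auto simp: push_def)
  finally show ?thesis using assms by simp
qed

section \<open>Multiplication rules for words\<close>

declare pull_sets [simp] push_sets [simp]

lemma p_sw: "A \<in> U \<Longrightarrow> \<alpha> \<in> lists \<AA> \<Longrightarrow> p A \<otimes> sw \<alpha> = sw \<alpha> \<otimes> p (pull \<alpha> A)"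
proof (induction \<alpha> arbitrary: A)
  case (Cons a \<alpha>)
  have "p A \<otimes> sw (a # \<alpha>) = (p A \<otimes> s a) \<otimes> sw \<alpha>" using Cons.prems by (simp add: m_assoc)
  also have "\<dots> = s a \<otimes> (p (pull [a] A) \<otimes> sw \<alpha>)"
    using Cons.prems by (simp add: p_s m_assoc)
  also have "\<dots> = sw (a # \<alpha>) \<otimes> p (pull \<alpha> (pull [a] A))"
    using Cons by (simp add: m_assoc)
  finally show ?case by (simp add: pull_Cons[of a \<alpha>])
qed simp

lemma tw_p: "A \<in> U \<Longrightarrow> \<alpha> \<in> lists \<AA> \<Longrightarrow> tw \<alpha> \<otimes> p A = p (pull \<alpha> A) \<otimes> tw \<alpha>"
proof (induction \<alpha> arbitrary: A)
  case (Cons a \<alpha>)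
  have "tw (a # \<alpha>) \<otimes> p A = tw \<alpha> \<otimes> (t a \<otimes> p A)" using Cons.prems by (simp add: m_assoc)
  also have "\<dots> = (tw \<alpha> \<otimes> p (pull [a] A)) \<otimes> t a"
    using Cons.prems by (simp add: t_p m_assoc)
  also have "\<dots> = p (pull \<alpha> (pull [a] A)) \<otimes> tw (a # \<alpha>)"
    using Cons by (simp add: m_assoc)
  finally show ?case by (simp add: pull_Cons[of a \<alpha>])
qed simp

lemma sw_dom: "\<alpha> \<in> lists \<AA> \<Longrightarrow> sw \<alpha> \<otimes> p (pull \<alpha> X) = sw \<alpha>"
  using p_sw[of X \<alpha>] by (simp add: p_space)

lemma tw_sw: "\<alpha> \<in> lists \<AA> \<Longrightarrow> tw \<alpha> \<otimes> sw \<alpha> = p (pull \<alpha> X)"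
proof (induction \<alpha>)
  case (Cons a \<alpha>)
  have e: "pull \<alpha> X \<inter> pull \<alpha> (dom a) = pull (a # \<alpha>) X"
    by (auto simp: pull_def dest: build_tail)
  have "tw (a # \<alpha>) \<otimes> sw (a # \<alpha>) = tw \<alpha> \<otimes> ((t a \<otimes> s a) \<otimes> sw \<alpha>)"
    using Cons.prems by (simp add: m_assoc)
  also have "\<dots> = (tw \<alpha> \<otimes> sw \<alpha>) \<otimes> p (pull \<alpha> (dom a))"
    using Cons.prems by (simp add: t_s p_sw m_assoc)
  also have "\<dots> = p (pull (a # \<alpha>) X)"
    using Cons e by (simp add: p_mult)
  finally show ?case .
qed (simp add: p_space)

lemma sw_p_tw: "A \<in> U \<Longrightarrow> \<alpha> \<in> lists \<AA> \<Longrightarrow> sw \<alpha> \<otimes> (p A \<otimes> tw \<alpha>) = p (push X \<alpha> A)"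
proof (induction \<alpha>)
  case (Cons a \<alpha>)
  have "sw (a # \<alpha>) \<otimes> (p A \<otimes> tw (a # \<alpha>)) = s a \<otimes> (sw \<alpha> \<otimes> (p A \<otimes> tw \<alpha>)) \<otimes> t a"
    using Cons.prems by (simp add: m_assoc)
  also have "\<dots> = p (push X [a] (push X \<alpha> A))"
    using Cons by (simp add: s_p_t)
  finally show ?case by (simp add: push_Cons[of a \<alpha>])
qed (simp add: push_Nil shift_sets_subset)

lemma sw_p_eq_zero:
  assumes "\<alpha> \<in> lists \<AA>" "B \<in> U" "pull \<alpha> X \<inter> B = {}" shows "sw \<alpha> \<otimes> p B = \<zero>"
proof -
  have "sw \<alpha> \<otimes> p B = sw \<alpha> \<otimes> (p (pull \<alpha> X) \<otimes> p B)"
    using assms sw_dom[OF assms(1)] by (simp add: m_assoc[symmetric])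
  also have "\<dots> = \<zero>" using assms by (simp add: p_mult)
  finally show ?thesis .
qed

text \<open>Equal first letters cancel to a projection, which moves past the rest of \<beta>; the
  first differing pair gives \<open>t a \<otimes> s b = \<zero>\<close>. The length condition
  ensures that a differing pair is reached.\<close>

lemma tw_sw_incomparable:
  assumes "\<alpha> \<in> lists \<AA>" "\<beta> \<in> lists \<AA>" "length \<alpha> \<le> length \<beta>" "take (length \<alpha>) \<beta> \<noteq> \<alpha>"
  shows "tw \<alpha> \<otimes> sw \<beta> = \<zero>"
  using assms
proof (induction \<alpha> arbitrary: \<beta> rule: list.induct)
  case (Cons a \<alpha>)
  then obtain b \<beta>' where b: "\<beta> = b # \<beta>'" by (cases \<beta>) auto
  have l: "a \<in> \<AA>" "b \<in> \<AA>" "\<alpha> \<in> lists \<AA>" "\<beta>' \<in> lists \<AA>"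
    using Cons.prems(1,2) b by simp_all
  have e: "tw (a # \<alpha>) \<otimes> sw \<beta> = tw \<alpha> \<otimes> ((t a \<otimes> s b) \<otimes> sw \<beta>')"
    using l b by (simp add: m_assoc)
  show ?case
  proof (cases "a = b")
    case True
    then have "tw \<alpha> \<otimes> sw \<beta>' = \<zero>" using Cons.IH[OF l(3,4)] Cons.prems b by auto
    moreover have "tw (a # \<alpha>) \<otimes> sw \<beta> = (tw \<alpha> \<otimes> sw \<beta>') \<otimes> p (pull \<beta>' (dom a))"
      using e True l by (simp add: t_s p_sw m_assoc)
    ultimately show ?thesis using l by simp
  next
    case False
    then show ?thesis using e l by (simp add: t_s_distinct)
  qed
qed simp

section \<open>Combinations of words over a fixed projection\<close>

text \<open>The span is generated term by term instead of being a sum over \<Gamma>, so linear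
  statements follow by adding one term. A word may be added several times; its coefficients are
  collected by \<open>word_span_split\<close>.\<close>

inductive_set word_span :: "'a list set \<Rightarrow> 'a word set \<Rightarrow> 'c set" for \<Gamma> B where
  zero: "\<zero> \<in> word_span \<Gamma> B"
| add: "r \<in> word_span \<Gamma> B \<Longrightarrow> \<gamma> \<in> \<Gamma> \<Longrightarrow> r \<oplus> k c \<otimes> (sw \<gamma> \<otimes> p B) \<in> word_span \<Gamma> B"

lemma word_span_closed:
  assumes "r \<in> word_span \<Gamma> B" "\<Gamma> \<subseteq> lists \<AA>" "B \<in> U" shows "r \<in> carrier R"
  using assms(1)
proof induction
  case (add r \<gamma> c)
  then have "\<gamma> \<in> lists \<AA>" using assms(2) by blast
  then show ?case using add assms(3) by simp
qed simp

lemma word_span_mono: "r \<in> word_span \<Gamma> B \<Longrightarrow> \<Gamma> \<subseteq> \<Delta> \<Longrightarrow> r \<in> word_span \<Delta> B"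
  by (induction rule: word_span.induct) (auto intro: word_span.intros)

lemma word_span_add:
  assumes "r \<in> word_span \<Gamma> B" "r' \<in> word_span \<Gamma> B" "\<Gamma> \<subseteq> lists \<AA>" "B \<in> U"
  shows "r \<oplus> r' \<in> word_span \<Gamma> B"
  using assms(2)
proof induction
  case zero
  then show ?case using assms word_span_closed by simp
next
  case (add r' \<gamma> c)
  have "\<gamma> \<in> lists \<AA>" "r \<in> carrier R" "r' \<in> carrier R"
    using add assms word_span_closed by blast+
  then have "r \<oplus> (r' \<oplus> k c \<otimes> (sw \<gamma> \<otimes> p B)) = (r \<oplus> r') \<oplus> k c \<otimes> (sw \<gamma> \<otimes> p B)"
    using assms(4) by (simp add: a_assoc)
  then show ?case using word_span.add[OF add.IH add.hyps(2)] by simp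
qed

lemma word_span_single:
  assumes "\<gamma> \<in> \<Gamma>" "\<Gamma> \<subseteq> lists \<AA>" "B \<in> U" shows "sw \<gamma> \<otimes> p B \<in> word_span \<Gamma> B"
proof -
  have "\<gamma> \<in> lists \<AA>" using assms by blast
  then show ?thesis
    using word_span.add[OF word_span.zero assms(1), where B = B and c = 1] assms(3) by simp
qed

lemma word_span_scale:
  assumes "r \<in> word_span \<Gamma> B" "\<Gamma> \<subseteq> lists \<AA>" "B \<in> U"
  shows "k c \<otimes> r \<in> word_span \<Gamma> B"
  using assms(1)
proof induction
  case zero
  then show ?case by (simp add: word_span.zero)
next
  case (add r \<gamma> d)
  have "\<gamma> \<in> lists \<AA>" "r \<in> carrier R"
    using add assms word_span_closed by blast+
  then have "k c \<otimes> (r \<oplus> k d \<otimes> (sw \<gamma> \<otimes> p B)) = k c \<otimes> r \<oplus> k (c * d) \<otimes> (sw \<gamma> \<otimes> p B)"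
    using assms(3) by (simp add: r_distr k_mult m_assoc)
  then show ?case using word_span.add[OF add.IH add.hyps(2)] by simp
qed

text \<open>Scalars are central, so multiplying by y on the left and z on the right is linear and
  single terms are enough. Both the set of words and the projection may change.\<close>

lemma word_span_sandwich:
  assumes "r \<in> word_span \<Gamma> B" "\<Gamma> \<subseteq> lists \<AA>" "B \<in> U" "\<Delta> \<subseteq> lists \<AA>" "D \<in> U"
    and y: "y \<in> carrier R" and z: "z \<in> carrier R"
    and step: "\<And>\<gamma>. \<gamma> \<in> \<Gamma> \<Longrightarrow> y \<otimes> (sw \<gamma> \<otimes> p B) \<otimes> z \<in> word_span \<Delta> D"
  shows "y \<otimes> r \<otimes> z \<in> word_span \<Delta> D"
  using assms(1)
proof induction
  case zero
  then show ?case using y z by (simp add: word_span.zero)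
next
  case (add r \<gamma> c)
  define w where "w = sw \<gamma> \<otimes> p B"
  have c: "\<gamma> \<in> lists \<AA>" "r \<in> carrier R"
    using add assms word_span_closed by blast+
  then have w: "w \<in> carrier R" using assms(3) by (simp add: w_def)
  have "y \<otimes> (k c \<otimes> w) = k c \<otimes> (y \<otimes> w)"
    using w y k_central[OF y, of c] by (simp add: m_assoc[symmetric])
  then have "y \<otimes> (r \<oplus> k c \<otimes> w) \<otimes> z = y \<otimes> r \<otimes> z \<oplus> k c \<otimes> (y \<otimes> w \<otimes> z)"
    using c w y z by (simp add: r_distr l_distr m_assoc)
  moreover have "k c \<otimes> (y \<otimes> w \<otimes> z) \<in> word_span \<Delta> D"
    using word_span_scale[OF step[OF add.hyps(2)] assms(4,5)] by (simp add: w_def)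
  ultimately show ?case
    unfolding w_def[symmetric] using word_span_add[OF add.IH _ assms(4,5)] by simp
qed

lemma word_span_split:
  assumes "r \<in> word_span \<Gamma> B" "\<Gamma> \<subseteq> lists \<AA>" "B \<in> U" "\<alpha> \<in> \<Gamma>"
  obtains c r' where "r' \<in> word_span (\<Gamma> - {\<alpha>}) B" "r = k c \<otimes> (sw \<alpha> \<otimes> p B) \<oplus> r'"
proof -
  have \<alpha>: "\<alpha> \<in> lists \<AA>" using assms by blast
  define w where "w = sw \<alpha> \<otimes> p B"
  have w: "w \<in> carrier R" using \<alpha> assms(3) by (simp add: w_def)
  have sub: "\<Gamma> - {\<alpha>} \<subseteq> lists \<AA>" using assms(2) by blast
  have "\<exists>c r'. r' \<in> word_span (\<Gamma> - {\<alpha>}) B \<and> r = k c \<otimes> w \<oplus> r'"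
    using assms(1)
  proof induction
    case zero
    then show ?case using w by (intro exI[of _ 0] exI[of _ \<zero>]) (simp add: word_span.zero)
  next
    case (add r \<gamma> d)
    then obtain c r' where r': "r' \<in> word_span (\<Gamma> - {\<alpha>}) B" "r = k c \<otimes> w \<oplus> r'" by blast
    have cr': "r' \<in> carrier R" using word_span_closed[OF r'(1) sub assms(3)] .
    show ?case
    proof (cases "\<gamma> = \<alpha>")
      case True
      have "k c \<otimes> w \<oplus> r' \<oplus> k d \<otimes> w = k (c + d) \<otimes> w \<oplus> r'"
        using w cr' by (simp add: k_add l_distr a_ac)
      then show ?thesis using True r' w_def by blast
    next
      case False
      then have "\<gamma> \<in> \<Gamma> - {\<alpha>}" using add by blast
      moreover have "\<gamma> \<in> lists \<AA>" using add assms by blast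
      ultimately have "r' \<oplus> k d \<otimes> (sw \<gamma> \<otimes> p B) \<in> word_span (\<Gamma> - {\<alpha>}) B"
        "k c \<otimes> w \<oplus> r' \<oplus> k d \<otimes> (sw \<gamma> \<otimes> p B) = k c \<otimes> w \<oplus> (r' \<oplus> k d \<otimes> (sw \<gamma> \<otimes> p B))"
        using r' w cr' assms(3) by (auto intro: word_span.intros simp: a_assoc simp del: in_lists_conv_set)
      then show ?thesis using r'(2) by metis
    qed
  qed
  with that show ?thesis by (auto simp: w_def)
qed

text \<open>Take a shortest word \<alpha> of \<Gamma>. If its collected coefficient is 0, the word
  is discarded and the argument repeats with the smaller set; as v is nonzero, this ends before
  \<Gamma> is exhausted.\<close>

lemma word_span_leading:
  assumes "finite \<Gamma>" "v \<in> word_span \<Gamma> B" "v \<noteq> \<zero>" "\<Gamma> \<subseteq> lists \<AA>" "B \<in> U"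
  shows "\<exists>\<alpha>\<in>\<Gamma>. \<exists>c r. c \<noteq> 0 \<and> r \<in> word_span {\<gamma> \<in> \<Gamma>. \<gamma> \<noteq> \<alpha> \<and> length \<alpha> \<le> length \<gamma>} B \<and>
    v = k c \<otimes> (sw \<alpha> \<otimes> p B) \<oplus> r"
  using assms
proof (induction "card \<Gamma>" arbitrary: \<Gamma> rule: less_induct)
  case less
  have "\<Gamma> \<noteq> {}"
  proof
    assume e: "\<Gamma> = {}"
    from less.prems(2) have "v = \<zero>" by (cases rule: word_span.cases) (simp_all add: e)
    then show False using less.prems by simp
  qed
  then obtain \<alpha> where \<alpha>: "\<alpha> \<in> \<Gamma>" "\<forall>\<gamma>\<in>\<Gamma>. length \<alpha> \<le> length \<gamma>"
    using less.prems(1) arg_min_if_finite(1)[of \<Gamma> length] arg_min_least[of \<Gamma> _ length] by metis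
  obtain c r where r: "r \<in> word_span (\<Gamma> - {\<alpha>}) B" "v = k c \<otimes> (sw \<alpha> \<otimes> p B) \<oplus> r"
    using word_span_split[OF less.prems(2,4,5) \<alpha>(1)] by blast
  have sub: "\<Gamma> - {\<alpha>} \<subseteq> lists \<AA>" "\<alpha> \<in> lists \<AA>" using less.prems \<alpha> by blast+
  show ?case
  proof (cases "c = 0")
    case True
    then have "v = r"
      using r sub(2) word_span_closed[OF r(1) sub(1) less.prems(5)] less.prems(5) by simp
    with r(1) have v: "v \<in> word_span (\<Gamma> - {\<alpha>}) B" by simp
    have "card (\<Gamma> - {\<alpha>}) < card \<Gamma>" using less.prems(1) \<alpha>(1) by (meson card_Diff1_less)
    from less.hyps[OF this _ v less.prems(3) sub(1) less.prems(5)] less.prems(1)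
    obtain \<beta> c r where *: "\<beta> \<in> \<Gamma> - {\<alpha>}" "c \<noteq> 0"
      "r \<in> word_span {\<gamma> \<in> \<Gamma> - {\<alpha>}. \<gamma> \<noteq> \<beta> \<and> length \<beta> \<le> length \<gamma>} B"
      "v = k c \<otimes> (sw \<beta> \<otimes> p B) \<oplus> r" by blast
    have "r \<in> word_span {\<gamma> \<in> \<Gamma>. \<gamma> \<noteq> \<beta> \<and> length \<beta> \<le> length \<gamma>} B"
      by (rule word_span_mono[OF *(3)]) auto
    with * show ?thesis by blast
  next
    case False
    have "r \<in> word_span {\<gamma> \<in> \<Gamma>. \<gamma> \<noteq> \<alpha> \<and> length \<alpha> \<le> length \<gamma>} B"
      by (rule word_span_mono[OF r(1)]) (use \<alpha> in auto)
    with False r \<alpha> show ?thesis by blast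
  qed
qed

section \<open>Spanning by monomials\<close>

inductive_set monomials :: "'c set" where
  zero: "\<zero> \<in> monomials"
| add: "x \<in> monomials \<Longrightarrow> \<alpha> \<in> lists \<AA> \<Longrightarrow> \<beta> \<in> lists \<AA> \<Longrightarrow> A \<in> U \<Longrightarrow>
    x \<oplus> k c \<otimes> (sw \<alpha> \<otimes> p A \<otimes> tw \<beta>) \<in> monomials"

lemma monomials_closed: "x \<in> monomials \<Longrightarrow> x \<in> carrier R"
  by (induction rule: monomials.induct) (auto simp del: in_lists_conv_set)

lemma monomials_add:
  assumes "x \<in> monomials" "y \<in> monomials" shows "x \<oplus> y \<in> monomials"
  using assms(2)
proof induction
  case zero
  then show ?case using assms monomials_closed by simp
next
  case (add y \<alpha> \<beta> A c)
  have "x \<oplus> (y \<oplus> k c \<otimes> (sw \<alpha> \<otimes> p A \<otimes> tw \<beta>)) = (x \<oplus> y) \<oplus> k c \<otimes> (sw \<alpha> \<otimes> p A \<otimes> tw \<beta>)"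
    using add assms(1) monomials_closed by (simp add: a_assoc)
  then show ?case using monomials.add[OF add.IH add.hyps(2-4)] by simp
qed

lemma monomials_single:
  assumes "\<alpha> \<in> lists \<AA>" "\<beta> \<in> lists \<AA>" "A \<in> U"
  shows "k c \<otimes> (sw \<alpha> \<otimes> p A \<otimes> tw \<beta>) \<in> monomials"
  using monomials.add[OF monomials.zero assms, of c] assms by simp

lemma monomials_left_mult:
  assumes "x \<in> monomials" and y: "y \<in> carrier R"
    and step: "\<And>\<alpha> \<beta> A c. \<alpha> \<in> lists \<AA> \<Longrightarrow> \<beta> \<in> lists \<AA> \<Longrightarrow> A \<in> U \<Longrightarrow>
      k c \<otimes> (y \<otimes> (sw \<alpha> \<otimes> p A \<otimes> tw \<beta>)) \<in> monomials"
  shows "y \<otimes> x \<in> monomials"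
  using assms(1)
proof induction
  case zero
  then show ?case using y by (simp add: monomials.zero)
next
  case (add x \<alpha> \<beta> A c)
  define w where "w = sw \<alpha> \<otimes> p A \<otimes> tw \<beta>"
  have w: "w \<in> carrier R" "x \<in> carrier R" using add monomials_closed by (auto simp: w_def simp del: in_lists_conv_set)
  have "y \<otimes> (k c \<otimes> w) = k c \<otimes> (y \<otimes> w)"
    using w y k_central[OF y, of c] by (simp add: m_assoc[symmetric])
  then have "y \<otimes> (x \<oplus> k c \<otimes> w) = y \<otimes> x \<oplus> k c \<otimes> (y \<otimes> w)"
    using w y by (simp add: r_distr)
  then show ?case
    using monomials_add[OF add.IH step[OF add.hyps(2-4), of c]] by (simp add: w_def)
qed

lemmas generated_induct = generated [consumes 1, case_names one add scale p s t]

text \<open>The span contains \<one> and survives left multiplication by every generator. The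
  interesting case is \<open>t a\<close>: against a first letter of \<alpha> it cancels to a
  projection or gives zero, and for empty \<alpha> it passes \<open>p A\<close> and joins the
  adjoint word, whose index grows to \<beta>a.\<close>

lemma carrier_monomials: "x \<in> carrier R \<Longrightarrow> x \<in> monomials"
proof (induction rule: generated_induct)
  case one
  show ?case using monomials_single[of "[]" "[]" X 1] by (simp add: p_space)
next
  case (add x y)
  then show ?case by (simp add: monomials_add)
next
  case (scale d x)
  have "k c \<otimes> (k d \<otimes> (sw \<alpha> \<otimes> p A \<otimes> tw \<beta>)) \<in> monomials"
    if "\<alpha> \<in> lists \<AA>" "\<beta> \<in> lists \<AA>" "A \<in> U" for \<alpha> \<beta> A c
    using monomials_single[OF that, of "c * d"] that by (simp add: k_mult m_assoc)
  from monomials_left_mult[OF _ _ this] scale show ?case by simp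
next
  case (p D x)
  have "k c \<otimes> (p D \<otimes> (sw \<alpha> \<otimes> p A \<otimes> tw \<beta>)) \<in> monomials"
    if "\<alpha> \<in> lists \<AA>" "\<beta> \<in> lists \<AA>" "A \<in> U" for \<alpha> \<beta> A c
  proof -
    have "p D \<otimes> (sw \<alpha> \<otimes> p A \<otimes> tw \<beta>) = (p D \<otimes> sw \<alpha>) \<otimes> (p A \<otimes> tw \<beta>)"
      using that p by (simp add: m_assoc)
    also have "\<dots> = sw \<alpha> \<otimes> p (pull \<alpha> D \<inter> A) \<otimes> tw \<beta>"
      using that p by (simp add: p_sw m_assoc p_mult_left)
    finally show ?thesis
      using monomials_single[of \<alpha> \<beta> "pull \<alpha> D \<inter> A" c] that p by simp
  qed
  from monomials_left_mult[OF _ _ this] p show ?case by simp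
next
  case (s a x)
  have "k c \<otimes> (s a \<otimes> (sw \<alpha> \<otimes> p A \<otimes> tw \<beta>)) \<in> monomials"
    if "\<alpha> \<in> lists \<AA>" "\<beta> \<in> lists \<AA>" "A \<in> U" for \<alpha> \<beta> A c
    using monomials_single[of "a # \<alpha>" \<beta> A c] that s by (simp add: m_assoc)
  from monomials_left_mult[OF _ _ this] s show ?case by simp
next
  case (t a x)
  have "k c \<otimes> (t a \<otimes> (sw \<alpha> \<otimes> p A \<otimes> tw \<beta>)) \<in> monomials"
    if that: "\<alpha> \<in> lists \<AA>" "\<beta> \<in> lists \<AA>" "A \<in> U" for \<alpha> \<beta> A c
  proof (cases \<alpha>)
    case Nil
    have "t a \<otimes> (sw \<alpha> \<otimes> p A \<otimes> tw \<beta>) = (t a \<otimes> p A) \<otimes> tw \<beta>"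
      using that t Nil by (simp add: m_assoc)
    also have "\<dots> = sw [] \<otimes> p (pull [a] A) \<otimes> tw (\<beta> @ [a])"
      using that t by (simp add: t_p tw_append m_assoc pull_letter_sets)
    finally show ?thesis
      using monomials_single[of "[]" "\<beta> @ [a]" "pull [a] A" c] that t by (simp add: pull_letter_sets)
  next
    case (Cons b \<alpha>')
    have b: "b \<in> \<AA>" "\<alpha>' \<in> lists \<AA>" using Cons that(1) by simp_all
    have e: "t a \<otimes> (sw \<alpha> \<otimes> p A \<otimes> tw \<beta>) = (t a \<otimes> s b) \<otimes> sw \<alpha>' \<otimes> (p A \<otimes> tw \<beta>)"
      using that t Cons b by (simp add: m_assoc)
    show ?thesis
    proof (cases "a = b")
      case True
      then have "t a \<otimes> (sw \<alpha> \<otimes> p A \<otimes> tw \<beta>) = sw \<alpha>' \<otimes> p (pull \<alpha>' (dom b) \<inter> A) \<otimes> tw \<beta>"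
        using e that b by (simp add: t_s p_sw m_assoc p_mult_left)
      then show ?thesis
        using monomials_single[of \<alpha>' \<beta> "pull \<alpha>' (dom b) \<inter> A" c] that b by simp
    next
      case False
      then show ?thesis using e that t b by (simp add: t_s_distinct monomials.zero)
    qed
  qed
  from monomials_left_mult[OF _ _ this] t show ?case by simp
qed

section \<open>Reduction\<close>

lemma pull_mono: "A \<subseteq> B \<Longrightarrow> pull \<alpha> A \<subseteq> pull \<alpha> B"
  by (auto simp: pull_def)

text \<open>The word \<nu> serves to cancel the adjoint words in x, and \<Gamma> records the words
  that remain. The inclusion of B in each \<open>pull \<gamma> X\<close> gives
  \<open>tw \<gamma> \<otimes> sw \<gamma> \<otimes> p B = p B\<close>, so that an adjoint can later
  strip a word without shrinking B.\<close>

definition piece :: "'c \<Rightarrow> 'a list \<Rightarrow> 'a word set \<Rightarrow> bool" where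
  "piece x \<nu> B \<longleftrightarrow> \<nu> \<in> lists \<AA> \<and> B \<in> U \<and>
     (\<exists>\<Gamma>. finite \<Gamma> \<and> \<Gamma> \<subseteq> lists \<AA> \<and> (\<forall>\<gamma>\<in>\<Gamma>. B \<subseteq> pull \<gamma> X) \<and>
       x \<otimes> (sw \<nu> \<otimes> p B) \<in> word_span \<Gamma> B)"

text \<open>The alphabet may be infinite, so the cylinders of a fixed length need not form a finite
  partition of \<open>X\<close>; the finite cover has to be adapted to \<open>x\<close>.\<close>

definition coverable :: "'c \<Rightarrow> bool" where
  "coverable x \<longleftrightarrow> (\<exists>F. finite F \<and> (\<forall>(\<nu>, B)\<in>F. piece x \<nu> B) \<and> X \<subseteq> (\<Union>(\<nu>, B)\<in>F. push X \<nu> B))"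

text \<open>For D inside \<open>pull \<delta> B\<close> one has \<open>p B \<otimes> sw \<delta>
  \<otimes> p D = sw \<delta> \<otimes> p D\<close>. The factor \<open>p B\<close> can therefore be
  inserted, and right multiplication by \<open>sw \<delta> \<otimes> p D\<close> extends every word
  of \<Gamma> by \<delta>.\<close>

lemma piece_refine:
  assumes "piece x \<nu> B" "\<delta> \<in> lists \<AA>" "D \<in> U" "D \<subseteq> pull \<delta> B" "x \<in> carrier R"
  shows "piece x (\<nu> @ \<delta>) D"
proof -
  from assms(1) obtain \<Gamma> where \<Gamma>: "\<nu> \<in> lists \<AA>" "B \<in> U" "finite \<Gamma>" "\<Gamma> \<subseteq> lists \<AA>"
    "\<forall>\<gamma>\<in>\<Gamma>. B \<subseteq> pull \<gamma> X" "x \<otimes> (sw \<nu> \<otimes> p B) \<in> word_span \<Gamma> B"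
    by (auto simp: piece_def simp del: in_lists_conv_set)
  define \<Delta> where "\<Delta> = (\<lambda>\<gamma>. \<gamma> @ \<delta>) ` \<Gamma>"
  have "\<gamma> @ \<delta> \<in> lists \<AA>" if "\<gamma> \<in> \<Gamma>" for \<gamma>
    using subsetD[OF \<Gamma>(4) that] assms(2) by simp
  then have "\<Delta> \<subseteq> lists \<AA>" unfolding \<Delta>_def by (rule image_subsetI)
  moreover have "finite \<Delta>" using \<Gamma>(3) by (simp add: \<Delta>_def)
  ultimately have \<Delta>: "\<Delta> \<subseteq> lists \<AA>" "finite \<Delta>" .
  have dom: "D \<subseteq> pull \<gamma> X" if "\<gamma> \<in> \<Delta>" for \<gamma>
  proof -
    from that obtain \<gamma>' where \<gamma>': "\<gamma>' \<in> \<Gamma>" "\<gamma> = \<gamma>' @ \<delta>" by (auto simp: \<Delta>_def)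
    have "pull \<delta> B \<subseteq> pull \<delta> (pull \<gamma>' X)" using \<Gamma>(5) \<gamma>'(1) by (intro pull_mono) blast
    with assms(4) show ?thesis by (simp add: \<gamma>'(2) pull_append)
  qed
  have e: "pull \<delta> B \<inter> D = D" using assms(4) by blast
  have "\<one> \<otimes> (sw \<gamma> \<otimes> p B) \<otimes> (sw \<delta> \<otimes> p D) \<in> word_span \<Delta> D" if "\<gamma> \<in> \<Gamma>" for \<gamma>
  proof -
    have \<gamma>: "\<gamma> \<in> lists \<AA>" "\<gamma> @ \<delta> \<in> \<Delta>" using that \<Gamma>(4) by (auto simp: \<Delta>_def)
    have "\<one> \<otimes> (sw \<gamma> \<otimes> p B) \<otimes> (sw \<delta> \<otimes> p D) = sw \<gamma> \<otimes> ((p B \<otimes> sw \<delta>) \<otimes> p D)"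
      using \<gamma> \<Gamma> assms by (simp add: m_assoc)
    also have "\<dots> = sw (\<gamma> @ \<delta>) \<otimes> p D"
      using \<gamma> \<Gamma> assms by (simp add: p_sw m_assoc p_mult e sw_append)
    finally show ?thesis using word_span_single[OF \<gamma>(2) \<Delta>(1) assms(3)] by simp
  qed
  from word_span_sandwich[OF \<Gamma>(6,4,2) \<Delta>(1) assms(3) one_closed _ this]
  have "x \<otimes> (sw \<nu> \<otimes> p B) \<otimes> (sw \<delta> \<otimes> p D) \<in> word_span \<Delta> D"
    using \<Gamma> assms by simp
  also have "x \<otimes> (sw \<nu> \<otimes> p B) \<otimes> (sw \<delta> \<otimes> p D) = x \<otimes> (sw \<nu> \<otimes> ((p B \<otimes> sw \<delta>) \<otimes> p D))"
    using \<Gamma> assms by (simp add: m_assoc)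
  also have "\<dots> = x \<otimes> (sw (\<nu> @ \<delta>) \<otimes> p D)"
    using \<Gamma> assms by (simp add: p_sw m_assoc p_mult e sw_append)
  finally have "x \<otimes> (sw (\<nu> @ \<delta>) \<otimes> p D) \<in> word_span \<Delta> D" .
  moreover have "\<nu> @ \<delta> \<in> lists \<AA>" using \<Gamma>(1) assms(2) by simp
  moreover have "\<forall>\<gamma>\<in>\<Delta>. D \<subseteq> pull \<gamma> X" using dom by blast
  ultimately show ?thesis using \<Delta> assms(3) unfolding piece_def by blast
qed

lemma piece_add:
  assumes "piece x \<nu> B" "piece y \<nu> B" "x \<in> carrier R" "y \<in> carrier R"
  shows "piece (x \<oplus> y) \<nu> B"
proof -
  from assms(1) obtain \<Gamma> where \<Gamma>: "\<nu> \<in> lists \<AA>" "B \<in> U" "finite \<Gamma>" "\<Gamma> \<subseteq> lists \<AA>"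
    "\<forall>\<gamma>\<in>\<Gamma>. B \<subseteq> pull \<gamma> X" "x \<otimes> (sw \<nu> \<otimes> p B) \<in> word_span \<Gamma> B"
    by (auto simp: piece_def simp del: in_lists_conv_set)
  from assms(2) obtain \<Delta> where \<Delta>: "finite \<Delta>" "\<Delta> \<subseteq> lists \<AA>"
    "\<forall>\<gamma>\<in>\<Delta>. B \<subseteq> pull \<gamma> X" "y \<otimes> (sw \<nu> \<otimes> p B) \<in> word_span \<Delta> B"
    by (auto simp: piece_def simp del: in_lists_conv_set)
  have "(x \<oplus> y) \<otimes> (sw \<nu> \<otimes> p B) \<in> word_span (\<Gamma> \<union> \<Delta>) B"
    using word_span_add[of _ "\<Gamma> \<union> \<Delta>" B] word_span_mono[OF \<Gamma>(6), of "\<Gamma> \<union> \<Delta>"]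
      word_span_mono[OF \<Delta>(4), of "\<Gamma> \<union> \<Delta>"] \<Gamma>(1,2,4) \<Delta>(2) assms(3,4) by (simp add: l_distr)
  moreover have "finite (\<Gamma> \<union> \<Delta>)" "\<Gamma> \<union> \<Delta> \<subseteq> lists \<AA>" "\<forall>\<gamma>\<in>\<Gamma> \<union> \<Delta>. B \<subseteq> pull \<gamma> X"
    using \<Gamma> \<Delta> by blast+
  ultimately show ?thesis using \<Gamma>(1,2) unfolding piece_def by blast
qed

lemma piece_zero: "\<nu> \<in> lists \<AA> \<Longrightarrow> B \<in> U \<Longrightarrow> x \<otimes> (sw \<nu> \<otimes> p B) = \<zero> \<Longrightarrow> piece x \<nu> B"
  unfolding piece_def by (intro conjI exI[of _ "{}"]) (auto intro: word_span.zero)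

text \<open>Two sets \<open>push X \<nu> B\<close> and \<open>push X \<mu> D\<close> meet only if
  one of the words is a prefix of the other, and the overlap is again such a set over the longer
  word. The overlaps of the two finite covers form a finite cover whose members are pieces of both
  elements.\<close>

lemma coverable_add:
  assumes "coverable x" "coverable y" and c: "x \<in> carrier R" "y \<in> carrier R"
  shows "coverable (x \<oplus> y)"
proof -
  from assms obtain F G where F: "finite F" "\<And>\<nu> B. (\<nu>, B) \<in> F \<Longrightarrow> piece x \<nu> B"
      "X \<subseteq> (\<Union>(\<nu>, B)\<in>F. push X \<nu> B)"
    and G: "finite G" "\<And>\<nu> B. (\<nu>, B) \<in> G \<Longrightarrow> piece y \<nu> B" "X \<subseteq> (\<Union>(\<nu>, B)\<in>G. push X \<nu> B)"
    unfolding coverable_def by fast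
  \<comment> \<open>Incomparable words contribute no point and get the pair \<open>([], {})\<close>,
    which is a piece of every element. Equal words fall under the first branch with an empty
    remainder.\<close>
  define h where "h = (\<lambda>((\<nu>, B), (\<mu>, D)).
    if take (length \<nu>) \<mu> = \<nu> then (\<mu>, pull (drop (length \<nu>) \<mu>) B \<inter> D)
    else if take (length \<mu>) \<nu> = \<mu> then (\<nu>, pull (drop (length \<mu>) \<nu>) D \<inter> B) else ([] :: 'a list, {}))"
  have "piece (x \<oplus> y) \<nu>' B'" if h': "(\<nu>', B') = h ((\<nu>, B), (\<mu>, D))"
    and mem: "(\<nu>, B) \<in> F" "(\<mu>, D) \<in> G" for \<nu>' B' \<nu> B \<mu> D
  proof -
    have P: "piece x \<nu> B" "piece y \<mu> D" using F(2) G(2) mem by blast+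
    then have U: "\<nu> \<in> lists \<AA>" "\<mu> \<in> lists \<AA>" "B \<in> U" "D \<in> U" by (auto simp: piece_def)
    consider (1) \<delta> where "\<mu> = \<nu> @ \<delta>" "\<nu>' = \<mu>" "B' = pull \<delta> B \<inter> D"
      | (2) \<delta> where "\<nu> = \<mu> @ \<delta>" "\<nu>' = \<nu>" "B' = pull \<delta> D \<inter> B"
      | (3) "\<nu>' = []" "B' = {}"
      using h' by (auto simp: h_def split: if_splits) (metis append_take_drop_id)+
    then show ?thesis
    proof cases
      case 1
      have \<delta>: "\<delta> \<in> lists \<AA>" using 1 U by auto
      have "piece x \<nu>' B'" using piece_refine[OF P(1) \<delta>, of B'] 1 U c \<delta> by simp
      moreover have "piece y \<nu>' B'" using piece_refine[OF P(2), of "[]" B'] 1 U c \<delta> by simp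
      ultimately show ?thesis using c by (rule piece_add)
    next
      case 2
      have \<delta>: "\<delta> \<in> lists \<AA>" using 2 U by auto
      have "piece y \<nu>' B'" using piece_refine[OF P(2) \<delta>, of B'] 2 U c \<delta> by simp
      moreover have "piece x \<nu>' B'" using piece_refine[OF P(1), of "[]" B'] 2 U c \<delta> by simp
      ultimately show ?thesis using c piece_add by blast
    next
      case 3
      then show ?thesis using c by (intro piece_zero) auto
    qed
  qed
  then have "\<forall>(\<nu>, B) \<in> h ` (F \<times> G). piece (x \<oplus> y) \<nu> B" by force
  moreover have "z \<in> (\<Union>(\<nu>, B) \<in> h ` (F \<times> G). push X \<nu> B)" if zX: "z \<in> X" for z
  proof -
    obtain \<nu> B \<mu> D where m: "(\<nu>, B) \<in> F" "(\<mu>, D) \<in> G" "z \<in> push X \<nu> B" "z \<in> push X \<mu> D"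
    proof -
      from F(3) zX obtain P where "P \<in> F" "z \<in> (\<lambda>(\<nu>, B). push X \<nu> B) P" by blast
      moreover from G(3) zX obtain Q where "Q \<in> G" "z \<in> (\<lambda>(\<nu>, B). push X \<nu> B) Q" by blast
      ultimately show thesis using that by (cases P, cases Q) simp
    qed
    obtain u where u: "z = \<nu> \<frown> u" "u \<in> B" using m(3) by (auto simp: push_def)
    obtain v where v: "z = \<mu> \<frown> v" "v \<in> D" using m(4) by (auto simp: push_def)
    note uv = u v
    have "\<exists>\<nu>' B'. h ((\<nu>, B), (\<mu>, D)) = (\<nu>', B') \<and> z \<in> push X \<nu>' B'"
    proof (cases "length \<nu> \<le> length \<mu>")
      case True
      obtain \<delta> where \<delta>: "\<mu> = \<nu> @ \<delta>" "u = \<delta> \<frown> v"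
        using conc_eq_conc_cases[of \<nu> u \<mu> v] uv True by metis
      then have "h ((\<nu>, B), (\<mu>, D)) = (\<mu>, pull \<delta> B \<inter> D)" by (simp add: h_def)
      moreover have "z \<in> push X \<mu> (pull \<delta> B \<inter> D)"
        using uv \<delta> zX by (auto simp: push_def pull_def)
      ultimately show ?thesis by blast
    next
      case False
      then obtain \<delta> where \<delta>: "\<nu> = \<mu> @ \<delta>" "v = \<delta> \<frown> u"
        using conc_eq_conc_cases[of \<mu> v \<nu> u] uv by (metis nat_le_linear)
      then have "h ((\<nu>, B), (\<mu>, D)) = (\<nu>, pull \<delta> D \<inter> B)"
        using False by (auto simp: h_def)
      moreover have "z \<in> push X \<nu> (pull \<delta> D \<inter> B)"
        using uv \<delta> zX by (auto simp: push_def pull_def)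
      ultimately show ?thesis by blast
    qed
    then obtain \<nu>' B' where "h ((\<nu>, B), (\<mu>, D)) = (\<nu>', B')" "z \<in> push X \<nu>' B'" by blast
    with m(1,2) show ?thesis by (metis (mono_tags, lifting) SigmaI UN_iff case_prod_conv imageI)
  qed
  then have "X \<subseteq> (\<Union>(\<nu>, B) \<in> h ` (F \<times> G). push X \<nu> B)" by blast
  ultimately show ?thesis
    unfolding coverable_def using F(1) G(1) by (intro exI[of _ "h ` (F \<times> G)"]) simp
qed

text \<open>Three pieces suffice. Off the cylinder of \<beta> the factor \<open>tw \<beta>\<close>
  gives zero. On that cylinder \<open>sw \<beta>\<close> cancels \<open>tw \<beta>\<close>, leaving
  a multiple of \<open>sw \<alpha> \<otimes> p B\<close> over B and zero over the rest.\<close>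

lemma coverable_monomial:
  assumes "\<alpha> \<in> lists \<AA>" "\<beta> \<in> lists \<AA>" "A \<in> U"
  shows "coverable (k c \<otimes> (sw \<alpha> \<otimes> p A \<otimes> tw \<beta>))"
proof -
  define x where "x = k c \<otimes> (sw \<alpha> \<otimes> p A \<otimes> tw \<beta>)"
  define B where "B = A \<inter> pull \<beta> X \<inter> pull \<alpha> X"
  have B: "B \<in> U" using assms by (simp add: B_def)
  have xs: "x \<otimes> (sw \<beta> \<otimes> p D) = k c \<otimes> (sw \<alpha> \<otimes> p (A \<inter> (pull \<beta> X \<inter> D)))" if "D \<in> U" for D
  proof -
    have "x \<otimes> (sw \<beta> \<otimes> p D) = k c \<otimes> (sw \<alpha> \<otimes> (p A \<otimes> ((tw \<beta> \<otimes> sw \<beta>) \<otimes> p D)))"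
      using assms that by (simp add: x_def m_assoc)
    then show ?thesis using assms that by (simp add: tw_sw p_mult)
  qed
  have 1: "piece x \<beta> B"
  proof -
    have "A \<inter> (pull \<beta> X \<inter> B) = B" by (auto simp: B_def)
    then have "x \<otimes> (sw \<beta> \<otimes> p B) \<in> word_span {\<alpha>} B"
      using xs[OF B] word_span_scale[OF word_span_single[of \<alpha> "{\<alpha>}" B]] B assms by simp
    then show ?thesis
      unfolding piece_def using assms B by (intro conjI exI[of _ "{\<alpha>}"]) (auto simp: B_def)
  qed
  have 2: "piece x \<beta> (X - B)"
  proof (rule piece_zero)
    have "pull \<alpha> X \<inter> (A \<inter> (pull \<beta> X \<inter> (X - B))) = {}" by (auto simp: B_def)
    then have "sw \<alpha> \<otimes> p (A \<inter> (pull \<beta> X \<inter> (X - B))) = \<zero>"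
      using assms B by (intro sw_p_eq_zero) simp_all
    then show "x \<otimes> (sw \<beta> \<otimes> p (X - B)) = \<zero>" using xs[of "X - B"] B by simp
  qed (use assms B in simp_all)
  have 3: "piece x [] (X - push X \<beta> X)"
  proof (rule piece_zero)
    have "pull \<beta> (X - push X \<beta> X) = {}"
      by (auto simp: pull_def push_def dest: conc_tail)
    then have "tw \<beta> \<otimes> p (X - push X \<beta> X) = \<zero>"
      using tw_p[of "X - push X \<beta> X" \<beta>] assms by simp
    then show "x \<otimes> (sw [] \<otimes> p (X - push X \<beta> X)) = \<zero>"
      using assms by (simp add: x_def m_assoc)
  qed (use assms in simp_all)
  have "z \<in> push X \<beta> B \<union> push X \<beta> (X - B) \<union> push X [] (X - push X \<beta> X)" if "z \<in> X" for z
    using that by (cases "z \<in> push X \<beta> X") (auto simp: push_def)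
  with 1 2 3 show ?thesis
    unfolding coverable_def x_def[symmetric]
    by (intro exI[of _ "{(\<beta>, B), (\<beta>, X - B), ([], X - push X \<beta> X)}"]) auto
qed

lemma coverable:
  assumes "x \<in> carrier R" shows "coverable x"
  using carrier_monomials[OF assms]
proof induction
  case zero
  show ?case unfolding coverable_def
    by (intro exI[of _ "{([], X)}"]) (auto intro!: piece_zero simp: push_Nil)
next
  case (add x \<alpha> \<beta> A c)
  then show ?case using monomials_closed
    by (intro coverable_add coverable_monomial) auto
qed

lemma p_Un_eq_zero:
  assumes "D \<in> U" "E \<in> U" "x \<in> carrier R" "x \<otimes> p D = \<zero>" "x \<otimes> p E = \<zero>"
  shows "x \<otimes> p (D \<union> E) = \<zero>"
proof -
  have "x \<otimes> p (D \<inter> E) = (x \<otimes> p D) \<otimes> p E"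
    using assms(1-3) by (simp add: m_assoc p_mult)
  also have "\<dots> = \<zero>" using assms by simp
  finally show ?thesis
    using assms by (simp add: p_Un minus_eq r_distr r_minus)
qed

lemma p_Union_eq_zero:
  assumes "finite G" "\<And>D. D \<in> G \<Longrightarrow> D \<in> U \<and> x \<otimes> p D = \<zero>" "x \<in> carrier R"
  shows "\<Union> G \<in> U \<and> x \<otimes> p (\<Union> G) = \<zero>"
  using assms(1,2)
proof (induction G)
  case empty
  then show ?case using assms(3) by simp
next
  case (insert D G)
  then have *: "D \<in> U" "x \<otimes> p D = \<zero>" "\<Union>G \<in> U" "x \<otimes> p (\<Union>G) = \<zero>" by auto
  then show ?case
    using p_Un_eq_zero[OF *(1,3) assms(3) *(2,4)] shift_sets.union[OF *(1,3)]
    by (simp only: Union_insert conj_commute simp_thms)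
qed

text \<open>If x annihilated \<open>sw \<nu> \<otimes> p B\<close> for every piece, multiplying by
  \<open>tw \<nu>\<close> would give zero against \<open>p (push X \<nu> B)\<close>; finitely many
  of these sets make up \<open>X\<close>, so x itself would vanish.\<close>

lemma nonzero_piece:
  assumes x: "x \<in> carrier R" "x \<noteq> \<zero>"
  obtains \<nu> B where "piece x \<nu> B" "x \<otimes> (sw \<nu> \<otimes> p B) \<noteq> \<zero>"
proof (rule ccontr)
  assume "\<not> thesis"
  with that have z: "x \<otimes> (sw \<nu> \<otimes> p B) = \<zero>" if "piece x \<nu> B" for \<nu> B using that by blast
  obtain F where F: "finite F" "\<forall>(\<nu>, B)\<in>F. piece x \<nu> B" "X \<subseteq> (\<Union>(\<nu>, B)\<in>F. push X \<nu> B)"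
    using coverable[OF x(1)] unfolding coverable_def by blast
  have "x \<otimes> p (push X \<nu> B) = \<zero> \<and> push X \<nu> B \<in> U" if "(\<nu>, B) \<in> F" for \<nu> B
  proof -
    have P: "piece x \<nu> B" using F(2) that by blast
    then have U: "\<nu> \<in> lists \<AA>" "B \<in> U" by (simp_all add: piece_def)
    have "x \<otimes> p (push X \<nu> B) = (x \<otimes> (sw \<nu> \<otimes> p B)) \<otimes> tw \<nu>"
      using U x(1) by (simp add: sw_p_tw[symmetric] m_assoc)
    then show ?thesis using z[OF P] U by simp
  qed
  then have *: "\<Union> ((\<lambda>(\<nu>, B). push X \<nu> B) ` F) \<in> U \<and> x \<otimes> p (\<Union> ((\<lambda>(\<nu>, B). push X \<nu> B) ` F)) = \<zero>"
    using F(1) x(1) by (intro p_Union_eq_zero) auto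
  moreover have "\<Union> ((\<lambda>(\<nu>, B). push X \<nu> B) ` F) = X"
    using F(3) by (auto simp: push_def)
  ultimately show False using x by (simp add: p_space)
qed

text \<open>Let \<alpha> be a shortest word with nonzero coefficient c. Left multiplication by
  \<open>k (inverse c) \<otimes> tw \<alpha>\<close> turns its term into \<open>p B\<close>. Every
  other word is at least as long, so it either properly extends \<alpha> and leaves a nonempty
  remainder, or is annihilated.\<close>

lemma reduction_leading_one:
  assumes x: "x \<in> carrier R" "x \<noteq> \<zero>"
  obtains y \<nu> B \<Gamma> r where "y \<in> carrier R" "\<nu> \<in> lists \<AA>" "B \<in> U" "B \<noteq> {}"
    "finite \<Gamma>" "\<Gamma> \<subseteq> lists \<AA>" "[] \<notin> \<Gamma>" "\<And>\<gamma>. \<gamma> \<in> \<Gamma> \<Longrightarrow> B \<subseteq> pull \<gamma> X"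
    "r \<in> word_span \<Gamma> B" "y \<otimes> x \<otimes> (sw \<nu> \<otimes> p B) = p B \<oplus> r"
proof -
  obtain \<nu> B where P: "piece x \<nu> B" "x \<otimes> (sw \<nu> \<otimes> p B) \<noteq> \<zero>"
    using nonzero_piece[OF x] by blast
  define v where "v = x \<otimes> (sw \<nu> \<otimes> p B)"
  from P obtain \<Gamma> where \<Gamma>: "\<nu> \<in> lists \<AA>" "B \<in> U" "finite \<Gamma>" "\<Gamma> \<subseteq> lists \<AA>"
    "\<forall>\<gamma>\<in>\<Gamma>. B \<subseteq> pull \<gamma> X" "v \<in> word_span \<Gamma> B"
    by (auto simp: piece_def v_def simp del: in_lists_conv_set)
  have v: "v \<noteq> \<zero>" "v \<in> carrier R" using P \<Gamma> x by (simp_all add: v_def)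
  have "B \<noteq> {}"
  proof
    assume "B = {}"
    then show False using v(1) \<Gamma>(1) x by (simp add: v_def)
  qed
  obtain \<alpha> c r where \<alpha>: "\<alpha> \<in> \<Gamma>" "c \<noteq> 0" "v = k c \<otimes> (sw \<alpha> \<otimes> p B) \<oplus> r"
    and r: "r \<in> word_span {\<gamma> \<in> \<Gamma>. \<gamma> \<noteq> \<alpha> \<and> length \<alpha> \<le> length \<gamma>} B"
    using word_span_leading[OF \<Gamma>(3,6) v(1) \<Gamma>(4,2)] by blast
  have \<alpha>l: "\<alpha> \<in> lists \<AA>" "B \<subseteq> pull \<alpha> X" using \<alpha>(1) \<Gamma>(4,5) by blast+
  define \<Gamma>' where "\<Gamma>' = {\<gamma> \<in> \<Gamma>. \<gamma> \<noteq> \<alpha> \<and> length \<alpha> \<le> length \<gamma>}"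
  \<comment> \<open>These are the remainders after stripping \<alpha>; the empty one would come from
    \<alpha> itself, whose term has been split off.\<close>
  define \<Delta> where "\<Delta> = {\<delta>. \<delta> \<noteq> [] \<and> \<alpha> @ \<delta> \<in> \<Gamma>}"
  have "\<Delta> \<subseteq> drop (length \<alpha>) ` \<Gamma>" by (force simp: \<Delta>_def)
  then have fin: "finite \<Delta>" using \<Gamma>(3) finite_subset by blast
  have \<Delta>l: "\<Delta> \<subseteq> lists \<AA>" using \<Gamma>(4) by (auto simp: \<Delta>_def)
  have \<Gamma>'l: "\<Gamma>' \<subseteq> lists \<AA>" using \<Gamma>(4) by (auto simp: \<Gamma>'_def)
  have \<Delta>X: "B \<subseteq> pull \<delta> X" if "\<delta> \<in> \<Delta>" for \<delta>
  proof
    fix z assume "z \<in> B"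
    moreover have "\<alpha> @ \<delta> \<in> \<Gamma>" using that by (simp add: \<Delta>_def)
    ultimately have "\<alpha> \<frown> \<delta> \<frown> z \<in> X" using \<Gamma>(5) by (fastforce simp: pull_def)
    then show "z \<in> pull \<delta> X" unfolding pull_def using conc_tail by blast
  qed
  define y where "y = k (inverse c) \<otimes> tw \<alpha>"
  have y: "y \<in> carrier R" using \<alpha>l by (simp add: y_def)
  have rc: "r \<in> carrier R" using word_span_closed[OF r] \<Gamma>'l \<Gamma>(2) by (simp add: \<Gamma>'_def)
  have "tw \<alpha> \<otimes> (sw \<gamma> \<otimes> p B) \<otimes> \<one> \<in> word_span \<Delta> B" if "\<gamma> \<in> \<Gamma>'" for \<gamma>
  proof -
    have \<gamma>: "\<gamma> \<in> lists \<AA>" "\<gamma> \<noteq> \<alpha>" "length \<alpha> \<le> length \<gamma>" "\<gamma> \<in> \<Gamma>"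
      using that \<Gamma>'l by (auto simp: \<Gamma>'_def simp del: in_lists_conv_set)
    have e: "tw \<alpha> \<otimes> (sw \<gamma> \<otimes> p B) \<otimes> \<one> = (tw \<alpha> \<otimes> sw \<gamma>) \<otimes> p B"
      using \<gamma> \<alpha>l \<Gamma>(2) by (simp add: m_assoc)
    show ?thesis
    proof (cases "take (length \<alpha>) \<gamma> = \<alpha>")
      case True
      then obtain \<delta> where \<delta>: "\<gamma> = \<alpha> @ \<delta>" by (metis append_take_drop_id)
      then have d: "\<delta> \<in> \<Delta>" "\<delta> \<in> lists \<AA>" using \<gamma> by (auto simp: \<Delta>_def)
      have "pull \<delta> (pull \<alpha> X) \<inter> B = B" 
        using \<Gamma>(5) \<gamma>(4) unfolding \<delta> pull_append[symmetric] by blast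
      then have "(tw \<alpha> \<otimes> sw \<gamma>) \<otimes> p B = sw \<delta> \<otimes> p B"
        using \<delta> d \<alpha>l \<Gamma>(2)
        by (simp add: sw_append m_assoc[symmetric] tw_sw p_sw) (simp add: m_assoc p_mult)
      then show ?thesis using e word_span_single[OF d(1) \<Delta>l \<Gamma>(2)] by simp
    next
      case False
      then show ?thesis
        using e tw_sw_incomparable[OF \<alpha>l(1) \<gamma>(1,3)] \<Gamma>(2) by (simp add: word_span.zero)
    qed
  qed
  from word_span_sandwich[OF r[folded \<Gamma>'_def] \<Gamma>'l \<Gamma>(2) \<Delta>l \<Gamma>(2) _ one_closed this]
  have "tw \<alpha> \<otimes> r \<in> word_span \<Delta> B" using \<alpha>l rc by simp
  from word_span_scale[OF this \<Delta>l \<Gamma>(2), of "inverse c"]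
  have yr: "y \<otimes> r \<in> word_span \<Delta> B" using \<alpha>l rc by (simp add: y_def m_assoc)
  have "y \<otimes> (k c \<otimes> (sw \<alpha> \<otimes> p B)) = (k (inverse c) \<otimes> k c) \<otimes> ((tw \<alpha> \<otimes> sw \<alpha>) \<otimes> p B)"
    using \<alpha>l \<Gamma>(2) k_central[of "tw \<alpha>" c] by (simp add: y_def m_assoc) (simp add: m_assoc[symmetric])
  also have "\<dots> = p B"
    using \<alpha>l \<Gamma>(2) \<alpha>(2) by (simp add: k_mult[symmetric] tw_sw p_mult Int_absorb1)
  finally have "y \<otimes> v = p B \<oplus> y \<otimes> r"
    using \<alpha>(3) y rc \<alpha>l \<Gamma>(2) by (simp add: r_distr)
  then have "y \<otimes> x \<otimes> (sw \<nu> \<otimes> p B) = p B \<oplus> y \<otimes> r"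
    using y x \<Gamma>(1,2) by (simp add: v_def m_assoc)
  moreover have "[] \<notin> \<Delta>" by (simp add: \<Delta>_def)
  ultimately show ?thesis
    using that[OF y \<Gamma>(1,2) \<open>B \<noteq> {}\<close> fin \<Delta>l _ \<Delta>X yr] by blast
qed

section \<open>Periodic points\<close>

lemma act_zero: "act \<zero> m z n = 0"
proof -
  have "act \<zero> m z n = act \<zero> m z n + act \<zero> m z n"
    using act_add[of \<zero> \<zero> m z n] by (simp only: l_zero zero_closed)
  then show ?thesis by (metis add_cancel_left_left)
qed

lemma act_diff:
  assumes "x \<in> carrier R" "y \<in> carrier R"
  shows "act (x \<ominus> y) m z n = act x m z n - act y m z n"
proof -
  have "(x \<ominus> y) \<oplus> y = x" using assms by (simp add: minus_eq a_assoc l_neg)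
  then show ?thesis using act_add[of "x \<ominus> y" y m z n] assms by simp
qed

lemma act_one: "act \<one> m z n = (if z \<in> X then m z n else 0)"
  using act_k[of 1] by simp

text \<open>The constant function 1 detects the projection: its image is nonzero exactly at the
  points of B.\<close>

lemma p_nonzero:
  assumes "B \<in> U" "B \<noteq> {}" shows "p B \<noteq> \<zero>"
proof
  assume "p B = \<zero>"
  moreover obtain z where "z \<in> B" using assms by blast
  ultimately show False
    using act_p[OF assms(1), of "\<lambda>_ _. 1" z 0] act_zero[of "\<lambda>_ _. 1" z 0] by simp
qed

lemma act_sw:
  assumes "\<alpha> \<in> lists \<AA>"
  shows "act (sw \<alpha>) m z n =
    (if z \<in> X \<and> (\<exists>w. z = \<alpha> \<frown> w) then m (suffix (length \<alpha>) z) (n - int (length \<alpha>)) else 0)"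
  using assms
proof (induction \<alpha> arbitrary: z n rule: list.induct)
  case Nil
  show ?case by (simp add: act_one)
next
  case (Cons a \<alpha>)
  have l: "a \<in> \<AA>" "\<alpha> \<in> lists \<AA>" using Cons.prems by simp_all
  have "act (sw (a # \<alpha>)) m z n =
      (if z \<in> X \<and> z 0 = a then act (sw \<alpha>) m (suffix 1 z) (n - 1) else 0)"
    using l by (simp add: act_mult act_s)
  also have "\<dots> = (if z \<in> X \<and> (\<exists>w. z = (a # \<alpha>) \<frown> w)
      then m (suffix (length (a # \<alpha>)) z) (n - int (length (a # \<alpha>))) else 0)"
    unfolding starts_with_Cons Cons.IH[OF l(2)] using suffix_closed[of z 1] by (simp add: algebra_simps)
  finally show ?case .
qed

definition delta :: "'a word \<Rightarrow> 'a word \<Rightarrow> int \<Rightarrow> 'r" where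
  "delta b z n = (if z = b \<and> n = 0 then 1 else 0)"

lemma act_point_delta: "{b} \<in> U \<Longrightarrow> act (p {b}) (delta b) = delta b"
  by (auto simp: fun_eq_iff act_p delta_def)

text \<open>At a periodic point \<open>sw \<beta> \<otimes> p {b}\<close> plays the role of a
  Laurent variable: it keeps the point b and raises the degree by the length of \<beta>.\<close>

lemma act_loop_delta:
  assumes "{b} \<in> U" "\<beta> \<frown> b = b" "\<beta> \<in> lists \<AA>"
  shows "act (sw \<beta> \<otimes> p {b}) (delta b) = (\<lambda>z n. delta b z (n - int (length \<beta>)))"
proof (intro ext)
  fix z n
  have b: "b \<in> X" using shift_sets_subset[OF assms(1)] by simp
  have "z \<in> X \<and> (\<exists>w. z = \<beta> \<frown> w) \<and> suffix (length \<beta>) z = b \<longleftrightarrow> z = b"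
  proof
    assume "z \<in> X \<and> (\<exists>w. z = \<beta> \<frown> w) \<and> suffix (length \<beta>) z = b"
    then obtain w where "z = \<beta> \<frown> w" "suffix (length \<beta>) z = b" by blast
    then show "z = b" using assms(2) by simp
  next
    assume "z = b"
    then show "z \<in> X \<and> (\<exists>w. z = \<beta> \<frown> w) \<and> suffix (length \<beta>) z = b"
      using b assms(2) suffix_conc_length[of \<beta> b] by metis
  qed
  moreover have "act (sw \<beta> \<otimes> p {b}) (delta b) z n =
      (if z \<in> X \<and> (\<exists>w. z = \<beta> \<frown> w) then delta b (suffix (length \<beta>) z) (n - int (length \<beta>)) else 0)"
    using assms by (simp add: act_mult act_sw act_point_delta)
  ultimately show "act (sw \<beta> \<otimes> p {b}) (delta b) z n = delta b z (n - int (length \<beta>))"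
    by (auto simp: delta_def)
qed

text \<open>Each generator moves the degree by at most one, and an element is built from finitely
  many of them; the bound is uniform in z.\<close>

lemma act_delta_bounded:
  "w \<in> carrier R \<Longrightarrow> \<exists>N. \<forall>z n. \<bar>n\<bar> > N \<longrightarrow> act w (delta b) z n = 0"
proof (induction rule: generated_induct)
  case one
  show ?case by (intro exI[of _ 0]) (simp add: act_one delta_def)
next
  case (add x y)
  then obtain M N where "\<forall>z n. \<bar>n\<bar> > M \<longrightarrow> act x (delta b) z n = 0"
    "\<forall>z n. \<bar>n\<bar> > N \<longrightarrow> act y (delta b) z n = 0" by blast
  with add show ?case by (intro exI[of _ "max M N"]) (simp add: act_add)
next
  case (scale c x)
  then obtain N where "\<forall>z n. \<bar>n\<bar> > N \<longrightarrow> act x (delta b) z n = 0" by blast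
  with scale show ?case by (intro exI[of _ N]) (simp add: act_mult act_k)
next
  case (p A x)
  then obtain N where "\<forall>z n. \<bar>n\<bar> > N \<longrightarrow> act x (delta b) z n = 0" by blast
  with p show ?case by (intro exI[of _ N]) (simp add: act_mult act_p)
next
  case (s a x)
  then obtain N where N: "\<forall>z n. \<bar>n\<bar> > N \<longrightarrow> act x (delta b) z n = 0" by blast
  have "\<bar>n - 1\<bar> > N" if "\<bar>n\<bar> > N + 1" for n using that by simp
  with s N show ?case by (intro exI[of _ "N + 1"]) (simp add: act_mult act_s)
next
  case (t a x)
  then obtain N where N: "\<forall>z n. \<bar>n\<bar> > N \<longrightarrow> act x (delta b) z n = 0" by blast
  have "\<bar>n + 1\<bar> > N" if "\<bar>n\<bar> > N + 1" for n using that by simp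
  with t N show ?case by (intro exI[of _ "N + 1"]) (simp add: act_mult act_t)
qed

text \<open>The degree enters the formulas for the generators only as n - 1, n or n + 1, so every
  operator commutes with translations of the degree.\<close>

lemma act_shift:
  "w \<in> carrier R \<Longrightarrow> act w (\<lambda>z n. m z (n - d)) = (\<lambda>z n. act w m z (n - d))"
proof (induction rule: generated_induct)
  case one
  show ?case by (simp add: fun_eq_iff act_one)
next
  case (add x y)
  then show ?case by (simp add: fun_eq_iff act_add)
next
  case (scale c x)
  then show ?case by (simp add: fun_eq_iff act_mult act_k)
next
  case (p A x)
  then show ?case by (simp add: fun_eq_iff act_mult act_p)
next
  case (s a x)
  have *: "n - 1 - d = n - d - 1" for n by simp
  from s show ?case by (auto simp: fun_eq_iff act_mult act_s *)
next
  case (t a x)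
  have *: "n + 1 - d = n - d + 1" for n by simp
  from t show ?case by (simp add: fun_eq_iff act_mult act_t *)
qed

text \<open>A nonempty word \<gamma> can move \<open>delta b\<close> only into the positive degree
  |\<gamma>|. Degrees up to 0 therefore see nothing but the leading term \<open>p {b}\<close> of a
  sum \<open>p {b} \<oplus> r\<close>.\<close>

lemma act_word_span_delta:
  assumes "r \<in> word_span \<Gamma> {b}" "\<Gamma> \<subseteq> lists \<AA>" "[] \<notin> \<Gamma>" "{b} \<in> U" "n \<le> 0"
  shows "act r (delta b) z n = 0"
  using assms(1)
proof induction
  case zero
  show ?case by (rule act_zero)
next
  case (add r \<gamma> c)
  have "\<gamma> \<in> lists \<AA>" "\<gamma> \<noteq> []" using add assms by blast+
  moreover from this assms(5) have "n \<noteq> int (length \<gamma>)" by auto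
  moreover have "r \<in> carrier R" using add(1) assms word_span_closed by blast
  ultimately show ?case
    using add.IH assms(4,5) 
    by (simp add: act_add act_mult act_k act_sw act_point_delta) (simp add: delta_def)
qed

lemma act_unipotent_delta:
  assumes "r \<in> word_span \<Gamma> {b}" "\<Gamma> \<subseteq> lists \<AA>" "[] \<notin> \<Gamma>" "{b} \<in> U" "n \<le> 0"
  shows "act (p {b} \<oplus> r) (delta b) z n = delta b z n"
  using act_word_span_delta[OF assms] word_span_closed[OF assms(1,2,4)] assms(4)
  by (simp add: act_add act_point_delta)

lemma unipotent_nonzero:
  assumes "r \<in> word_span \<Gamma> {b}" "\<Gamma> \<subseteq> lists \<AA>" "[] \<notin> \<Gamma>" "{b} \<in> U"
  shows "p {b} \<oplus> r \<noteq> \<zero>"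
  using act_unipotent_delta[OF assms, of 0 b] act_zero[of "delta b" b 0]
  by (auto simp: delta_def)

lemma pull_fixed: "\<gamma> \<frown> b = b \<Longrightarrow> pull \<gamma> {b} = {b}"
proof -
  assume "\<gamma> \<frown> b = b"
  then have "\<gamma> \<frown> x = b \<longleftrightarrow> x = b" for x by (metis same_concat_eq)
  then show ?thesis by (simp add: pull_def)
qed

text \<open>Words fixing the same sequence commute: \<gamma>\<beta>b and \<beta>\<gamma>b both equal
  b, and \<gamma>\<beta> and \<beta>\<gamma> are its prefixes of the same length. A loop multiplied
  on the right can thus be moved to the left, where left ideals absorb it.\<close>

lemma word_span_loop:
  assumes "r \<in> word_span \<Gamma> {b}" "\<Gamma> \<subseteq> lists \<AA>" "{b} \<in> U" "\<And>\<gamma>. \<gamma> \<in> \<Gamma> \<Longrightarrow> \<gamma> \<frown> b = b"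
    and \<beta>: "\<beta> \<frown> b = b" "\<beta> \<in> lists \<AA>"
  shows "r \<otimes> p {b} = r" and "r \<otimes> (sw \<beta> \<otimes> p {b}) = sw \<beta> \<otimes> r"
  using assms(1)
proof induction
  case zero
  { case 1 show ?case using assms by simp }
  { case 2 show ?case using assms by simp }
next
  case (add r \<gamma> c)
  have \<gamma>: "\<gamma> \<in> lists \<AA>" "\<gamma> \<frown> b = b" using add(2) assms by blast+
  have rc: "r \<in> carrier R" using add(1) assms word_span_closed by blast
  have e: "p {b} \<otimes> p {b} = p {b}" using assms(3) by (simp add: p_mult)
  { case 1
    show ?case using add.IH(1) \<gamma> rc assms(3) e by (simp add: l_distr m_assoc)
  next
    case 2
    have "(\<gamma> @ \<beta>) \<frown> b = (\<beta> @ \<gamma>) \<frown> b" using \<gamma> \<beta> by (simp flip: conc_conc)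
    then have comm: "\<gamma> @ \<beta> = \<beta> @ \<gamma>" by (subst (asm) concat_eq) auto
    have "(sw \<gamma> \<otimes> p {b}) \<otimes> (sw \<beta> \<otimes> p {b}) = sw \<gamma> \<otimes> ((p {b} \<otimes> sw \<beta>) \<otimes> p {b})"
      using \<gamma> \<beta> assms(3) by (simp add: m_assoc)
    also have "\<dots> = sw (\<gamma> @ \<beta>) \<otimes> p {b}"
      using \<gamma> \<beta> assms(3) e by (simp add: p_sw pull_fixed m_assoc sw_append)
    also have "\<dots> = sw \<beta> \<otimes> (sw \<gamma> \<otimes> p {b})"
      using \<gamma> \<beta> assms(3) by (simp add: comm sw_append m_assoc)
    finally have *: "(sw \<gamma> \<otimes> p {b}) \<otimes> (sw \<beta> \<otimes> p {b}) = sw \<beta> \<otimes> (sw \<gamma> \<otimes> p {b})" .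
    have "k c \<otimes> (sw \<gamma> \<otimes> p {b}) \<otimes> (sw \<beta> \<otimes> p {b}) = k c \<otimes> ((sw \<gamma> \<otimes> p {b}) \<otimes> (sw \<beta> \<otimes> p {b}))"
      using \<gamma> \<beta> assms(3) by (simp add: m_assoc)
    also have "\<dots> = (k c \<otimes> sw \<beta>) \<otimes> (sw \<gamma> \<otimes> p {b})"
      using \<gamma> \<beta> assms(3) * by (simp add: m_assoc)
    also have "\<dots> = sw \<beta> \<otimes> (k c \<otimes> (sw \<gamma> \<otimes> p {b}))"
      using \<gamma> \<beta> assms(3) k_central[of "sw \<beta>" c] by (simp add: m_assoc)
    finally show ?case using add.IH(2) \<gamma> \<beta> rc assms(3) by (simp add: l_distr r_distr) }
qed

text \<open>The value at n recurs at n + jd for all j \<ge> 0 and so occurs beyond the bound. The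
  set \<open>T\<close> confines the recursion to a half line, which is run through downwards for
  negative d and upwards for positive d.\<close>

lemma bounded_support_periodic_zero:
  fixes g :: "int \<Rightarrow> 'r"
  assumes rec: "\<And>n. n \<in> T \<Longrightarrow> g n = g (n + d)" and T: "\<And>n. n \<in> T \<Longrightarrow> n + d \<in> T"
    and d: "d \<noteq> 0" and bounded: "\<And>n. \<bar>n\<bar> > N \<Longrightarrow> g n = 0" and n: "n \<in> T"
  shows "g n = 0"
proof -
  have *: "n + int j * d \<in> T \<and> g (n + int j * d) = g n" for j
  proof (induction j)
    case (Suc j)
    have *: "n + int (Suc j) * d = (n + int j * d) + d" by (simp add: algebra_simps)
    then show ?case
      unfolding * using Suc rec[of "n + int j * d"] T[of "n + int j * d"] by simp
  qed (simp add: n)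
  \<comment> \<open>With this j, |n + jd| \<ge> j - |n| > |N|; the absolute value covers a negative
    \<open>N\<close>.\<close>
  define j where "j = nat (\<bar>n\<bar> + \<bar>N\<bar> + 1)"
  have "\<bar>int j * d\<bar> \<ge> int j"
    using d by (simp add: abs_mult mult_le_cancel_left1 zero_less_abs_iff int_one_le_iff_zero_less)
  then have "\<bar>n + int j * d\<bar> > N" unfolding j_def by linarith
  then show ?thesis using bounded * by metis
qed

text \<open>If \<open>e - s\<^sub>\<beta> e\<close> carried \<open>J\<close> onto itself, it could be divided off any element
  of \<open>J\<close> again and again, shrinking each time the range of degrees of its action on \<open>delta b\<close>.\<close>

lemma no_minimal_left_ideal_at_periodic:
  assumes b: "{b} \<in> U" and \<beta>: "\<beta> \<noteq> []" "\<beta> \<frown> b = b" and J: "minimal_left_ideal J R"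
    and \<Gamma>: "\<Gamma> \<subseteq> lists \<AA>" "[] \<notin> \<Gamma>" "\<And>\<gamma>. \<gamma> \<in> \<Gamma> \<Longrightarrow> \<gamma> \<frown> b = b"
    and r: "r \<in> word_span \<Gamma> {b}" "p {b} \<oplus> r \<in> J"
  shows False
proof -
  have bX: "b \<in> X" using shift_sets_subset[OF b] by simp
  have \<beta>l: "\<beta> \<in> lists \<AA>" using conc_letters[of \<beta> b] \<beta> bX by simp
  have JL: "left_ideal J R" using J by (simp add: minimal_left_ideal_def)
  note J' = left_idealD[OF JL]
  define e where "e = p {b}"
  define u where "u = sw \<beta> \<otimes> e"
  define D where "D = e \<ominus> u"
  define q where "q = e \<oplus> r"
  define d where "d = int (length \<beta>)"
  have d: "d > 0" using \<beta> by (simp add: d_def)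
  have ec: "e \<in> carrier R" "e \<otimes> e = e" using b by (simp_all add: e_def p_mult)
  have uc: "u \<in> carrier R" "D \<in> carrier R" using ec \<beta>l by (simp_all add: u_def D_def)
  have rc: "r \<in> carrier R" using word_span_closed[OF r(1) \<Gamma>(1) b] .
  have q: "q \<in> J" "q \<in> carrier R" using r(2) J'(1) by (auto simp: q_def e_def)
  have eu: "e \<otimes> u = u"
    using b \<beta>l \<beta>(2) ec p_sw[OF b \<beta>l] by (simp add: u_def e_def pull_fixed m_assoc[symmetric])
      (simp add: m_assoc)
  have ru: "r \<otimes> e = r" "r \<otimes> u = sw \<beta> \<otimes> r"
    using word_span_loop[OF r(1) \<Gamma>(1) b \<Gamma>(3) \<beta>(2) \<beta>l] by (simp_all add: u_def e_def)
  have qD: "q \<otimes> D = q \<ominus> sw \<beta> \<otimes> q"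
    using ec uc rc \<beta>l eu ru
    by (simp add: q_def D_def minus_eq l_distr r_distr r_minus) (simp add: u_def)
  have act_D: "act (w \<otimes> D) (delta b) z n = act w (delta b) z n - act w (delta b) z (n - d)"
    if "w \<in> carrier R" for w z n
  proof -
    have "w \<otimes> D = w \<otimes> e \<ominus> w \<otimes> u"
      using that ec uc by (simp add: D_def minus_eq r_distr r_minus)
    moreover have "act (w \<otimes> e) (delta b) = act w (delta b)"
      using that ec b by (simp add: act_mult e_def act_point_delta)
    moreover have "act u (delta b) = (\<lambda>z n. delta b z (n - d))"
      using act_loop_delta[OF b \<beta>(2) \<beta>l] by (simp add: u_def e_def d_def)
    then have "act (w \<otimes> u) (delta b) = (\<lambda>z n. act w (delta b) z (n - d))"
      using that uc by (simp add: act_mult act_shift)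
    ultimately show ?thesis
      using that ec uc by (simp add: act_diff)
  qed
  have q0: "act q (delta b) b n = delta b b n" if "n \<le> 0" for n
    using act_unipotent_delta[OF r(1) \<Gamma>(1,2) b that] by (simp add: q_def e_def)
  \<comment> \<open>The value is the difference of the values of \<open>delta b\<close> at b in
    degrees 0 and -d, that is 1 - 0.\<close>
  have "act (q \<otimes> D) (delta b) b 0 = 1"
    using d by (simp add: act_D[OF q(2)] q0 delta_def)
  then have qD0: "q \<otimes> D \<noteq> \<zero>" using act_zero by auto
  have JD: "minimal_left_ideal (right_translate R J D) R"
    by (rule minimal_right_translate(2)[OF J uc(2) q(1) qD0])
  have JDL: "left_ideal (right_translate R J D) R"
    by (rule left_ideal_right_translate[OF JL uc(2)])
  have mem: "q \<otimes> D \<in> J \<inter> right_translate R J D"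
  proof
    show "q \<otimes> D \<in> right_translate R J D" using q(1) by (auto simp: right_translate_def)
    show "q \<otimes> D \<in> J" unfolding qD using J'(4)[OF q(1) J'(5)[OF _ q(1)]] \<beta>l by simp
  qed
  have "J \<inter> right_translate R J D = J"
    by (rule minimal_left_ideal_eqI[OF J left_ideal_Int[OF JL JDL] _ mem qD0]) simp
  moreover have "J \<inter> right_translate R J D = right_translate R J D"
    by (rule minimal_left_ideal_eqI[OF JD left_ideal_Int[OF JL JDL] _ mem qD0]) simp
  ultimately have JJ: "J = right_translate R J D" by simp
  \<comment> \<open>Writing w = w'D, the support of w' keeps the lower end l of the window, while
    the upper end drops by d \<ge> 1; the induction records a loss of one. Outside the window w'
    repeats with period d, and its bounded support makes it zero there.\<close>
  have vanish: "\<forall>z n. act w (delta b) z n = 0"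
    if "w \<in> J" "\<And>z n. act w (delta b) z n \<noteq> 0 \<Longrightarrow> l \<le> n \<and> n < l + int j" for j w l
    using that
  proof (induction j arbitrary: w)
    case 0
    then show ?case by fastforce
  next
    case (Suc j)
    obtain w' where w': "w' \<in> J" "w = w' \<otimes> D"
      using Suc.prems(1) JJ by (auto simp: right_translate_def)
    have w'c: "w' \<in> carrier R" using w'(1) J'(1) by blast
    have v: "act w (delta b) z n = act w' (delta b) z n - act w' (delta b) z (n - d)" for z n
      using act_D[OF w'c] w'(2) by simp
    obtain N where N: "\<And>z n. \<bar>n\<bar> > N \<Longrightarrow> act w' (delta b) z n = 0"
      using act_delta_bounded[OF w'c] by blast
    have "act w' (delta b) z n = 0" if "n < l" for z n
    proof (rule bounded_support_periodic_zero[where T = "{..<l}" and d = "- d" and N = N])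
      fix i assume "i \<in> {..<l}"
      then have "act w (delta b) z i = 0" using Suc.prems(2)[of z i] by fastforce
      then show "act w' (delta b) z i = act w' (delta b) z (i + - d)" by (simp add: v)
    qed (use that d N in auto)
    moreover have "act w' (delta b) z n = 0" if "n \<ge> l + int j" for z n
    proof (rule bounded_support_periodic_zero[where T = "{l + int j..}" and d = d and N = N])
      fix i assume "i \<in> {l + int j..}"
      then have "act w (delta b) z (i + d) = 0" using Suc.prems(2)[of z "i + d"] d by fastforce
      then show "act w' (delta b) z i = act w' (delta b) z (i + d)" by (simp add: v)
    qed (use that d N in auto)
    ultimately have supp: "l \<le> n \<and> n < l + int j" if "act w' (delta b) z n \<noteq> 0" for z n
      using that by (meson not_le)
    have "\<forall>z n. act w' (delta b) z n = 0"
      by (rule Suc.IH[OF w'(1)]) (rule supp)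
    then show ?case by (simp add: v)
  qed
  \<comment> \<open>The degrees from -N to N form the initial window, of length 2N + 1.\<close>
  obtain N where N: "\<And>z n. \<bar>n\<bar> > N \<Longrightarrow> act q (delta b) z n = 0"
    using act_delta_bounded[OF q(2)] by blast
  have "\<forall>z n. act q (delta b) z n = 0"
  proof (rule vanish[OF q(1)])
    fix z n assume "act q (delta b) z n \<noteq> 0"
    then have "\<bar>n\<bar> \<le> N" using N by (meson not_le)
    then show "- N \<le> n \<and> n < - N + int (nat (2 * N + 1))" by auto
  qed
  with q0[of 0] show False by (simp add: delta_def)
qed

section \<open>Minimal left ideals\<close>

lemma word_span_empty: "r \<in> word_span {} B \<Longrightarrow> r = \<zero>"
  by (induction rule: word_span.induct) auto

lemma reduction:
  assumes x: "x \<in> carrier R" "x \<noteq> \<zero>"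
  obtains (idempotent) y \<nu> B where "y \<in> carrier R" "\<nu> \<in> lists \<AA>" "B \<in> U" "B \<noteq> {}"
      "y \<otimes> x \<otimes> (sw \<nu> \<otimes> p B) = p B"
    | (periodic) y \<nu> b \<beta> \<Gamma> r where "y \<in> carrier R" "\<nu> \<in> lists \<AA>" "{b} \<in> U"
      "\<beta> \<noteq> []" "\<beta> \<frown> b = b" "\<Gamma> \<subseteq> lists \<AA>" "[] \<notin> \<Gamma>" "\<And>\<gamma>. \<gamma> \<in> \<Gamma> \<Longrightarrow> \<gamma> \<frown> b = b"
      "r \<in> word_span \<Gamma> {b}" "y \<otimes> x \<otimes> (sw \<nu> \<otimes> p {b}) = p {b} \<oplus> r"
proof -
  obtain y \<nu> B \<Gamma> r where y: "y \<in> carrier R" "\<nu> \<in> lists \<AA>" and B: "B \<in> U" "B \<noteq> {}"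
    and \<Gamma>: "finite \<Gamma>" "\<Gamma> \<subseteq> lists \<AA>" "[] \<notin> \<Gamma>" "\<And>\<gamma>. \<gamma> \<in> \<Gamma> \<Longrightarrow> B \<subseteq> pull \<gamma> X"
    and r: "r \<in> word_span \<Gamma> B" "y \<otimes> x \<otimes> (sw \<nu> \<otimes> p B) = p B \<oplus> r"
    using reduction_leading_one[OF x] by blast
  have rc: "r \<in> carrier R" using word_span_closed[OF r(1) \<Gamma>(2) B(1)] .
  have cut: "p D \<otimes> y \<otimes> x \<otimes> (sw \<nu> \<otimes> p D) = p D \<oplus> p D \<otimes> r \<otimes> p D"
    if D: "D \<in> U" "D \<subseteq> B" for D
  proof -
    have e: "p B \<otimes> p D = p D" "p D \<otimes> p D = p D"
      using D B(1) by (simp_all add: p_mult Int_absorb1)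
    have "p D \<otimes> y \<otimes> x \<otimes> (sw \<nu> \<otimes> p D) = p D \<otimes> (y \<otimes> x \<otimes> (sw \<nu> \<otimes> p B)) \<otimes> p D"
      using D B y x e by (simp add: m_assoc)
    also have "\<dots> = p D \<oplus> p D \<otimes> r \<otimes> p D"
      using D B rc e by (simp add: r(2) l_distr r_distr m_assoc)
    finally show ?thesis .
  qed
  \<comment> \<open>Cutting on both sides leaves of the term for \<gamma> only those z in D for
    which \<gamma>z is in D again; the two choices of D below control this set.\<close>
  have sandwich: "p D \<otimes> (sw \<gamma> \<otimes> p B) \<otimes> p D = sw \<gamma> \<otimes> p (pull \<gamma> D \<inter> D)"
    if D: "D \<in> U" "D \<subseteq> B" and \<gamma>: "\<gamma> \<in> \<Gamma>" for D \<gamma>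
  proof -
    have \<gamma>l: "\<gamma> \<in> lists \<AA>" using \<gamma> \<Gamma>(2) by blast
    have "p D \<otimes> (sw \<gamma> \<otimes> p B) \<otimes> p D = (p D \<otimes> sw \<gamma>) \<otimes> (p B \<otimes> p D)"
      using D B \<gamma>l by (simp add: m_assoc)
    also have "p B \<otimes> p D = p D" using D B(1) by (simp add: p_mult Int_absorb1)
    finally show ?thesis using D \<gamma>l by (simp add: p_sw m_assoc p_mult)
  qed
  show ?thesis
  proof (cases "\<exists>b\<in>B. \<forall>\<gamma>\<in>\<Gamma>. \<gamma> \<frown> b \<noteq> b")
    case True
    then obtain b where b: "b \<in> B" "\<And>\<gamma>. \<gamma> \<in> \<Gamma> \<Longrightarrow> \<gamma> \<frown> b \<noteq> b" by blast
    have bX: "b \<in> X" using b(1) shift_sets_subset[OF B(1)] by blast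
    have "finite ((\<lambda>\<gamma>. \<gamma> \<frown> b) ` \<Gamma>)" "b \<notin> (\<lambda>\<gamma>. \<gamma> \<frown> b) ` \<Gamma>"
      using \<Gamma>(1) b(2) by (simp, metis imageE)
    then obtain n where n: "\<And>z. z \<in> (\<lambda>\<gamma>. \<gamma> \<frown> b) ` \<Gamma> \<Longrightarrow> \<exists>m<n. z m \<noteq> b m"
      using separating_length by blast
    define D where "D = B \<inter> {z \<in> X. \<forall>m<n. z m = b m}"
    have D: "D \<in> U" "D \<subseteq> B" "D \<noteq> {}"
      using B(1) cylinder_sets[OF bX] b(1) bX by (auto simp: D_def)
    have disj: "pull \<gamma> D \<inter> D = {}" if \<gamma>: "\<gamma> \<in> \<Gamma>" for \<gamma>
    proof (rule ccontr)
      assume "pull \<gamma> D \<inter> D \<noteq> {}"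
      then obtain z where z: "\<gamma> \<frown> z \<in> D" "z \<in> D" by (auto simp: pull_def)
      obtain m where m: "m < n" "(\<gamma> \<frown> b) m \<noteq> b m" using n \<gamma> by blast
      \<comment> \<open>Prefixing \<gamma> preserves agreement on the first n positions, so
        \<gamma>z would inherit the difference of \<gamma>b from b.\<close>
      have "(\<gamma> \<frown> z) m = (\<gamma> \<frown> b) m"
        using z(2) m(1) by (cases "m < length \<gamma>") (auto simp: D_def)
      then show False using z(1) m by (auto simp: D_def)
    qed
    have "p D \<otimes> r \<otimes> p D \<in> word_span {} D"
    proof (rule word_span_sandwich[OF r(1) \<Gamma>(2) B(1)])
      fix \<gamma> assume \<gamma>: "\<gamma> \<in> \<Gamma>"
      then have "\<gamma> \<in> lists \<AA>" using \<Gamma>(2) by blast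
      then show "p D \<otimes> (sw \<gamma> \<otimes> p B) \<otimes> p D \<in> word_span {} D"
        using sandwich[OF D(1,2) \<gamma>] disj[OF \<gamma>] by (simp add: word_span.zero)
    qed (use D in simp_all)
    then have "p D \<otimes> r \<otimes> p D = \<zero>" by (rule word_span_empty)
    then have "p D \<otimes> y \<otimes> x \<otimes> (sw \<nu> \<otimes> p D) = p D"
      using cut[OF D(1,2)] D(1) by simp
    with idempotent[of "p D \<otimes> y" \<nu> D] D y show ?thesis by simp
  next
    case False
    have iter: "\<exists>\<gamma>\<in>\<Gamma>. \<gamma> \<frown> b = b \<and> b = \<gamma>\<^sup>\<omega>" if b: "b \<in> B" for b
    proof -
      obtain \<gamma> where "\<gamma> \<in> \<Gamma>" "\<gamma> \<frown> b = b" using False b by blast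
      moreover from this have "\<gamma> \<noteq> []" using \<Gamma>(3) by blast
      ultimately show ?thesis using fixed_by_conc_imp_iter by blast
    qed
    \<comment> \<open>Every point of B is now fixed by some nonempty word of \<Gamma> and hence
      determined by it. This makes B finite, so a cylinder isolates one of its points.\<close>
    then have "B \<subseteq> (\<lambda>\<gamma>. \<gamma>\<^sup>\<omega>) ` \<Gamma>" by blast
    then have fin: "finite B" using \<Gamma>(1) finite_surj by blast
    obtain b where b: "b \<in> B" using B(2) by blast
    have bX: "b \<in> X" using b shift_sets_subset[OF B(1)] by blast
    obtain \<beta> where \<beta>: "\<beta> \<in> \<Gamma>" "\<beta> \<frown> b = b" using iter[OF b] by blast
    have "\<beta> \<noteq> []" using \<beta>(1) \<Gamma>(3) by blast
    obtain n where n: "\<And>z. z \<in> B - {b} \<Longrightarrow> \<exists>m<n. z m \<noteq> b m"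
      using separating_length[of "B - {b}" b] fin by blast
    have "{b} = B \<inter> {z \<in> X. \<forall>m<n. z m = b m}" using n b bX by blast
    then have D: "{b} \<in> U" "{b} \<subseteq> B"
      using Int_sets[OF B(1) cylinder_sets[OF bX, of n]] b by simp_all
    \<comment> \<open>Only words fixing b survive the cut to the single point b.\<close>
    define \<Delta> where "\<Delta> = {\<gamma> \<in> \<Gamma>. \<gamma> \<frown> b = b}"
    have \<Delta>: "\<Delta> \<subseteq> lists \<AA>" "[] \<notin> \<Delta>" "\<And>\<gamma>. \<gamma> \<in> \<Delta> \<Longrightarrow> \<gamma> \<frown> b = b"
      using \<Gamma>(2,3) by (auto simp: \<Delta>_def simp del: in_lists_conv_set)
    have "p {b} \<otimes> r \<otimes> p {b} \<in> word_span \<Delta> {b}"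
    proof (rule word_span_sandwich[OF r(1) \<Gamma>(2) B(1) \<Delta>(1) D(1)])
      fix \<gamma> assume \<gamma>: "\<gamma> \<in> \<Gamma>"
      then have \<gamma>l: "\<gamma> \<in> lists \<AA>" using \<Gamma>(2) by blast
      show "p {b} \<otimes> (sw \<gamma> \<otimes> p B) \<otimes> p {b} \<in> word_span \<Delta> {b}"
      proof (cases "\<gamma> \<frown> b = b")
        case True
        then have "\<gamma> \<in> \<Delta>" using \<gamma> by (simp add: \<Delta>_def)
        then show ?thesis
          using sandwich[OF D \<gamma>] word_span_single[OF _ \<Delta>(1) D(1)] True by (simp add: pull_fixed)
      next
        case False
        then have "pull \<gamma> {b} \<inter> {b} = {}" by (auto simp: pull_def)
        then show ?thesis using sandwich[OF D \<gamma>] \<gamma>l by (simp add: word_span.zero)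
      qed
    qed (use D in simp_all)
    with periodic[of "p {b} \<otimes> y" \<nu> b \<beta> \<Delta> "p {b} \<otimes> r \<otimes> p {b}"]
      cut[OF D] D y \<beta> \<Delta> \<open>\<beta> \<noteq> []\<close> show ?thesis by simp
  qed
qed

text \<open>A second point in B would give a proper nonempty subset D whose projection also
  generates J; then \<open>p B\<close> is a left multiple of \<open>p D\<close>, which forces D = B.
  If the point were \<alpha>c with c periodic, right translation by
  \<open>sw \<alpha> \<otimes> p {c}\<close> would carry J to a minimal left ideal containing
  \<open>p {c}\<close>, which is impossible.\<close>

lemma minimal_imp_irrational:
  assumes B: "B \<in> U" "B \<noteq> {}" and J: "minimal_left_ideal J R" "p B \<in> J"
  shows "B \<in> irrational_paths X"
proof -
  have JL: "left_ideal J R" using J by (simp add: minimal_left_ideal_def)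
  note J' = left_idealD[OF JL]
  obtain b where b: "b \<in> B" using B by blast
  have bX: "b \<in> X" using b shift_sets_subset[OF B(1)] by blast
  have Bb: "B = {b}"
  proof (rule ccontr)
    assume "B \<noteq> {b}"
    then obtain z where z: "z \<in> B" "z \<noteq> b" using b by blast
    obtain n where n: "\<exists>m<n. z m \<noteq> b m" using separating_length[of "{z}" b] z by blast
    define D where "D = B \<inter> {z \<in> X. \<forall>m<n. z m = b m}"
    have D: "D \<in> U" "D \<subseteq> B" "D \<noteq> {}" "z \<notin> D"
      using B(1) cylinder_sets[OF bX] b bX n by (auto simp: D_def)
    have "p D = p D \<otimes> p B" using D B by (simp add: p_mult Int_absorb2)
    then have "p D \<in> J" using J'(5)[OF _ J(2), of "p D"] D by simp
    then have "J = principal_left_ideal R (p D)"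
      using minimal_left_ideal_principal[OF J(1)] p_nonzero[OF D(1,3)] by blast
    then obtain a where a: "a \<in> carrier R" "p B = a \<otimes> p D"
      using J(2) by (auto simp: principal_left_ideal_def)
    then have "p B \<otimes> p D = p B" using D by (simp add: m_assoc p_mult)
    then have "p D = p B" using D B by (simp add: p_mult Int_absorb1)
    \<comment> \<open>The constant function 1 is tested at z, which lies in B but not in D.\<close>
    then have "act (p D) (\<lambda>_ _. 1) z 0 = act (p B) (\<lambda>_ _. 1) z 0" by simp
    then show False using D z B by (simp add: act_p)
  qed
  have "b \<noteq> \<alpha> \<frown> \<beta>\<^sup>\<omega>" if \<alpha>: "\<alpha> \<in> language X" and \<beta>: "\<beta> \<noteq> []" for \<alpha> \<beta>
  proof
    assume eq: "b = \<alpha> \<frown> \<beta>\<^sup>\<omega>"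
    define c where "c = \<beta>\<^sup>\<omega>"
    have \<alpha>l: "\<alpha> \<in> lists \<AA>" using language_lists[OF \<alpha>] .
    have c: "pull \<alpha> {b} = {c}" "\<beta> \<frown> c = c"
      using \<beta> iter_unroll[of \<beta>] by (auto simp: pull_def eq c_def)
    have cU: "{c} \<in> U" using pull_sets[of "{b}" \<alpha>] B(1) Bb \<alpha>l c(1) by simp
    have cX: "{c} \<subseteq> pull \<alpha> X" using bX by (simp add: pull_def eq c_def)
    define z where "z = sw \<alpha> \<otimes> p {c}"
    have zc: "z \<in> carrier R" using cU \<alpha>l by (simp add: z_def)
    have tz: "tw \<alpha> \<otimes> z = p {c}"
      using cU \<alpha>l cX by (simp add: z_def m_assoc[symmetric] tw_sw p_mult Int_absorb1)
    have bz: "p B \<otimes> z = z"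
      using cU \<alpha>l B(1) p_sw[OF B(1) \<alpha>l] c(1) Bb
      by (simp add: z_def m_assoc[symmetric]) (simp add: m_assoc p_mult)
    have "tw \<alpha> \<otimes> \<zero> = \<zero>" using \<alpha>l by simp
    then have z0: "z \<noteq> \<zero>" using tz p_nonzero[OF cU] by auto
    have K: "minimal_left_ideal (right_translate R J z) R"
      using minimal_right_translate(2)[OF J(1) zc J(2)] bz z0 by simp
    have "tw \<alpha> \<otimes> p B \<in> J" using J'(5)[OF _ J(2)] \<alpha>l by simp
    moreover have "tw \<alpha> \<otimes> p B \<otimes> z = p {c}" using \<alpha>l B(1) zc bz tz by (simp add: m_assoc)
    ultimately have "p {c} \<in> right_translate R J z" unfolding right_translate_def by force
    \<comment> \<open>Adding \<zero> brings \<open>p {c}\<close> into the form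
      \<open>p {c} \<oplus> r\<close> with r in the span of no words.\<close>
    then have "p {c} \<oplus> \<zero> \<in> right_translate R J z" using cU by simp
    from no_minimal_left_ideal_at_periodic[OF cU \<beta> c(2) K _ _ _ word_span.zero this, of "{}"]
    show False by simp
  qed
  with Bb B(1) show ?thesis unfolding irrational_paths_def by blast
qed

lemma minimal_left_ideal_imp:
  assumes "minimal_left_ideal I R"
  shows "\<exists>A\<in>irrational_paths X. left_module_isomorphic R I (principal_left_ideal R (p A))"
proof -
  have IL: "left_ideal I R" "I \<noteq> {\<zero>}" using assms by (simp_all add: minimal_left_ideal_def)
  note I' = left_idealD[OF IL(1)]
  obtain x where x: "x \<in> I" "x \<noteq> \<zero>" using IL(2) I'(2) by blast
  have xc: "x \<in> carrier R" using x I'(1) by blast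
  from xc x(2) show ?thesis
  proof (cases rule: reduction)
    case (idempotent y \<nu> B)
    define z where "z = sw \<nu> \<otimes> p B"
    have zc: "z \<in> carrier R" using idempotent by (simp add: z_def)
    have pB: "p B \<noteq> \<zero>" using p_nonzero idempotent by blast
    have yx: "y \<otimes> x \<in> I" "y \<otimes> x \<otimes> z = p B" using I'(5) x idempotent by (simp_all add: z_def)
    note J = minimal_right_translate[OF assms zc yx(1)]
    have "p B \<in> right_translate R I z" using yx unfolding right_translate_def by force
    then have "B \<in> irrational_paths X" "right_translate R I z = principal_left_ideal R (p B)"
      using minimal_imp_irrational minimal_left_ideal_principal J yx pB idempotent by simp_all
    then show ?thesis using J(1) yx pB by auto
  next
    case (periodic y \<nu> b \<beta> \<Gamma> r)
    define z where "z = sw \<nu> \<otimes> p {b}"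
    have zc: "z \<in> carrier R" using periodic by (simp add: z_def)
    have q: "p {b} \<oplus> r \<noteq> \<zero>" using unipotent_nonzero periodic by blast
    have yx: "y \<otimes> x \<in> I" "y \<otimes> x \<otimes> z = p {b} \<oplus> r"
      using I'(5) x periodic by (simp_all add: z_def)
    have J: "minimal_left_ideal (right_translate R I z) R"
      using minimal_right_translate(2)[OF assms zc yx(1)] yx(2) q by simp
    have "p {b} \<oplus> r \<in> right_translate R I z" using yx unfolding right_translate_def by force
    then show ?thesis
      using no_minimal_left_ideal_at_periodic[OF periodic(3-5) J periodic(6,7,8,9)] by blast
  qed
qed

text \<open>Take a nonzero x in a left ideal below the principal one and reduce it. Since x = x
  \<open>p {w}\<close>, the word \<nu> used must be a prefix of w. The periodic outcome would make w
  eventually periodic, and the idempotent one can be undone to give \<open>p {w}\<close> as a left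
  multiple of x.\<close>

lemma irrational_imp_minimal:
  assumes A: "A \<in> irrational_paths X"
  shows "minimal_left_ideal (principal_left_ideal R (p A)) R"
proof -
  obtain w where w: "A = {w}" "{w} \<in> U"
    "\<And>\<alpha> \<beta>. \<alpha> \<in> language X \<Longrightarrow> \<beta> \<in> language X \<Longrightarrow> \<beta> \<noteq> [] \<Longrightarrow> w \<noteq> \<alpha> \<frown> \<beta>\<^sup>\<omega>"
    using A unfolding irrational_paths_def by blast
  have wX: "w \<in> X" using shift_sets_subset[OF w(2)] by simp
  define e where "e = p {w}"
  have e: "e \<in> carrier R" "e \<otimes> e = e" "e \<noteq> \<zero>"
    using w(2) p_nonzero[OF w(2)] by (simp_all add: e_def p_mult)
  define P where "P = principal_left_ideal R e"
  have PL: "left_ideal P R" unfolding P_def by (rule left_ideal_principal[OF e(1)])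
  have eP: "e \<in> P" unfolding P_def principal_left_ideal_def using e by (auto intro!: exI[of _ \<one>])
  have "L = P" if L: "left_ideal L R" "L \<subseteq> P" "L \<noteq> {\<zero>}" for L
  proof -
    note L' = left_idealD[OF L(1)]
    obtain x where x: "x \<in> L" "x \<noteq> \<zero>" using L L'(2) by blast
    have xc: "x \<in> carrier R" using x L'(1) by blast
    have xe: "x \<otimes> e = x"
      using x L(2) e by (auto simp: P_def principal_left_ideal_def m_assoc)
    \<comment> \<open>Only points z with \<nu>z = w contribute, and there is at most one of
      them.\<close>
    have restrict: "x \<otimes> (sw \<nu> \<otimes> p B) = x \<otimes> (sw \<nu> \<otimes> p (pull \<nu> {w} \<inter> B))"
      if "\<nu> \<in> lists \<AA>" "B \<in> U" for \<nu> B
    proof -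
      have "x \<otimes> (sw \<nu> \<otimes> p B) = (x \<otimes> e) \<otimes> (sw \<nu> \<otimes> p B)" by (simp add: xe)
      also have "\<dots> = x \<otimes> ((e \<otimes> sw \<nu>) \<otimes> p B)" using that xc e by (simp add: m_assoc)
      also have "\<dots> = x \<otimes> (sw \<nu> \<otimes> p (pull \<nu> {w} \<inter> B))"
        using that w(2) by (simp add: e_def p_sw m_assoc p_mult)
      finally show ?thesis .
    qed
    from xc x(2) have "e \<in> L"
    proof (cases rule: reduction)
      case (idempotent y \<nu> B)
      have y: "y \<otimes> x \<otimes> (sw \<nu> \<otimes> p (pull \<nu> {w} \<inter> B)) = p B"
        using idempotent restrict[of \<nu> B] xc w(2) by (simp add: m_assoc)
      have "pull \<nu> {w} \<inter> B \<noteq> {}"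
      proof
        assume "pull \<nu> {w} \<inter> B = {}"
        then have "p B = \<zero>" using y idempotent xc by simp
        then show False using p_nonzero idempotent by blast
      qed
      then obtain z where z: "z \<in> B" "\<nu> \<frown> z = w" by (auto simp: pull_def)
      have pz: "pull \<nu> {w} = {z}" using z(2) by (auto simp: pull_def)
      have zU: "{z} \<in> U" using pull_sets[OF w(2) idempotent(2)] by (simp add: pz)
      have B: "pull \<nu> {w} \<inter> B = {z}" "B \<inter> {z} = {z}" using z(1) pz by auto
      have "y \<otimes> x \<otimes> (sw \<nu> \<otimes> p {z}) = y \<otimes> x \<otimes> (sw \<nu> \<otimes> p {z}) \<otimes> p {z}"
        using idempotent xc zU by (simp add: m_assoc p_mult)
      also have "\<dots> = p B \<otimes> p {z}" using y by (simp add: B)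
      also have "\<dots> = p {z}" using idempotent zU B by (simp add: p_mult)
      finally have yz: "y \<otimes> x \<otimes> (sw \<nu> \<otimes> p {z}) = p {z}" .
      have push: "push X \<nu> {z} = {w}" using z wX by (auto simp: push_def)
      \<comment> \<open>The right factor needed for the reduction can be absorbed: e equals
        \<open>sw \<nu> \<otimes> p {z} \<otimes> tw \<nu>\<close> and x = x e. What remains is a
        left multiple of x, so e lies in L.\<close>
      have "sw \<nu> \<otimes> y \<otimes> x = sw \<nu> \<otimes> y \<otimes> (x \<otimes> (sw \<nu> \<otimes> (p {z} \<otimes> tw \<nu>)))"
        using sw_p_tw[OF zU idempotent(2)] xe by (simp add: push e_def)
      also have "\<dots> = sw \<nu> \<otimes> (y \<otimes> x \<otimes> (sw \<nu> \<otimes> p {z})) \<otimes> tw \<nu>"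
        using idempotent xc zU by (simp add: m_assoc)
      also have "\<dots> = e"
        using sw_p_tw[OF zU idempotent(2)] idempotent zU by (simp add: yz push e_def m_assoc)
      finally have "sw \<nu> \<otimes> y \<otimes> x = e" .
      moreover have "sw \<nu> \<otimes> y \<otimes> x \<in> L" using L'(5)[OF _ x(1)] idempotent by simp
      ultimately show ?thesis by simp
    next
      case (periodic y \<nu> b \<beta> \<Gamma> r)
      have y: "y \<otimes> x \<otimes> (sw \<nu> \<otimes> p (pull \<nu> {w} \<inter> {b})) = p {b} \<oplus> r"
        using periodic restrict[of \<nu> "{b}"] xc w(2) by (simp add: m_assoc)
      have "pull \<nu> {w} \<inter> {b} \<noteq> {}"
      proof
        assume "pull \<nu> {w} \<inter> {b} = {}"
        then have "p {b} \<oplus> r = \<zero>" using y periodic xc by simp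
        then show False using unipotent_nonzero periodic by blast
      qed
      then have wb: "w = \<nu> \<frown> b" by (auto simp: pull_def)
      have "b = \<beta>\<^sup>\<omega>" using fixed_by_conc_imp_iter periodic by blast
      moreover have "\<nu> \<in> language X" using conc_language[of \<nu> b] wX wb by simp
      moreover have "\<beta> \<in> language X"
        using conc_language[of \<beta> b] conc_tail[of \<nu> b] wX wb periodic(5) by simp
      ultimately show ?thesis using w(3) wb periodic(4) by blast
    qed
    then have "P \<subseteq> L" using L'(5) by (auto simp: P_def principal_left_ideal_def)
    with L(2) show ?thesis by blast
  qed
  moreover have "P \<noteq> {\<zero>}" using eP e(3) by blast
  ultimately show ?thesis
    using PL unfolding minimal_left_ideal_def P_def e_def w(1) by blast
qed

theorem minimal_left_ideal_iff:
  assumes "left_ideal I R"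
  shows "minimal_left_ideal I R \<longleftrightarrow>
    (\<exists>A\<in>irrational_paths X. left_module_isomorphic R I (principal_left_ideal R (p A)))"
proof
  assume "\<exists>A\<in>irrational_paths X. left_module_isomorphic R I (principal_left_ideal R (p A))"
  then obtain A where A: "A \<in> irrational_paths X"
    "left_module_isomorphic R I (principal_left_ideal R (p A))" by blast
  from minimal_left_ideal_transfer[OF left_module_isomorphic_sym[OF A(2) assms]
      irrational_imp_minimal[OF A(1)] assms]
  show "minimal_left_ideal I R" .
qed (rule minimal_left_ideal_imp)

end

section \<open>The shift representation of the free algebra\<close>

text \<open>Both summands in the additive case are known to be supported in \<open>W\<close>, so the
  rule applies to properties that make sense only inside the free algebra on a given set of
  generators.\<close>

lemma poly_mapping_induct [consumes 1, case_names zero single add]: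
  assumes f: "Poly_Mapping.keys f \<subseteq> W"
    and zero: "Q 0" and single: "\<And>w c. w \<in> W \<Longrightarrow> Q (Poly_Mapping.single w c)"
    and add: "\<And>f g. Poly_Mapping.keys f \<subseteq> W \<Longrightarrow> Poly_Mapping.keys g \<subseteq> W \<Longrightarrow>
      Q f \<Longrightarrow> Q g \<Longrightarrow> Q (f + g)"
  shows "Q (f :: 'b \<Rightarrow>\<^sub>0 'r::comm_monoid_add)"
proof -
  have "Poly_Mapping.keys (\<Sum>w\<in>T. Poly_Mapping.single w (h w)) \<subseteq> W \<and>
      Q (\<Sum>w\<in>T. Poly_Mapping.single w (h w))" if "finite T" "T \<subseteq> W" for T and h :: "'b \<Rightarrow> 'r"
    using that
  proof (induction T)
    case (insert w T)
    have "Poly_Mapping.keys (Poly_Mapping.single w (h w)) \<subseteq> W" using insert by auto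
    with insert show ?case
      using add[of "Poly_Mapping.single w (h w)"] single[of w]
        Poly_Mapping.keys_add[of "Poly_Mapping.single w (h w)" "\<Sum>w\<in>T. Poly_Mapping.single w (h w)"]
      by simp (meson order_trans Un_least)
  qed (simp add: zero)
  moreover have "f = (\<Sum>w\<in>Poly_Mapping.keys f. Poly_Mapping.single w (Poly_Mapping.lookup f w))"
    by (rule poly_mapping_eqI)
      (simp add: lookup_sum lookup_single when_def in_keys_iff)
  ultimately show ?thesis using f by (metis finite_keys)
qed

text \<open>\<open>S a\<close> moves a function one degree up and \<open>S_star a\<close> one degree
  down. The guards express that prefixing a is only partially defined on \<open>X\<close>.\<close>

fun generator_op :: "'a word set \<Rightarrow> 'a generator \<Rightarrow>
    ('a word \<Rightarrow> int \<Rightarrow> 'r::comm_ring_1) \<Rightarrow> 'a word \<Rightarrow> int \<Rightarrow> 'r" where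
  "generator_op X (P A) m z n = (if z \<in> A then m z n else 0)"
| "generator_op X (S a) m z n = (if z \<in> X \<and> z 0 = a then m (suffix 1 z) (n - 1) else 0)"
| "generator_op X (S_star a) m z n = (if a ## z \<in> X then m (a ## z) (n + 1) else 0)"

definition free_act :: "'a word set \<Rightarrow> ('a generator list \<Rightarrow>\<^sub>0 'r::comm_ring_1) \<Rightarrow>
    ('a word \<Rightarrow> int \<Rightarrow> 'r) \<Rightarrow> 'a word \<Rightarrow> int \<Rightarrow> 'r" where
  "free_act X f m z n =
    (\<Sum>w\<in>Poly_Mapping.keys f. Poly_Mapping.lookup f w * foldr (generator_op X) w m z n)"

lemma foldr_generator_op_add:
  "foldr (generator_op X) w (\<lambda>z n. l z n + m z n) =
    (\<lambda>z n. foldr (generator_op X) w l z n + foldr (generator_op X) w m z n)"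
proof (induction w)
  case (Cons g w)
  then show ?case by (cases g) (auto simp: fun_eq_iff)
qed simp

lemma foldr_generator_op_scale:
  "foldr (generator_op X) w (\<lambda>z n. c * m z n) = (\<lambda>z n. c * foldr (generator_op X) w m z n)"
proof (induction w)
  case (Cons g w)
  then show ?case by (cases g) (auto simp: fun_eq_iff)
qed simp

lemma free_act_superset:
  assumes "finite T" "Poly_Mapping.keys f \<subseteq> T"
  shows "free_act X f m z n = (\<Sum>w\<in>T. Poly_Mapping.lookup f w * foldr (generator_op X) w m z n)"
  unfolding free_act_def using assms by (intro sum.mono_neutral_left) (auto simp: in_keys_iff)

lemma free_act_add: "free_act X (f + g) m z n = free_act X f m z n + free_act X g m z n"
proof -
  let ?T = "Poly_Mapping.keys f \<union> Poly_Mapping.keys g"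
  have "free_act X h m z n = (\<Sum>w\<in>?T. Poly_Mapping.lookup h w * foldr (generator_op X) w m z n)"
    if "Poly_Mapping.keys h \<subseteq> ?T" for h
    using that by (intro free_act_superset) auto
  then show ?thesis
    using Poly_Mapping.keys_add[of f g] by (simp add: lookup_add distrib_right sum.distrib)
qed

lemma free_act_single:
  "free_act X (Poly_Mapping.single w c) m z n = c * foldr (generator_op X) w m z n"
  using free_act_superset[of "{w}" "Poly_Mapping.single w c" X m z n] by simp

lemma free_act_zero [simp]: "free_act X 0 m z n = 0"
  by (simp add: free_act_def)

lemma free_act_uminus: "free_act X (- f) m z n = - free_act X f m z n"
  using free_act_add[of X f "- f" m z n] by (simp add: eq_neg_iff_add_eq_0 add.commute)

lemma free_act_diff: "free_act X (f - g) m z n = free_act X f m z n - free_act X g m z n"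
  using free_act_add[of X f "- g" m z n] by (simp add: free_act_uminus)

lemma free_act_var [simp]: "free_act X (var g) m = generator_op X g m"
  by (simp add: fun_eq_iff var_def free_act_single)

lemma free_act_one [simp]: "free_act X 1 m = m"
  using free_act_single[of X "[]" 1 m] by (simp add: fun_eq_iff zero_list_def flip: single_one)

text \<open>Composing operators is concatenating words. This is multiplicativity for a single word
  on the left, extended linearly by \<open>free_act_mult\<close>.\<close>

lemma foldr_free_act:
  "foldr (generator_op X) u (free_act X g m) z n = free_act X (Poly_Mapping.single u 1 * g) m z n"
proof -
  have "Poly_Mapping.keys g \<subseteq> UNIV" by simp
  then have "\<forall>z n. foldr (generator_op X) u (free_act X g m) z n =
      free_act X (Poly_Mapping.single u 1 * g) m z n"
  proof (induction rule: poly_mapping_induct)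
    case zero
    have "foldr (generator_op X) u (\<lambda>z n. 0 * m z n) z n = 0" for z n
      unfolding foldr_generator_op_scale by simp
    moreover have "free_act X 0 m = (\<lambda>z n. 0 * m z n)" by (simp add: fun_eq_iff)
    ultimately show ?case by simp
  next
    case (single w c)
    have "free_act X (Poly_Mapping.single w c) m = (\<lambda>z n. c * foldr (generator_op X) w m z n)"
      by (simp add: fun_eq_iff free_act_single)
    then show ?case
      by (simp add: foldr_generator_op_scale mult_single free_act_single plus_list_def)
  next
    case (add f g)
    have "free_act X (f + g) m = (\<lambda>z n. free_act X f m z n + free_act X g m z n)"
      by (simp add: fun_eq_iff free_act_add)
    with add show ?case
      by (simp add: foldr_generator_op_add distrib_left free_act_add)
  qed
  then show ?thesis by blast
qed

lemma free_act_mult: "free_act X (f * g) m = free_act X f (free_act X g m)"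
proof -
  have "Poly_Mapping.keys f \<subseteq> UNIV" by simp
  then have "\<forall>z n. free_act X (f * g) m z n = free_act X f (free_act X g m) z n"
  proof (induction rule: poly_mapping_induct)
    case (single w c)
    have *: "Poly_Mapping.single w c = Poly_Mapping.single [] c * Poly_Mapping.single w 1"
      by (simp add: mult_single plus_list_def)
    have "free_act X (Poly_Mapping.single [] c * h) m z n = c * free_act X h m z n" for h z n
    proof -
      have "Poly_Mapping.keys h \<subseteq> UNIV" by simp
      then show ?thesis
        by (induction rule: poly_mapping_induct)
          (simp_all add: mult_single plus_list_def free_act_single free_act_add distrib_left)
    qed
    then have "free_act X (Poly_Mapping.single w c * g) m z n =
        c * free_act X (Poly_Mapping.single w 1 * g) m z n" for z n
      by (subst *) (simp add: mult.assoc)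
    then show ?case by (simp add: free_act_single foldr_free_act)
  qed (simp_all add: free_act_add distrib_right)
  then show ?thesis by (simp add: fun_eq_iff)
qed

section \<open>Functions supported on the shift space and the relation ideal\<close>

text \<open>The generator \<open>P X\<close> acts as restriction to \<open>X\<close>, so the
  relation \<open>p\<^sub>X = 1\<close> holds only on functions that vanish off \<open>X\<close>.
  The quotient acts on these, and \<open>restrict_to\<close> projects onto them.\<close>

definition supported_on :: "'a word set \<Rightarrow> ('a word \<Rightarrow> int \<Rightarrow> 'r::comm_ring_1) \<Rightarrow> bool" where
  "supported_on X m \<longleftrightarrow> (\<forall>z n. z \<notin> X \<longrightarrow> m z n = 0)"

definition restrict_to :: "'a word set \<Rightarrow> ('a word \<Rightarrow> int \<Rightarrow> 'r::comm_ring_1) \<Rightarrow> 'a word \<Rightarrow> int \<Rightarrow> 'r" where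
  "restrict_to X m z n = (if z \<in> X then m z n else 0)"

lemma supported_restrict_to [simp]: "supported_on X (restrict_to X m)"
  by (simp add: supported_on_def restrict_to_def)

lemma restrict_to_supported: "supported_on X m \<Longrightarrow> restrict_to X m = m"
  by (auto simp: supported_on_def restrict_to_def fun_eq_iff)

lemma free_mult_closed:
  "Poly_Mapping.keys f \<subseteq> lists G \<Longrightarrow> Poly_Mapping.keys g \<subseteq> lists G \<Longrightarrow>
    Poly_Mapping.keys (f * g :: 'g list \<Rightarrow>\<^sub>0 'r::comm_ring_1) \<subseteq> lists G"
  using ring.ring_simprules(5)[OF ring_free_algebra, of f G g] by (simp add: free_algebra_def)

lemma free_add_closed:
  "Poly_Mapping.keys f \<subseteq> W \<Longrightarrow> Poly_Mapping.keys g \<subseteq> W \<Longrightarrow>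
    Poly_Mapping.keys (f + g :: 'b \<Rightarrow>\<^sub>0 'r::comm_ring_1) \<subseteq> W"
  using Poly_Mapping.keys_add[of f g] by blast

context full_subshift
begin

lemma generator_op_supported:
  assumes "g \<in> generators \<AA> X" "supported_on X m" shows "supported_on X (generator_op X g m)"
  using assms shift_sets_subset[of _ X] build_tail
  by (auto simp: generators_def supported_on_def)

text \<open>This is what makes the annihilator of the supported functions closed under right
  multiplication as well.\<close>

lemma free_act_supported:
  assumes "Poly_Mapping.keys f \<subseteq> lists (generators \<AA> X)" "supported_on X m"
  shows "supported_on X (free_act X f m)"
  using assms(1)
proof (induction rule: poly_mapping_induct)
  case (single w c)
  have "supported_on X (foldr (generator_op X) w m)"
    using single by (induction w) (auto simp: assms(2) generator_op_supported)
  then show ?case by (simp add: supported_on_def free_act_single)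
qed (simp_all add: supported_on_def free_act_add)

lemma free_act_s_word:
  assumes "supported_on X m"
  shows "free_act X (s_word \<alpha>) m z n =
    (if z \<in> X \<and> (\<exists>w. z = \<alpha> \<frown> w) then m (suffix (length \<alpha>) z) (n - int (length \<alpha>)) else 0)"
proof (induction \<alpha> arbitrary: z n)
  case Nil
  show ?case using assms by (simp add: s_word_def supported_on_def)
next
  case (Cons a \<alpha>)
  have "free_act X (s_word (a # \<alpha>)) m z n =
      (if z \<in> X \<and> z 0 = a then free_act X (s_word \<alpha>) m (suffix 1 z) (n - 1) else 0)"
    by (simp add: s_word_def free_act_mult)
  moreover have "suffix (length \<alpha>) (suffix 1 z) = suffix (length (a # \<alpha>)) z"
    "n - 1 - int (length \<alpha>) = n - int (length (a # \<alpha>))" by simp_all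
  ultimately show ?case
    unfolding starts_with_Cons Cons.IH using suffix_closed[of z 1] by presburger
qed

lemma free_act_s_star_word:
  assumes "supported_on X m"
  shows "free_act X (s_star_word \<alpha>) m z n =
    (if \<alpha> \<frown> z \<in> X then m (\<alpha> \<frown> z) (n + int (length \<alpha>)) else 0)"
  using assms
proof (induction \<alpha> arbitrary: z n m)
  case Nil
  then show ?case by (simp add: s_star_word_def supported_on_def)
next
  case (Cons a \<alpha>)
  have sup: "supported_on X (generator_op X (S_star a) m)"
    using build_tail by (auto simp: supported_on_def)
  have "free_act X (s_star_word (a # \<alpha>)) m z n =
      free_act X (s_star_word \<alpha>) (generator_op X (S_star a) m) z n"
    by (simp add: s_star_word_def free_act_mult)
  then show ?case
    unfolding Cons.IH[OF sup] using build_tail[of a "\<alpha> \<frown> z"] by (auto simp: algebra_simps)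
qed

text \<open>The four factors lead from z = \<beta>w to w, to \<alpha>w, back to w and back to
  \<beta>w. The path exists exactly when z lies in C(\<alpha>, \<beta>), and the degree changes
  cancel.\<close>

lemma free_act_follower:
  assumes m: "supported_on X m"
  shows "free_act X (s_word \<beta> * s_star_word \<alpha> * s_word \<alpha> * s_star_word \<beta>) m =
    free_act X (var (P (follower_cylinder X \<alpha> \<beta>))) m"
proof (intro ext)
  fix z :: "'a word" and n :: int
  have sup: "supported_on X (free_act X (s_star_word \<beta>) m)" 
    if "supported_on X m" for \<beta> and m :: "'a word \<Rightarrow> int \<Rightarrow> 'b" using that
    unfolding supported_on_def free_act_s_star_word[OF that] using conc_tail by auto
  have sup': "supported_on X (free_act X (s_word \<beta>) m)" 
    if "supported_on X m" for \<beta> and m :: "'a word \<Rightarrow> int \<Rightarrow> 'b" using that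
    unfolding supported_on_def free_act_s_word[OF that] by auto
  note sups = m sup[OF m] sup'[OF sup[OF m]] sup[OF sup'[OF sup[OF m]]]
  define w where "w = suffix (length \<beta>) z"
  have cyl: "z \<in> follower_cylinder X \<alpha> \<beta> \<longleftrightarrow> z \<in> X \<and> (\<exists>x. z = \<beta> \<frown> x) \<and> \<alpha> \<frown> w \<in> X"
    unfolding follower_cylinder_def w_def by force
  have "free_act X (s_word \<beta> * s_star_word \<alpha> * s_word \<alpha> * s_star_word \<beta>) m z n =
    free_act X (s_word \<beta>) (free_act X (s_star_word \<alpha>) (free_act X (s_word \<alpha>)
      (free_act X (s_star_word \<beta>) m))) z n"
    by (simp add: free_act_mult)
  also have "\<dots> = (if z \<in> X \<and> (\<exists>x. z = \<beta> \<frown> x) \<and> \<alpha> \<frown> w \<in> X \<and> \<beta> \<frown> w \<in> X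
      then m (\<beta> \<frown> w) n else 0)"
    unfolding free_act_s_word[OF sups(4)] free_act_s_star_word[OF sups(3)]
      free_act_s_word[OF sups(2)] free_act_s_star_word[OF sups(1)] w_def by auto
  also have "\<dots> = (if z \<in> follower_cylinder X \<alpha> \<beta> then m z n else 0)"
    unfolding cyl by (auto simp: w_def)
  finally show "free_act X (s_word \<beta> * s_star_word \<alpha> * s_word \<alpha> * s_star_word \<beta>) m z n =
    free_act X (var (P (follower_cylinder X \<alpha> \<beta>))) m z n" by simp
qed

text \<open>The elements annihilating every supported function form a two-sided ideal, and it
  contains the relators.\<close>

lemma relation_ideal_acts_trivially:
  assumes f: "f \<in> (relation_ideal \<AA> X :: ('a generator list \<Rightarrow>\<^sub>0 'r::comm_ring_1) set)"
    and m: "supported_on X m"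
  shows "free_act X f m z n = 0"
proof -
  let ?F = "free_algebra (generators \<AA> X) :: ('a generator list \<Rightarrow>\<^sub>0 'r) ring"
  interpret F: ring ?F by (rule ring_free_algebra)
  define N where "N = {f \<in> carrier ?F. \<forall>m. supported_on X m \<longrightarrow> free_act X f m = (\<lambda>_ _. 0)}"
  have zero: "free_act X g (\<lambda>_ _. 0 :: 'r) = (\<lambda>_ _. 0)" for g
  proof -
    have "free_act X (0 :: 'a generator list \<Rightarrow>\<^sub>0 'r) (\<lambda>_ _. 0) = (\<lambda>_ _. 0)"
      by (simp add: fun_eq_iff)
    with free_act_mult[of X g 0 "\<lambda>_ _. 0"] show ?thesis by simp
  qed
  have "ideal N ?F"
  proof (rule idealI[OF F.ring_axioms])
    have inv: "inv\<^bsub>add_monoid ?F\<^esub> f = - f" if "f \<in> carrier ?F" for f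
      using F.minus_equality[of "- f" f] that by (simp add: a_inv_def free_algebra_def)
    show "subgroup N (add_monoid ?F)"
    proof (rule group.subgroupI[OF F.add.group_axioms])
      show "inv\<^bsub>add_monoid ?F\<^esub> f \<in> N" if "f \<in> N" for f
        using that inv[of f] by (simp add: N_def fun_eq_iff free_act_uminus free_algebra_def)
      show "f \<otimes>\<^bsub>add_monoid ?F\<^esub> g \<in> N" if "f \<in> N" "g \<in> N" for f g
        using that free_add_closed[of f _ g]
        by (simp add: N_def fun_eq_iff free_act_add free_algebra_def)
      have "0 \<in> N" by (simp add: N_def fun_eq_iff free_algebra_def)
      then show "N \<noteq> {}" by blast
    qed (auto simp: N_def)
    fix f g assume f: "f \<in> N" and g: "g \<in> carrier ?F"
    then show "g \<otimes>\<^bsub>?F\<^esub> f \<in> N"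
      using free_mult_closed[of g _ f] by (simp add: N_def free_algebra_def free_act_mult zero)
    show "f \<otimes>\<^bsub>?F\<^esub> g \<in> N"
      using f g free_mult_closed[of f _ g] free_act_supported[of g]
      by (simp add: N_def free_algebra_def free_act_mult)
  qed
  moreover have "relators \<AA> X \<subseteq> N"
  proof
    fix h :: "'a generator list \<Rightarrow>\<^sub>0 'r" assume h: "h \<in> relators \<AA> X"
    have "free_act X h m = (\<lambda>_ _. 0)" if m: "supported_on X m" for m
    proof (intro ext)
      fix z n
      from h show "free_act X h m z n = 0"
        unfolding relators_def
        using m build_tail[of _ z] suffix_closed[of z 1]
        by (auto simp: free_act_diff free_act_add free_act_mult[of X _ "var _"] free_act_follower
            supported_on_def)
    qed
    then show "h \<in> N" using h relators_closed[OF subshift] by (auto simp: N_def)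
  qed
  ultimately have "relation_ideal \<AA> X \<subseteq> N"
    unfolding relation_ideal_def by (rule F.genideal_minimal)
  with f m show ?thesis by (auto simp: N_def fun_eq_iff)
qed

end

section \<open>The subshift algebra\<close>

definition coset :: "'a set \<Rightarrow> 'a word set \<Rightarrow> ('a generator list \<Rightarrow>\<^sub>0 'r::comm_ring_1) \<Rightarrow>
    ('a generator list \<Rightarrow>\<^sub>0 'r) set" where
  "coset \<AA> X f = relation_ideal \<AA> X +>\<^bsub>free_algebra (generators \<AA> X)\<^esub> f"

definition free_words :: "'a set \<Rightarrow> 'a word set \<Rightarrow> ('a generator list \<Rightarrow>\<^sub>0 'r::comm_ring_1) set" where
  "free_words \<AA> X = {f. Poly_Mapping.keys f \<subseteq> lists (generators \<AA> X)}"

text \<open>A representative is chosen arbitrarily; restricting the argument to \<open>X\<close>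
  first makes the result independent of the choice.\<close>

definition coset_act :: "'a set \<Rightarrow> 'a word set \<Rightarrow> ('a generator list \<Rightarrow>\<^sub>0 'r::comm_ring_1) set \<Rightarrow>
    ('a word \<Rightarrow> int \<Rightarrow> 'r) \<Rightarrow> 'a word \<Rightarrow> int \<Rightarrow> 'r" where
  "coset_act \<AA> X x m =
    free_act X (SOME f. f \<in> free_words \<AA> X \<and> coset \<AA> X f = x) (restrict_to X m)"

context
  fixes \<AA> :: "'a set" and X :: "'a word set"
  assumes subshift: "subshift \<AA> X"
begin

lemma ideal_relation_ideal:
  "ideal (relation_ideal \<AA> X :: ('a generator list \<Rightarrow>\<^sub>0 'r::comm_ring_1) set)
    (free_algebra (generators \<AA> X))"
  unfolding relation_ideal_def
  by (intro ring.genideal_ideal ring_free_algebra relators_closed subshift)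

lemma carrier_free_words: "carrier (free_algebra (generators \<AA> X)) = free_words \<AA> X"
  by (simp add: free_algebra_def free_words_def)

lemma coset_hom: "coset \<AA> X \<in> ring_hom (free_algebra (generators \<AA> X)) (subshift_algebra \<AA> X)"
  using ideal.rcos_ring_hom[OF ideal_relation_ideal]
  by (simp add: subshift_algebra_def coset_def[abs_def])

lemma coset_closed: "f \<in> free_words \<AA> X \<Longrightarrow> coset \<AA> X f \<in> carrier (subshift_algebra \<AA> X)"
  by (rule ring_hom_closed[OF coset_hom]) (simp add: carrier_free_words)

lemma coset_add: "f \<in> free_words \<AA> X \<Longrightarrow> g \<in> free_words \<AA> X \<Longrightarrow>
    coset \<AA> X (f + g) = coset \<AA> X f \<oplus>\<^bsub>subshift_algebra \<AA> X\<^esub> coset \<AA> X g"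
  using ring_hom_add[OF coset_hom, of f g] unfolding carrier_free_words by (simp add: free_algebra_def)

lemma coset_mult: "f \<in> free_words \<AA> X \<Longrightarrow> g \<in> free_words \<AA> X \<Longrightarrow>
    coset \<AA> X (f * g) = coset \<AA> X f \<otimes>\<^bsub>subshift_algebra \<AA> X\<^esub> coset \<AA> X g"
  using Ring.ring_hom_mult[OF coset_hom, of f g] unfolding carrier_free_words
  by (simp add: free_algebra_def)

lemma coset_one: "coset \<AA> X 1 = \<one>\<^bsub>subshift_algebra \<AA> X\<^esub>"
  using Ring.ring_hom_one[OF coset_hom] by (simp add: free_algebra_def)

lemma coset_zero: "coset \<AA> X 0 = \<zero>\<^bsub>subshift_algebra \<AA> X\<^esub>"
  using Ring.ring_hom_zero[OF coset_hom ring_free_algebra ring_subshift_algebra[OF subshift]]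
  by (simp add: free_algebra_def)

lemma coset_surj:
  assumes "x \<in> carrier (subshift_algebra \<AA> X)"
  obtains f where "f \<in> free_words \<AA> X" "coset \<AA> X f = x"
  using assms unfolding subshift_algebra_def FactRing_def A_RCOSETS_def' coset_def
  by (auto simp: free_algebra_def free_words_def)

lemma coset_eq_iff:
  assumes "f \<in> free_words \<AA> X" "g \<in> free_words \<AA> X"
  shows "coset \<AA> X f = coset \<AA> X g \<longleftrightarrow> f - g \<in> relation_ideal \<AA> X"
proof -
  let ?F = "free_algebra (generators \<AA> X) :: ('a generator list \<Rightarrow>\<^sub>0 'b) ring"
  interpret F: ring ?F by (rule ring_free_algebra)
  have "\<ominus>\<^bsub>?F\<^esub> g = - g"
    using F.minus_equality[of "- g" g] assms by (simp add: free_algebra_def free_words_def)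
  then have "f \<ominus>\<^bsub>?F\<^esub> g = f - g" by (simp add: a_minus_def free_algebra_def)
  with F.quotient_eq_iff_same_a_r_cos[OF ideal_relation_ideal, of f g] assms
  show ?thesis unfolding carrier_free_words by (simp add: coset_def)
qed

lemma coset_relator:
  assumes "f - g \<in> relators \<AA> X" "f \<in> free_words \<AA> X" "g \<in> free_words \<AA> X"
  shows "coset \<AA> X f = coset \<AA> X g"
  using ring.genideal_self[OF ring_free_algebra relators_closed[OF subshift]] assms(1)
  unfolding coset_eq_iff[OF assms(2,3)] relation_ideal_def by blast

lemma free_words_closed [simp]:
  "A \<in> shift_sets X \<Longrightarrow> var (P A) \<in> free_words \<AA> X"
  "a \<in> \<AA> \<Longrightarrow> var (S a) \<in> free_words \<AA> X"
  "a \<in> \<AA> \<Longrightarrow> var (S_star a) \<in> free_words \<AA> X"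
  "1 \<in> free_words \<AA> X" "0 \<in> free_words \<AA> X" "Poly_Mapping.single [] c \<in> free_words \<AA> X"
  "f \<in> free_words \<AA> X \<Longrightarrow> g \<in> free_words \<AA> X \<Longrightarrow> f + g \<in> free_words \<AA> X"
  "f \<in> free_words \<AA> X \<Longrightarrow> g \<in> free_words \<AA> X \<Longrightarrow> f - g \<in> free_words \<AA> X"
  "f \<in> free_words \<AA> X \<Longrightarrow> g \<in> free_words \<AA> X \<Longrightarrow> f * g \<in> free_words \<AA> X"
  using free_add_closed[of f "lists (generators \<AA> X)" g]
    free_add_closed[of f "lists (generators \<AA> X)" "- g"] free_mult_closed[of f _ g]
  by (auto simp: free_words_def var_def generators_def zero_list_def dest: subsetD[OF free_mult_closed])

lemma s_word_Cons: "s_word (a # \<alpha>) = var (S a) * s_word \<alpha>"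
  by (simp add: s_word_def)

lemma s_star_word_Cons: "s_star_word (a # \<alpha>) = s_star_word \<alpha> * var (S_star a)"
  by (simp add: s_star_word_def)

lemma s_word_closed [simp]:
  "\<alpha> \<in> lists \<AA> \<Longrightarrow> s_word \<alpha> \<in> free_words \<AA> X" "\<alpha> \<in> lists \<AA> \<Longrightarrow> s_star_word \<alpha> \<in> free_words \<AA> X"
proof -
  show "s_word \<alpha> \<in> free_words \<AA> X" if "\<alpha> \<in> lists \<AA>"
    using that
  proof (induction \<alpha> rule: list.induct)
    case Nil
    show ?case using free_words_closed(4) by (simp add: s_word_def)
  next
    case (Cons a \<alpha>)
    then show ?case unfolding s_word_Cons by (intro free_words_closed(9,2)) simp_all
  qed
  show "s_star_word \<alpha> \<in> free_words \<AA> X" if "\<alpha> \<in> lists \<AA>"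
    using that
  proof (induction \<alpha> rule: list.induct)
    case Nil
    show ?case using free_words_closed(4) by (simp add: s_star_word_def)
  next
    case (Cons a \<alpha>)
    then show ?case unfolding s_star_word_Cons by (intro free_words_closed(9,3)) simp_all
  qed
qed

lemma coset_s_word:
  "\<alpha> \<in> lists \<AA> \<Longrightarrow> coset \<AA> X (s_word \<alpha>) = lprod (subshift_algebra \<AA> X) (\<lambda>a. coset \<AA> X (var (S a))) \<alpha>"
proof (induction \<alpha> rule: list.induct)
  case Nil
  show ?case by (simp add: s_word_def coset_one)
next
  case (Cons a \<alpha>)
  then show ?case by (simp add: s_word_Cons coset_mult)
qed

lemma coset_s_star_word:
  "\<alpha> \<in> lists \<AA> \<Longrightarrow>
    coset \<AA> X (s_star_word \<alpha>) = rprod (subshift_algebra \<AA> X) (\<lambda>a. coset \<AA> X (var (S_star a))) \<alpha>"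
proof (induction \<alpha> rule: list.induct)
  case Nil
  show ?case by (simp add: s_star_word_def coset_one)
next
  case (Cons a \<alpha>)
  then show ?case by (simp add: s_star_word_Cons coset_mult)
qed

text \<open>Words are built from their right end by left multiplication with one generator at a
  time; scalars and sums then reach every noncommutative polynomial, and each coset has such a
  representative.\<close>

lemma coset_generated:
  assumes x: "x \<in> carrier (subshift_algebra \<AA> X :: ('a generator list \<Rightarrow>\<^sub>0 'r::comm_ring_1) set ring)"
    and one: "Q \<one>\<^bsub>subshift_algebra \<AA> X\<^esub>"
    and add: "\<And>x y. x \<in> carrier (subshift_algebra \<AA> X) \<Longrightarrow> y \<in> carrier (subshift_algebra \<AA> X) \<Longrightarrow>
      Q x \<Longrightarrow> Q y \<Longrightarrow> Q (x \<oplus>\<^bsub>subshift_algebra \<AA> X\<^esub> y)"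
    and scale: "\<And>c x. x \<in> carrier (subshift_algebra \<AA> X) \<Longrightarrow> Q x \<Longrightarrow>
      Q (coset \<AA> X (Poly_Mapping.single [] c) \<otimes>\<^bsub>subshift_algebra \<AA> X\<^esub> x)"
    and gen: "\<And>g x. g \<in> generators \<AA> X \<Longrightarrow> x \<in> carrier (subshift_algebra \<AA> X) \<Longrightarrow> Q x \<Longrightarrow>
      Q (coset \<AA> X (var g) \<otimes>\<^bsub>subshift_algebra \<AA> X\<^esub> x)"
  shows "Q x"
proof -
  obtain f where f: "f \<in> free_words \<AA> X" "coset \<AA> X f = x" using coset_surj[OF x] .
  have scale': "Q (coset \<AA> X (Poly_Mapping.single [] c * h))"
    if "h \<in> free_words \<AA> X" "Q (coset \<AA> X h)" for c h
    using coset_mult[OF free_words_closed(6) that(1), of c] scale[OF coset_closed[OF that(1)] that(2)]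
    by simp
  have word: "Q (coset \<AA> X (Poly_Mapping.single w 1)) \<and>
      Poly_Mapping.single w (1 :: 'r) \<in> free_words \<AA> X" if "w \<in> lists (generators \<AA> X)" for w
    using that
  proof (induction w rule: list.induct)
    case Nil
    have e: "Poly_Mapping.single [] (1 :: 'r) = 1" by (simp flip: single_one zero_list_def)
    show ?case unfolding e using one by (simp add: coset_one)
  next
    case (Cons g w)
    have g: "g \<in> generators \<AA> X" "w \<in> lists (generators \<AA> X)" using Cons.prems by simp_all
    have e: "Poly_Mapping.single (g # w) (1 :: 'r) = var g * Poly_Mapping.single w 1"
      by (simp add: var_def mult_single plus_list_def)
    have vg: "(var g :: _ \<Rightarrow>\<^sub>0 'r) \<in> free_words \<AA> X" using g by (simp add: var_def free_words_def)
    have IH: "Q (coset \<AA> X (Poly_Mapping.single w 1))" "Poly_Mapping.single w (1 :: 'r) \<in> free_words \<AA> X"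
      using Cons.IH g(2) by blast+
    show ?case
      unfolding e coset_mult[OF vg IH(2)]
      using gen[OF g(1) coset_closed[OF IH(2)] IH(1)] free_words_closed(9)[OF vg IH(2)] by blast
  qed
  from f(1) have "Poly_Mapping.keys f \<subseteq> lists (generators \<AA> X)" by (simp add: free_words_def)
  then have "Q (coset \<AA> X f)"
  proof (induction rule: poly_mapping_induct)
    case zero
    show ?case using scale'[of 1 0] one by (simp add: coset_one zero_list_def)
  next
    case (single w c)
    have e: "Poly_Mapping.single w c = Poly_Mapping.single [] c * Poly_Mapping.single w 1"
      by (simp add: mult_single plus_list_def)
    show ?case unfolding e using word[OF single] scale' by blast
  next
    case (add f g)
    then show ?case
      using coset_add[of f g] assms(3)[OF coset_closed coset_closed, of f g] by (simp add: free_words_def)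
  qed
  with f(2) show ?thesis by simp
qed

lemma coset_scalar_central:
  assumes "f \<in> free_words \<AA> X"
  shows "coset \<AA> X (Poly_Mapping.single [] c * f) = coset \<AA> X (f * Poly_Mapping.single [] c)"
proof -
  have "Poly_Mapping.keys f \<subseteq> UNIV" by simp
  then have "Poly_Mapping.single [] c * f = f * Poly_Mapping.single [] c"
    by (induction rule: poly_mapping_induct)
      (simp_all add: mult_single plus_list_def distrib_left distrib_right mult.commute)
  then show ?thesis by simp
qed

lemma coset_act:
  assumes "full_subshift \<AA> X" and f: "f \<in> free_words \<AA> X"
  shows "coset_act \<AA> X (coset \<AA> X f) m = free_act X f (restrict_to X m)"
proof -
  define g where "g = (SOME g. g \<in> free_words \<AA> X \<and> coset \<AA> X g = coset \<AA> X f)"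
  have g: "g \<in> free_words \<AA> X \<and> coset \<AA> X g = coset \<AA> X f"
    unfolding g_def by (rule someI[of _ f]) (use f in simp)
  then have "g - f \<in> relation_ideal \<AA> X" using coset_eq_iff[of g f] f by simp
  then have "free_act X (g - f) (restrict_to X m) z n = 0" for z n
    by (rule full_subshift.relation_ideal_acts_trivially[OF assms(1)]) simp
  then show ?thesis
    unfolding coset_act_def g_def[symmetric] by (simp add: fun_eq_iff free_act_diff)
qed

end

section \<open>The quotient satisfies the relations and carries the action\<close>

lemma subshift_ring_subshift_algebra:
  assumes full: "full_subshift \<AA> X"
  shows "subshift_ring (subshift_algebra \<AA> X) \<AA> X
    (p_elem \<AA> X :: _ \<Rightarrow> ('a generator list \<Rightarrow>\<^sub>0 'r::field) set)
    (\<lambda>a. coset \<AA> X (var (S a))) (\<lambda>a. coset \<AA> X (var (S_star a)))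
    (\<lambda>c. coset \<AA> X (Poly_Mapping.single [] c)) (coset_act \<AA> X)"
proof -
  interpret full_subshift \<AA> X by (rule full)
  let ?A = "subshift_algebra \<AA> X :: ('a generator list \<Rightarrow>\<^sub>0 'r) set ring"
  let ?c = "coset \<AA> X :: ('a generator list \<Rightarrow>\<^sub>0 'r) \<Rightarrow> _"
  interpret A: ring ?A by (rule ring_subshift_algebra[OF subshift])
  note hom = coset_closed[OF subshift] coset_add[OF subshift] coset_mult[OF subshift]
    coset_one[OF subshift] coset_zero[OF subshift]
  note closed = free_words_closed[OF subshift] s_word_closed[OF subshift]
  have p: "p_elem \<AA> X A = ?c (var (P A))" for A
    by (simp add: p_elem_def coset_def)
  have relator: "?c f = ?c g" if "f - g \<in> relators \<AA> X" "f \<in> free_words \<AA> X" "g \<in> free_words \<AA> X"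
    for f g using coset_relator[OF subshift that] .
  show ?thesis
  proof (rule subshift_ring.intro[OF A.ring_axioms full], unfold_locales)
    fix A B :: "'a word set" and a :: 'a and c d :: 'r
    show "p_elem \<AA> X A \<in> carrier ?A" if "A \<in> U" using that by (simp add: p hom closed)
    show "?c (var (S a)) \<in> carrier ?A" "?c (var (S_star a)) \<in> carrier ?A" if "a \<in> \<AA>"
      using that by (simp_all add: hom closed)
    show "?c (Poly_Mapping.single [] c) \<in> carrier ?A" by (simp add: hom closed)
    have "?c (var (P X)) = ?c 1"
      by (rule relator) (simp_all add: closed relators_def shift_sets.space)
    then show "p_elem \<AA> X X = \<one>\<^bsub>?A\<^esub>" by (simp add: p hom)
    have "?c (var (P {})) = ?c 0"
      by (rule relator) (simp_all add: closed relators_def)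
    then show "p_elem \<AA> X {} = \<zero>\<^bsub>?A\<^esub>" by (simp add: p hom)
    show "p_elem \<AA> X A \<otimes>\<^bsub>?A\<^esub> p_elem \<AA> X B = (p_elem \<AA> X (A \<inter> B) :: ('a generator list \<Rightarrow>\<^sub>0 'r) set)"
      if "A \<in> U" "B \<in> U"
    proof -
      have "?c (var (P (A \<inter> B))) = ?c (var (P A) * var (P B))"
      proof (rule relator)
        show "var (P (A \<inter> B)) - var (P A) * var (P B) \<in> relators \<AA> X"
          unfolding relators_def using that by blast
      qed (use that in \<open>simp_all add: closed shift_sets.inter\<close>)
      with that show ?thesis by (simp add: p hom closed)
    qed
    show "p_elem \<AA> X (A \<union> B) =
        p_elem \<AA> X A \<oplus>\<^bsub>?A\<^esub> p_elem \<AA> X B \<ominus>\<^bsub>?A\<^esub> (p_elem \<AA> X (A \<inter> B) :: ('a generator list \<Rightarrow>\<^sub>0 'r) set)"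
      if "A \<in> U" "B \<in> U"
    proof -
      have "?c (var (P (A \<union> B))) = ?c (var (P A) + var (P B) - var (P (A \<inter> B)))"
      proof (rule relator)
        show "var (P (A \<union> B)) - (var (P A) + var (P B) - var (P (A \<inter> B))) \<in> relators \<AA> X"
          unfolding relators_def using that by blast
      qed (use that in \<open>simp_all add: closed shift_sets.inter shift_sets.union\<close>)
      \<comment> \<open>The passage to cosets is stated for sums, so the difference is treated by
        adding \<open>var (P (A \<inter> B))\<close> back and cancelling in the quotient.\<close>
      moreover have "?c (var (P A) + var (P B) - var (P (A \<inter> B)) + var (P (A \<inter> B))) =
          ?c (var (P A) + var (P B) - var (P (A \<inter> B))) \<oplus>\<^bsub>?A\<^esub> ?c (var (P (A \<inter> B)))"
        using that by (intro hom(2)) (simp_all add: closed shift_sets.inter)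
      ultimately have "?c (var (P A)) \<oplus>\<^bsub>?A\<^esub> ?c (var (P B)) =
          ?c (var (P (A \<union> B))) \<oplus>\<^bsub>?A\<^esub> ?c (var (P (A \<inter> B)))"
        using that by (simp add: hom(2) closed)
      with that show ?thesis
        by (simp add: p hom closed shift_sets.inter shift_sets.union A.minus_eq A.a_assoc A.r_neg)
    qed
    show "?c (var (S a)) \<otimes>\<^bsub>?A\<^esub> ?c (var (S_star a)) \<otimes>\<^bsub>?A\<^esub> ?c (var (S a)) = ?c (var (S a))"
      "?c (var (S_star a)) \<otimes>\<^bsub>?A\<^esub> ?c (var (S a)) \<otimes>\<^bsub>?A\<^esub> ?c (var (S_star a)) = ?c (var (S_star a))"
      if "a \<in> \<AA>"
    proof -
      have mem: "var (S a) * var (S_star a) * var (S a) - var (S a) \<in> relators \<AA> X"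
        "var (S_star a) * var (S a) * var (S_star a) - var (S_star a) \<in> relators \<AA> X"
        unfolding relators_def using that by blast+
      have "?c (var (S a) * var (S_star a) * var (S a)) = ?c (var (S a))"
        "?c (var (S_star a) * var (S a) * var (S_star a)) = ?c (var (S_star a))"
        by (rule relator[OF mem(1)] relator[OF mem(2)]; use that in \<open>simp add: closed\<close>)+
      with that show "?c (var (S a)) \<otimes>\<^bsub>?A\<^esub> ?c (var (S_star a)) \<otimes>\<^bsub>?A\<^esub> ?c (var (S a)) = ?c (var (S a))"
        "?c (var (S_star a)) \<otimes>\<^bsub>?A\<^esub> ?c (var (S a)) \<otimes>\<^bsub>?A\<^esub> ?c (var (S_star a)) = ?c (var (S_star a))"
        by (simp_all add: hom closed)
    qed
    show "lprod ?A (\<lambda>a. ?c (var (S a))) \<beta> \<otimes>\<^bsub>?A\<^esub> rprod ?A (\<lambda>a. ?c (var (S_star a))) \<alpha> \<otimes>\<^bsub>?A\<^esub>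
        lprod ?A (\<lambda>a. ?c (var (S a))) \<alpha> \<otimes>\<^bsub>?A\<^esub> rprod ?A (\<lambda>a. ?c (var (S_star a))) \<beta> =
        p_elem \<AA> X (C \<alpha> \<beta>)" if "\<alpha> \<in> language X" "\<beta> \<in> language X" for \<alpha> \<beta>
    proof -
      have l: "\<alpha> \<in> lists \<AA>" "\<beta> \<in> lists \<AA>" using that language_lists by blast+
      have "?c (s_word \<beta> * s_star_word \<alpha> * s_word \<alpha> * s_star_word \<beta>) = ?c (var (P (C \<alpha> \<beta>)))"
      proof (rule relator)
        show "s_word \<beta> * s_star_word \<alpha> * s_word \<alpha> * s_star_word \<beta> - var (P (C \<alpha> \<beta>)) \<in> relators \<AA> X"
          unfolding relators_def using that by blast
      qed (use that l in \<open>simp_all add: closed shift_sets.base\<close>)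
      with l show ?thesis
        by (simp add: p hom closed coset_s_word[OF subshift, symmetric] coset_s_star_word[OF subshift, symmetric])
    qed
    show "?c (Poly_Mapping.single [] 0) = \<zero>\<^bsub>?A\<^esub>" by (simp add: hom)
    show "?c (Poly_Mapping.single [] 1) = \<one>\<^bsub>?A\<^esub>"
    proof -
      have "Poly_Mapping.single ([] :: 'a generator list) (1 :: 'r) = 1" by (simp flip: single_one zero_list_def)
      then show ?thesis by (simp only: hom)
    qed
    show "?c (Poly_Mapping.single [] (c * d)) =
        ?c (Poly_Mapping.single [] c) \<otimes>\<^bsub>?A\<^esub> ?c (Poly_Mapping.single [] d)"
      using hom(3)[OF closed(6) closed(6), of c d] by (simp add: mult_single plus_list_def)
    show "?c (Poly_Mapping.single [] (c + d)) =
        ?c (Poly_Mapping.single [] c) \<oplus>\<^bsub>?A\<^esub> ?c (Poly_Mapping.single [] d)"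
      using hom(2)[OF closed(6) closed(6), of c d] by (simp add: single_add)
    fix m :: "'a word \<Rightarrow> int \<Rightarrow> 'r" and z :: "'a word" and n :: int
    note act = coset_act[OF subshift full]
    show "coset_act \<AA> X (?c (Poly_Mapping.single [] c)) m z n = (if z \<in> X then c * m z n else 0)"
      by (simp add: act closed free_act_single restrict_to_def)
    show "coset_act \<AA> X (p_elem \<AA> X A) m z n = (if z \<in> A then m z n else 0)" if "A \<in> U"
      using shift_sets_subset[OF that] that by (auto simp: p act closed restrict_to_def)
    show "coset_act \<AA> X (?c (var (S a))) m z n =
        (if z \<in> X \<and> z 0 = a then m (suffix 1 z) (n - 1) else 0)" if "a \<in> \<AA>"
      using that suffix_closed[of z 1] by (simp add: act closed restrict_to_def)
    show "coset_act \<AA> X (?c (var (S_star a))) m z n =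
        (if a ## z \<in> X then m (a ## z) (n + 1) else 0)" if "a \<in> \<AA>"
      using that by (simp add: act closed restrict_to_def)
    fix x y assume x: "x \<in> carrier ?A"
    obtain f where f: "f \<in> free_words \<AA> X" "?c f = x" using coset_surj[OF subshift x] .
    show "?c (Poly_Mapping.single [] c) \<otimes>\<^bsub>?A\<^esub> x = x \<otimes>\<^bsub>?A\<^esub> ?c (Poly_Mapping.single [] c)"
      using coset_scalar_central[OF subshift f(1), of c] f by (simp add: hom closed)
    show "Q x" if "Q \<one>\<^bsub>?A\<^esub>"
      "\<And>x y. x \<in> carrier ?A \<Longrightarrow> y \<in> carrier ?A \<Longrightarrow> Q x \<Longrightarrow> Q y \<Longrightarrow> Q (x \<oplus>\<^bsub>?A\<^esub> y)"
      "\<And>c x. x \<in> carrier ?A \<Longrightarrow> Q x \<Longrightarrow> Q (?c (Poly_Mapping.single [] c) \<otimes>\<^bsub>?A\<^esub> x)"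
      "\<And>A x. A \<in> U \<Longrightarrow> x \<in> carrier ?A \<Longrightarrow> Q x \<Longrightarrow> Q (p_elem \<AA> X A \<otimes>\<^bsub>?A\<^esub> x)"
      "\<And>a x. a \<in> \<AA> \<Longrightarrow> x \<in> carrier ?A \<Longrightarrow> Q x \<Longrightarrow> Q (?c (var (S a)) \<otimes>\<^bsub>?A\<^esub> x)"
      "\<And>a x. a \<in> \<AA> \<Longrightarrow> x \<in> carrier ?A \<Longrightarrow> Q x \<Longrightarrow> Q (?c (var (S_star a)) \<otimes>\<^bsub>?A\<^esub> x)" for Q
      by (rule coset_generated[OF subshift x that(1-3)])
        (use that(4-6) in \<open>auto simp: generators_def p\<close>)
    assume y: "y \<in> carrier ?A"
    obtain g where g: "g \<in> free_words \<AA> X" "?c g = y" using coset_surj[OF subshift y] .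
    show "coset_act \<AA> X (x \<oplus>\<^bsub>?A\<^esub> y) m z n = coset_act \<AA> X x m z n + coset_act \<AA> X y m z n"
      using act[of "f + g" m] act[of f m] act[of g m] f g by (simp add: hom closed free_act_add)
    \<comment> \<open>The action of x restricts its argument once more; this changes nothing because
      g preserves the support.\<close>
    have "supported_on X (free_act X g (restrict_to X m))"
      using g(1) by (intro free_act_supported) (simp_all add: free_words_def)
    then show "coset_act \<AA> X (x \<otimes>\<^bsub>?A\<^esub> y) m = coset_act \<AA> X x (coset_act \<AA> X y m)"
      using act[of "f * g" m] act[of f "coset_act \<AA> X y m"] act[of g m] f g
      by (simp add: hom closed free_act_mult restrict_to_supported)
  qed
qed

theorem corollary3p11:
  fixes \<AA> :: "'a set" and X :: "'a word set"
    and I :: "('a generator list \<Rightarrow>\<^sub>0 'r::field) set set"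
  assumes "\<AA> \<noteq> {}"
    and "subshift \<AA> X"
    and "X \<noteq> {} \<Longrightarrow> \<forall>a\<in>\<AA>. [a] \<in> language X"
    and "left_ideal I (subshift_algebra \<AA> X)"
  shows "minimal_left_ideal I (subshift_algebra \<AA> X) \<longleftrightarrow>
    (\<exists>A\<in>irrational_paths X.
       left_module_isomorphic (subshift_algebra \<AA> X) I
         (principal_left_ideal (subshift_algebra \<AA> X) (p_elem \<AA> X A)))"
proof (cases "X = {}")
  case True
  let ?A = "subshift_algebra \<AA> X :: ('a generator list \<Rightarrow>\<^sub>0 'r) set ring"
  interpret A: ring ?A by (rule ring_subshift_algebra[OF assms(2)])
  have "irrational_paths X = {}"
    using shift_sets_subset[of _ X] True by (force simp: irrational_paths_def)
  \<comment> \<open>For empty \<open>X\<close> the generators \<open>P X\<close> and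
    \<open>P {}\<close> coincide, and the relations send them to 1 and 0, so the algebra is the zero
    ring and I is not minimal.\<close>
  moreover have "I = {\<zero>\<^bsub>?A\<^esub>}"
  proof -
    have "(coset \<AA> X (var (P X)) :: ('a generator list \<Rightarrow>\<^sub>0 'r) set) = coset \<AA> X 1"
      "(coset \<AA> X (var (P {})) :: ('a generator list \<Rightarrow>\<^sub>0 'r) set) = coset \<AA> X 0"
      by (rule coset_relator[OF assms(2)];
          simp add: relators_def shift_sets.space free_words_closed[OF assms(2)])+
    then have "(coset \<AA> X 1 :: ('a generator list \<Rightarrow>\<^sub>0 'r) set) = coset \<AA> X 0"
      using True by simp
    then have "\<one>\<^bsub>?A\<^esub> = \<zero>\<^bsub>?A\<^esub>" by (simp only: coset_one[OF assms(2)] coset_zero[OF assms(2)])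
    then show ?thesis using A.one_zeroD A.left_idealD(1,2)[OF assms(4)] by blast
  qed
  ultimately show ?thesis by (simp add: minimal_left_ideal_def)
next
  case False
  then have "full_subshift \<AA> X" using assms(2,3) by (simp add: full_subshift_def)
  then interpret subshift_ring "subshift_algebra \<AA> X" \<AA> X "p_elem \<AA> X"
    "\<lambda>a. coset \<AA> X (var (S a))" "\<lambda>a. coset \<AA> X (var (S_star a))"
    "\<lambda>c. coset \<AA> X (Poly_Mapping.single [] (c :: 'r))" "coset_act \<AA> X"
    by (rule subshift_ring_subshift_algebra)
  show ?thesis by (rule minimal_left_ideal_iff[OF assms(4)])
qed

end
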